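(* Let $F$ be a finite-dimensional irreducible $\mathfrak g_{\ge 0}$-module (so that $\mathfrak g_{>0}$ acts trivially on it). Then $\mathrm{Ind}(F)$ contains no (nonzero, homogeneous) singular vectors of degree greater than $3$.
   Context: Everything is over $\mathbb C$. Let $\Lambda(4)$ be the Grassmann superalgebra in the odd variables $\xi_1,\xi_2,\xi_3,\xi_4$, let $t$ be an even variable, $\partial_i=\partial/\partial\xi_i$ (left derivative), $p$ the parity. $K(1,4)_+$ is the space $\mathbb C[t]\otimes\Lambda(4)$ with Lie superbracket $$[f,g]=\Big(2f-\sum_{i}\xi_i\partial_i f\Big)\partial_t g-\partial_t f\Big(2g-\sum_i\xi_i\partial_i g\Big)+(-1)^{p(f)}\sum_{i}\partial_i f\,\partial_i g .$$ Write $\xi_{i_1\cdots i_r}=\xi_{i_1}\cdots\xi_{i_r}$. Let $\mathfrak g=K(1,4)_+\oplus\mathbb C C$ be the central extension (with $C$ even and central) with bracket $[a,b]_{\mathfrak g}=[a,b]+\psi(a,b)C$, where $\psi$ is the bilinear form with $\psi(a,b)=-(-1)^{p(a)p(b)}\psi(b,a)$ determined by $\psi(1,\xi_{1234})=-2$, $\psi(\xi_i,\partial_i\xi_{1234})=-1$ for $i=1,\dots,4$, all other values on pairs of basis monomials $t^m\xi_{i_1\cdots i_r}$ ($i_1<\dots<i_r$) being zero up to skew-symmetry. ($\mathfrak g$ is the annihilation superalgebra of the conformal superalgebra $K'_4$.) $\mathfrak g$ is $\mathbb Z$-graded by $\deg(t^m\xi_{i_1\cdots i_r})=2m+r-2$,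 $\deg C=0$; $\mathfrak g_{>0}$, $\mathfrak g_{\ge0}$, $\mathfrak g_{<0}$ denote the sums of the corresponding components. $\mathrm{Ind}(F)=U(\mathfrak g)\otimes_{U(\mathfrak g_{\ge0})}F\cong U(\mathfrak g_{<0})\otimes F$ as a vector space, graded by $\mathbb Z_{\ge 0}$ via minus the degree of $U(\mathfrak g_{<0})$. A singular vector is a vector annihilated by $\mathfrak g_{>0}$. *)

theory Defs
  imports
    Complex_Main
    "HOL-Computational_Algebra.Polynomial"
    "HOL-Library.Function_Algebras"
    "HOL-Library.Product_Plus"
    "HOL-Library.Poly_Mapping"
begin

section \<open>The superalgebra \<open>\<complex>[t] \<otimes> \<Lambda>(4)\<close>\<close>

datatype ix = X1 | X2 | X3 | X4

lemma UNIV_ix: "UNIV = {X1, X2, X3, X4}"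
  by (auto intro: ix.exhaust)

instance ix :: finite
  by standard (simp add: UNIV_ix)

fun pos :: "ix \<Rightarrow> nat" where
  "pos X1 = 1" | "pos X2 = 2" | "pos X3 = 3" | "pos X4 = 4"

text \<open>
  An element \<open>f\<close> stands for the sum over all \<open>I\<close> of \<open>f I * \<xi>\<^sub>I\<close>, where \<open>f I\<close> is a polynomial
  in \<open>t\<close> and \<open>\<xi>\<^sub>I\<close> is the product of the \<open>\<xi>\<^sub>i\<close> (\<open>i \<in> I\<close>) in increasing order.  Addition is the
  pointwise one; the pointwise product of \<open>HOL-Library.Function_Algebras\<close> is not used.
\<close>

type_synonym grass = "ix set \<Rightarrow> complex poly"

definition gmono :: "nat \<Rightarrow> ix set \<Rightarrow> grass" where
  "gmono m I = (\<lambda>J. if J = I then monom 1 m else 0)"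

definition gscale :: "complex \<Rightarrow> grass \<Rightarrow> grass" where
  "gscale c f = (\<lambda>I. smult c (f I))"

text \<open>\<open>\<xi>\<^sub>I \<xi>\<^sub>J = gsign I J * \<xi>\<^sub>(\<^sub>I \<^sub>\<union> \<^sub>J\<^sub>)\<close> for disjoint \<open>I\<close> and \<open>J\<close>.\<close>

definition gsign :: "ix set \<Rightarrow> ix set \<Rightarrow> complex" where
  "gsign I J = (- 1) ^ card {(i, j). i \<in> I \<and> j \<in> J \<and> pos j < pos i}"

definition gmul :: "grass \<Rightarrow> grass \<Rightarrow> grass" where
  "gmul f g = (\<lambda>K. \<Sum>I\<in>Pow K. smult (gsign I (K - I)) (f I * g (K - I)))"

definition d_t :: "grass \<Rightarrow> grass" where
  "d_t f = (\<lambda>I. pderiv (f I))"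

text \<open>The left derivative: \<open>\<partial>\<^sub>i(\<xi>\<^sub>i \<xi>\<^sub>I) = \<xi>\<^sub>I\<close> for \<open>i \<notin> I\<close>.\<close>

definition d_xi :: "ix \<Rightarrow> grass \<Rightarrow> grass" where
  "d_xi i f = (\<lambda>I. if i \<in> I then 0 else smult (gsign {i} I) (f (insert i I)))"

definition gparity :: "grass \<Rightarrow> grass" where
  "gparity f = (\<lambda>I. smult ((- 1) ^ card I) (f I))"

definition euler :: "grass \<Rightarrow> grass" where
  "euler f = (\<Sum>i\<in>UNIV. gmul (gmono 0 {i}) (d_xi i f))"


section \<open>The Lie superalgebra \<open>\<gg> = K(1,4)\<^sub>+ \<oplus> \<complex>C\<close>\<close>

text \<open>The sign \<open>(-1)\<^sup>p\<^sup>(\<^sup>f\<^sup>)\<close> is extended linearly to inhomogeneous \<open>f\<close> by \<open>gparity\<close>.\<close>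

definition K_bracket :: "grass \<Rightarrow> grass \<Rightarrow> grass" where
  "K_bracket f g =
     gmul (gscale 2 f - euler f) (d_t g) - gmul (d_t f) (gscale 2 g - euler g)
     + (\<Sum>i\<in>UNIV. gmul (d_xi i (gparity f)) (d_xi i g))"

definition gcoeff :: "grass \<Rightarrow> nat \<Rightarrow> ix set \<Rightarrow> complex" where
  "gcoeff f m I = poly.coeff (f I) m"

text \<open>
  Coordinates of the cocycle.  Since \<open>\<partial>\<^sub>i \<xi>\<^sub>1\<^sub>2\<^sub>3\<^sub>4\<close> is \<open>gsign {i} (- {i})\<close> times the monomial
  \<open>\<xi>\<^sub>(\<^sub>-\<^sub>{\<^sub>i\<^sub>}\<^sub>)\<close>, the value \<open>\<psi>(\<xi>\<^sub>i, \<partial>\<^sub>i \<xi>\<^sub>1\<^sub>2\<^sub>3\<^sub>4) = -1\<close> says \<open>\<psi>(\<xi>\<^sub>i, \<xi>\<^sub>(\<^sub>-\<^sub>{\<^sub>i\<^sub>}\<^sub>)) = - gsign {i} (- {i})\<close>;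
  super-skew-symmetry makes \<open>\<psi>\<close> antisymmetric on the even pair and symmetric on the odd pairs.
\<close>

definition psi :: "grass \<Rightarrow> grass \<Rightarrow> complex" where
  "psi f g =
     - 2 * (gcoeff f 0 {} * gcoeff g 0 UNIV - gcoeff f 0 UNIV * gcoeff g 0 {})
     - (\<Sum>i\<in>UNIV. gsign {i} (- {i}) *
          (gcoeff f 0 {i} * gcoeff g 0 (- {i}) + gcoeff f 0 (- {i}) * gcoeff g 0 {i}))"

text \<open>The pair \<open>(f, z)\<close> stands for \<open>f + z C\<close>.\<close>

type_synonym lie = "grass \<times> complex"

definition lie_scale :: "complex \<Rightarrow> lie \<Rightarrow> lie" where
  "lie_scale c x = (gscale c (fst x), c * snd x)"

definition lie_bracket :: "lie \<Rightarrow> lie \<Rightarrow> lie" where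
  "lie_bracket x y = (K_bracket (fst x) (fst y), psi (fst x) (fst y))"

text \<open>Homogeneous elements of parity \<open>p \<in> {0, 1}\<close>.\<close>

definition lie_part :: "nat \<Rightarrow> lie set" where
  "lie_part p = {x. (\<forall>I. fst x I \<noteq> 0 \<longrightarrow> card I mod 2 = p) \<and> (snd x \<noteq> 0 \<longrightarrow> p = 0)}"

text \<open>The degrees of the basis elements \<open>t\<^sup>m \<xi>\<^sub>I\<close> and \<open>C\<close> that occur in \<open>x\<close>.\<close>

definition lie_degrees :: "lie \<Rightarrow> int set" where
  "lie_degrees x = {2 * int m + int (card I) - 2 |m I. gcoeff (fst x) m I \<noteq> 0}
                   \<union> {d. d = 0 \<and> snd x \<noteq> 0}"

definition lie_comp :: "int \<Rightarrow> lie set" where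
  "lie_comp d = {x. lie_degrees x \<subseteq> {d}}"

definition lie_pos :: "lie set" where
  "lie_pos = {x. lie_degrees x \<subseteq> {0<..}}"

definition lie_nonneg :: "lie set" where
  "lie_nonneg = {x. lie_degrees x \<subseteq> {0..}}"


section \<open>The universal enveloping algebra\<close>

text \<open>Words form the free monoid, so \<open>'a word \<Rightarrow>\<^sub>0 complex\<close> is the free algebra on the set \<open>'a\<close>.\<close>

datatype 'a word = Word (letters: "'a list")

instantiation word :: (type) monoid_add
begin

definition zero_word :: "'a word" where
  "zero_word = Word []"

definition plus_word :: "'a word \<Rightarrow> 'a word \<Rightarrow> 'a word" where
  "plus_word u v = Word (letters u @ letters v)"

instance
  by standard (simp_all add: zero_word_def plus_word_def)

end

type_synonym free_alg = "lie word \<Rightarrow>\<^sub>0 complex"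

definition letter :: "lie \<Rightarrow> free_alg" where
  "letter x = Poly_Mapping.single (Word [x]) 1"

definition scalar :: "complex \<Rightarrow> free_alg" where
  "scalar c = Poly_Mapping.single 0 c"

text \<open>
  The first two families make \<^const>\<open>letter\<close> linear, turning the free algebra into the tensor
  algebra of \<open>\<gg>\<close>; the third imposes \<open>x y - (-1)\<^sup>p\<^sup>(\<^sup>x\<^sup>)\<^sup>p\<^sup>(\<^sup>y\<^sup>) y x = [x, y]\<close>.
\<close>

definition U_relators :: "free_alg set" where
  "U_relators =
     {letter (x + y) - letter x - letter y |x y. True}
     \<union> {letter (lie_scale c x) - scalar c * letter x |c x. True}
     \<union> {letter x * letter y - scalar ((- 1) ^ (p * q)) * letter y * letter x
           - letter (lie_bracket x y) |x y p q.
         p \<in> {0, 1} \<and> q \<in> {0, 1} \<and> x \<in> lie_part p \<and> y \<in> lie_part q}"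

text \<open>The two-sided ideal generated by the relators.\<close>

inductive_set U_ideal :: "free_alg set" where
  zero: "0 \<in> U_ideal"
| gen: "r \<in> U_relators \<Longrightarrow> a * r * b \<in> U_ideal"
| add: "a \<in> U_ideal \<Longrightarrow> b \<in> U_ideal \<Longrightarrow> a + b \<in> U_ideal"

lemma U_ideal_mult: "a \<in> U_ideal \<Longrightarrow> b * a * c \<in> U_ideal"
proof (induction rule: U_ideal.induct)
  case zero
  then show ?case by (simp add: U_ideal.zero)
next
  case (gen r a' b')
  then have "(b * a') * r * (b' * c) \<in> U_ideal" by (rule U_ideal.gen)
  then show ?case by (simp add: mult.assoc)
next
  case (add a' b')
  then show ?case by (simp add: distrib_left distrib_right U_ideal.add)
qed

lemma U_ideal_uminus: "a \<in> U_ideal \<Longrightarrow> - a \<in> U_ideal"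
  using U_ideal_mult[of a "- 1" 1] by simp

lemma U_ideal_diff: "a \<in> U_ideal \<Longrightarrow> b \<in> U_ideal \<Longrightarrow> a - b \<in> U_ideal"
  using U_ideal.add[OF _ U_ideal_uminus, of a b] by simp

definition U_rel :: "free_alg \<Rightarrow> free_alg \<Rightarrow> bool" where
  "U_rel a b \<longleftrightarrow> a - b \<in> U_ideal"

lemma U_rel_refl: "U_rel a a"
  by (simp add: U_rel_def U_ideal.zero)

lemma U_rel_add: "U_rel a b \<Longrightarrow> U_rel c d \<Longrightarrow> U_rel (a + c) (b + d)"
  unfolding U_rel_def by (drule (1) U_ideal.add) (simp add: algebra_simps)

lemma U_rel_uminus: "U_rel a b \<Longrightarrow> U_rel (- a) (- b)"
  unfolding U_rel_def by (drule U_ideal_uminus) (simp add: algebra_simps)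

lemma U_rel_mult:
  assumes "U_rel a b" "U_rel c d"
  shows "U_rel (a * c) (b * d)"
proof -
  have "1 * (a - b) * c \<in> U_ideal" "b * (c - d) * 1 \<in> U_ideal"
    using assms unfolding U_rel_def by (blast intro: U_ideal_mult)+
  then have "1 * (a - b) * c + b * (c - d) * 1 \<in> U_ideal" by (rule U_ideal.add)
  then show ?thesis unfolding U_rel_def by (simp add: algebra_simps)
qed

quotient_type U = free_alg / U_rel
proof (rule equivpI)
  show "reflp U_rel"
    by (rule reflpI) (rule U_rel_refl)
  show "symp U_rel"
    by (rule sympI) (unfold U_rel_def, drule U_ideal_uminus, simp)
  show "transp U_rel"
    by (rule transpI) (unfold U_rel_def, drule (1) U_ideal.add, simp)
qed

instantiation U :: ring
begin

lift_definition zero_U :: U is 0 .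
lift_definition plus_U :: "U \<Rightarrow> U \<Rightarrow> U" is "(+)" by (rule U_rel_add)
lift_definition uminus_U :: "U \<Rightarrow> U" is uminus by (rule U_rel_uminus)
lift_definition minus_U :: "U \<Rightarrow> U \<Rightarrow> U" is "(-)"
  unfolding U_rel_def by (drule (1) U_ideal_diff) (simp add: algebra_simps)
lift_definition times_U :: "U \<Rightarrow> U \<Rightarrow> U" is "(*)" by (rule U_rel_mult)

instance
  by standard (transfer; simp add: add_ac distrib_left distrib_right mult.assoc U_rel_refl)+

end

instantiation U :: monoid_mult
begin

lift_definition one_U :: U is 1 .

instance
  by standard (transfer; simp add: U_rel_refl)+

end

lift_definition U_scalar :: "complex \<Rightarrow> U" is scalar .

lift_definition iota :: "lie \<Rightarrow> U" is letter .

definition U_scale :: "complex \<Rightarrow> U \<Rightarrow> U" where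
  "U_scale c u = U_scalar c * u"

text \<open>
  The component of degree \<open>-k\<close> of \<open>U(\<gg>\<^sub><\<^sub>0)\<close>, viewed inside \<open>U(\<gg>)\<close>: it is spanned by the products
  of homogeneous elements of \<open>\<gg>\<^sub><\<^sub>0\<close> of total degree \<open>-k\<close>.
\<close>

definition U_neg :: "nat \<Rightarrow> U set" where
  "U_neg k = module.span U_scale
     {prod_list (map iota xs) |xs ds.
        list_all2 (\<lambda>x d. d < 0 \<and> x \<in> lie_comp d) xs ds \<and> sum_list ds = - int k}"


section \<open>Modules over \<open>\<gg>\<^sub>\<ge>\<^sub>0\<close>\<close>

text \<open>
  As usual for superalgebras, modules and submodules are \<open>\<int>/2\<close>-graded.  The action
  \<open>act\<close> is only meaningful on \<^const>\<open>lie_nonneg\<close>.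
\<close>

locale nonneg_module = vector_space scale
  for scale :: "complex \<Rightarrow> 'f \<Rightarrow> 'f::ab_group_add" +
  fixes part :: "nat \<Rightarrow> 'f set"
    and act :: "lie \<Rightarrow> 'f \<Rightarrow> 'f"
  assumes part_subspace: "p \<in> {0, 1} \<Longrightarrow> subspace (part p)"
    and part_disjoint: "part 0 \<inter> part 1 = {0}"
    and part_sum: "\<exists>v0\<in>part 0. \<exists>v1\<in>part 1. v = v0 + v1"
    and act_add_right: "x \<in> lie_nonneg \<Longrightarrow> act x (v + w) = act x v + act x w"
    and act_scale_right: "x \<in> lie_nonneg \<Longrightarrow> act x (scale c v) = scale c (act x v)"
    and act_add_left: "x \<in> lie_nonneg \<Longrightarrow> y \<in> lie_nonneg \<Longrightarrow> act (x + y) v = act x v + act y v"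
    and act_scale_left: "x \<in> lie_nonneg \<Longrightarrow> act (lie_scale c x) v = scale c (act x v)"
    and act_part: "p \<in> {0, 1} \<Longrightarrow> q \<in> {0, 1} \<Longrightarrow> x \<in> lie_nonneg \<Longrightarrow> x \<in> lie_part p \<Longrightarrow>
      v \<in> part q \<Longrightarrow> act x v \<in> part ((p + q) mod 2)"
    and act_bracket: "p \<in> {0, 1} \<Longrightarrow> q \<in> {0, 1} \<Longrightarrow> x \<in> lie_nonneg \<Longrightarrow> y \<in> lie_nonneg \<Longrightarrow>
      x \<in> lie_part p \<Longrightarrow> y \<in> lie_part q \<Longrightarrow>
      act (lie_bracket x y) v = act x (act y v) - scale ((- 1) ^ (p * q)) (act y (act x v))"
begin

definition graded_submodule :: "'f set \<Rightarrow> bool" where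
  "graded_submodule W \<longleftrightarrow>
     subspace W
     \<and> (\<forall>w\<in>W. \<exists>w0\<in>W \<inter> part 0. \<exists>w1\<in>W \<inter> part 1. w = w0 + w1)
     \<and> (\<forall>x\<in>lie_nonneg. \<forall>w\<in>W. act x w \<in> W)"

end

locale fd_irreducible_nonneg_module = nonneg_module scale part act
  for scale :: "complex \<Rightarrow> 'f \<Rightarrow> 'f::ab_group_add"
    and part :: "nat \<Rightarrow> 'f set"
    and act :: "lie \<Rightarrow> 'f \<Rightarrow> 'f" +
  assumes finite_dim: "\<exists>B. finite B \<and> span B = UNIV"
    and nonzero: "\<exists>v::'f. v \<noteq> 0"
    and irreducible: "graded_submodule W \<Longrightarrow> W = {0} \<or> W = UNIV"


section \<open>The induced module\<close>

text \<open>
  \<open>Ind(F)\<close> is the free complex vector space on symbols \<open>u \<otimes> v\<close> modulo bilinearity and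
  \<open>u x \<otimes> v = u \<otimes> x v\<close> for \<open>x \<in> \<gg>\<^sub>\<ge>\<^sub>0\<close>.  As \<open>\<gg>\<^sub>\<ge>\<^sub>0\<close> generates the algebra \<open>U(\<gg>\<^sub>\<ge>\<^sub>0)\<close>, this is the
  tensor product over \<open>U(\<gg>\<^sub>\<ge>\<^sub>0)\<close>.
\<close>

type_synonym 'f pre_ind = "(U \<times> 'f) \<Rightarrow>\<^sub>0 complex"

definition tens :: "U \<Rightarrow> 'f \<Rightarrow> 'f pre_ind" where
  "tens u v = Poly_Mapping.single (u, v) 1"

definition pre_scale :: "complex \<Rightarrow> 'f pre_ind \<Rightarrow> 'f pre_ind" where
  "pre_scale c T = Poly_Mapping.map (\<lambda>z. c * z) T"

definition ind_relators ::
    "(complex \<Rightarrow> 'f \<Rightarrow> 'f::ab_group_add) \<Rightarrow> (lie \<Rightarrow> 'f \<Rightarrow> 'f) \<Rightarrow> 'f pre_ind set" where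
  "ind_relators scale act =
     {tens (u + u') v - tens u v - tens u' v |u u' v. True}
     \<union> {tens u (v + v') - tens u v - tens u v' |u v v'. True}
     \<union> {tens (U_scale c u) v - pre_scale c (tens u v) |c u v. True}
     \<union> {tens u (scale c v) - pre_scale c (tens u v) |c u v. True}
     \<union> {tens (u * iota x) v - tens u (act x v) |u x v. x \<in> lie_nonneg}"

definition ind_rel ::
    "(complex \<Rightarrow> 'f \<Rightarrow> 'f::ab_group_add) \<Rightarrow> (lie \<Rightarrow> 'f \<Rightarrow> 'f) \<Rightarrow> ('f pre_ind \<times> 'f pre_ind) set" where
  "ind_rel scale act = {(S, T). S - T \<in> module.span pre_scale (ind_relators scale act)}"

definition ind_class ::
    "(complex \<Rightarrow> 'f \<Rightarrow> 'f::ab_group_add) \<Rightarrow> (lie \<Rightarrow> 'f \<Rightarrow> 'f) \<Rightarrow> 'f pre_ind \<Rightarrow> 'f pre_ind set" where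
  "ind_class scale act T = ind_rel scale act `` {T}"

definition Ind ::
    "(complex \<Rightarrow> 'f \<Rightarrow> 'f::ab_group_add) \<Rightarrow> (lie \<Rightarrow> 'f \<Rightarrow> 'f) \<Rightarrow> 'f pre_ind set set" where
  "Ind scale act = UNIV // ind_rel scale act"

definition ind_zero ::
    "(complex \<Rightarrow> 'f \<Rightarrow> 'f::ab_group_add) \<Rightarrow> (lie \<Rightarrow> 'f \<Rightarrow> 'f) \<Rightarrow> 'f pre_ind set" where
  "ind_zero scale act = ind_class scale act 0"

text \<open>Left multiplication by \<open>x \<in> \<gg>\<close>, which sends \<open>u \<otimes> v\<close> to \<open>x u \<otimes> v\<close>.\<close>

definition pre_act :: "lie \<Rightarrow> 'f pre_ind \<Rightarrow> 'f pre_ind" where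
  "pre_act x T = (\<Sum>(u, v)\<in>Poly_Mapping.keys T.
     pre_scale (Poly_Mapping.lookup T (u, v)) (tens (iota x * u) v))"

definition ind_act ::
    "(complex \<Rightarrow> 'f \<Rightarrow> 'f::ab_group_add) \<Rightarrow> (lie \<Rightarrow> 'f \<Rightarrow> 'f) \<Rightarrow> lie \<Rightarrow>
     'f pre_ind set \<Rightarrow> 'f pre_ind set" where
  "ind_act scale act x X = (\<Union>T\<in>X. ind_class scale act (pre_act x T))"

text \<open>The degree \<open>k\<close> part of \<open>Ind(F)\<close>: the sums of \<open>u \<otimes> v\<close> with \<open>u \<in> U(\<gg>\<^sub><\<^sub>0)\<close> of degree \<open>-k\<close>.\<close>

definition ind_comp ::
    "(complex \<Rightarrow> 'f \<Rightarrow> 'f::ab_group_add) \<Rightarrow> (lie \<Rightarrow> 'f \<Rightarrow> 'f) \<Rightarrow> nat \<Rightarrow> 'f pre_ind set set" where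
  "ind_comp scale act k =
     {ind_class scale act T |T. Poly_Mapping.keys T \<subseteq> U_neg k \<times> UNIV}"

definition singular ::
    "(complex \<Rightarrow> 'f \<Rightarrow> 'f::ab_group_add) \<Rightarrow> (lie \<Rightarrow> 'f \<Rightarrow> 'f) \<Rightarrow> 'f pre_ind set \<Rightarrow> bool" where
  "singular scale act X \<longleftrightarrow>
     X \<in> Ind scale act \<and> (\<forall>x\<in>lie_pos. ind_act scale act x X = ind_zero scale act)"


section \<open>The quotients are well defined\<close>

text \<open>
  The spans above are taken in vector spaces, and by \<open>ind_act_class\<close> the action on
  \<open>Ind(F)\<close> does not depend on representatives.
\<close>

lemma scalar_add: "scalar (a + b) = scalar a + scalar b"
  by (simp add: scalar_def single_add)
lemma scalar_mult: "scalar (a * b) = scalar a * scalar b"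
  by (simp add: scalar_def mult_single)

lemma U_scalar_add: "U_scalar (a + b) = U_scalar a + U_scalar b"
  by transfer (simp only: scalar_add U_rel_refl)

lemma U_scalar_mult: "U_scalar (a * b) = U_scalar a * U_scalar b"
  by transfer (simp only: scalar_mult U_rel_refl)

lemma U_scalar_one: "U_scalar 1 = 1"
  by transfer (simp add: scalar_def U_rel_refl)

lemma vector_space_U: "vector_space U_scale"
  by standard (simp_all add: U_scale_def U_scalar_add U_scalar_mult U_scalar_one
      distrib_left distrib_right mult.assoc)

lemma lookup_pre_scale: "Poly_Mapping.lookup (pre_scale c T) p = c * Poly_Mapping.lookup T p"
  by (simp add: pre_scale_def Poly_Mapping.map.rep_eq when_def)

lemma vector_space_pre: "vector_space pre_scale"
  unfolding vector_space_def
  by (auto intro!: poly_mapping_eqI simp: lookup_pre_scale lookup_add algebra_simps)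

interpretation pre: vector_space pre_scale by (rule vector_space_pre)

lemma pre_act_superset:
  assumes "finite A" "Poly_Mapping.keys T \<subseteq> A"
  shows "pre_act x T = (\<Sum>(u, v)\<in>A. pre_scale (Poly_Mapping.lookup T (u, v)) (tens (iota x * u) v))"
  unfolding pre_act_def using assms
  by (intro sum.mono_neutral_left) (auto simp: in_keys_iff)

lemma pre_act_add: "pre_act x (S + T) = pre_act x S + pre_act x T"
proof -
  let ?A = "Poly_Mapping.keys S \<union> Poly_Mapping.keys T"
  have "finite ?A" "Poly_Mapping.keys (S + T) \<subseteq> ?A" using keys_add[of S T] by auto
  moreover have "Poly_Mapping.keys S \<subseteq> ?A" "Poly_Mapping.keys T \<subseteq> ?A" by auto
  ultimately show ?thesis
    by (simp add: pre_act_superset[of ?A] case_prod_beta' lookup_add pre.scale_left_distrib sum.distrib)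
qed

lemma pre_act_scale: "pre_act x (pre_scale c T) = pre_scale c (pre_act x T)"
proof -
  have "Poly_Mapping.keys (pre_scale c T) \<subseteq> Poly_Mapping.keys T"
    by (auto simp: in_keys_iff lookup_pre_scale)
  then show ?thesis
    by (simp add: pre_act_superset[of "Poly_Mapping.keys T"] case_prod_beta' lookup_pre_scale
        pre.scale_sum_right)
qed

lemma pre_act_tens: "pre_act x (tens u v) = tens (iota x * u) v"
  by (simp add: pre_act_def tens_def lookup_single)


lemma scalar_central: "scalar c * a = a * scalar c"
proof (induction a rule: update_induct)
  case const
  show ?case by simp
next
  case (update f w z)
  have "Poly_Mapping.update w z f = f + Poly_Mapping.single w z"
    using update by (auto intro!: poly_mapping_eqI simp: lookup_update lookup_add lookup_single in_keys_iff)
  then show ?case using update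
    by (simp add: scalar_def mult_single algebra_simps)
qed

lemma U_scale_mult_right: "iota x * U_scale c u = U_scale c (iota x * u)"
  unfolding U_scale_def
proof transfer
  fix x c u
  have "letter x * (scalar c * u) = scalar c * (letter x * u)"
    by (simp only: mult.assoc[symmetric] scalar_central[of c "letter x"])
  then show "U_rel (letter x * (scalar c * u)) (scalar c * (letter x * u))"
    by (simp only: U_rel_refl)
qed

lemma pre_act_diff: "pre_act x (S - T) = pre_act x S - pre_act x T"
  using pre_act_add[of x "S - T" T] by simp

lemma ind_relatorsI:
  "tens (u + u') v - tens u v - tens u' v \<in> ind_relators scale act"
  "tens u (v + v') - tens u v - tens u v' \<in> ind_relators scale act"
  "tens (U_scale c u) v - pre_scale c (tens u v) \<in> ind_relators scale act"
  "tens u (scale c v) - pre_scale c (tens u v) \<in> ind_relators scale act"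
  "x \<in> lie_nonneg \<Longrightarrow> tens (u * iota x) v - tens u (act x v) \<in> ind_relators scale act"
  unfolding ind_relators_def by blast+

lemma pre_act_relators:
  assumes "T \<in> ind_relators scale act"
  shows "pre_act x T \<in> ind_relators scale act"
proof -
  note eqs = pre_act_diff pre_act_scale pre_act_tens distrib_left U_scale_mult_right
    mult.assoc[symmetric]
  consider u u' v where "T = tens (u + u') v - tens u v - tens u' v"
    | u v v' where "T = tens u (v + v') - tens u v - tens u v'"
    | c u v where "T = tens (U_scale c u) v - pre_scale c (tens u v)"
    | c u v where "T = tens u (scale c v) - pre_scale c (tens u v)"
    | u y v where "T = tens (u * iota y) v - tens u (act y v)" "y \<in> lie_nonneg"
    using assms unfolding ind_relators_def by blast
  then show ?thesis
    by cases (simp_all only: eqs ind_relatorsI)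
qed

lemma pre_act_span:
  assumes "T \<in> pre.span (ind_relators scale act)"
  shows "pre_act x T \<in> pre.span (ind_relators scale act)"
proof -
  interpret lin: Vector_Spaces.linear pre_scale pre_scale "pre_act x"
    by unfold_locales (simp_all add: pre_act_add pre_act_scale)
  show ?thesis using assms
    by (induction rule: pre.span_induct_alt)
      (simp_all add: pre_act_add pre_act_scale lin.zero pre.span_zero pre.span_add pre.span_scale
        pre.span_base pre_act_relators)
qed

lemma equiv_ind_rel: "equiv UNIV (ind_rel scale act)"
proof (rule equivI)
  show "refl (ind_rel scale act)"
    by (rule refl_onI) (simp_all add: ind_rel_def pre.span_zero)
  show "sym (ind_rel scale act)"
    by (rule symI) (unfold ind_rel_def, drule CollectD, drule case_prodD, drule pre.span_neg, simp)
  show "trans (ind_rel scale act)"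
    by (rule transI) (unfold ind_rel_def, drule CollectD, drule CollectD, drule case_prodD,
      drule case_prodD, drule (1) pre.span_add, simp)
qed auto

lemma pre_act_cong: "(S, T) \<in> ind_rel scale act \<Longrightarrow> (pre_act x S, pre_act x T) \<in> ind_rel scale act"
  by (simp add: ind_rel_def pre_act_diff[symmetric] pre_act_span)

lemma ind_act_class: "ind_act scale act x (ind_class scale act T) = ind_class scale act (pre_act x T)"
  unfolding ind_act_def ind_class_def
  by (rule UN_equiv_class[OF equiv_ind_rel]) 
    (auto intro!: congruentI equiv_class_eq[OF equiv_ind_rel] pre_act_cong)

end

theory Submission
  imports Defs "HOL-Computational_Algebra.Fundamental_Theorem_Algebra"
begin

text \<open>
  As a vector space \<open>Ind(F) = \<complex>[\<Theta>] \<otimes> \<Lambda>(\<eta>\<^sub>1, \<dots>, \<eta>\<^sub>4) \<otimes> F\<close>.  That the monomials \<open>\<Theta>\<^sup>a \<eta>\<^sub>I\<close> are independent is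
  shown by letting \<open>\<gg>\<close> act on the space on the right: the action is forced by commuting an element
  past the leading factor of a monomial, and since \<open>\<gg>\<^sub><\<^sub>0\<close> is generated by the \<open>\<xi>\<^sub>i\<close>, the Jacobi
  identities that involve some \<open>\<xi>\<^sub>i\<close> suffice to make it a representation.

  The element \<open>t\<close> acts by the degree, so an eigenvector of \<open>t\<close> in \<open>F\<close> whose eigenvalue has maximal real
  part is killed by \<open>\<gg>\<^sub>>\<^sub>0\<close>; by irreducibility \<open>\<gg>\<^sub>>\<^sub>0\<close> kills \<open>F\<close>.

  Let \<open>m\<close> be a singular vector of degree \<open>k > 3\<close>.  Because \<open>[1, t \<xi>\<^sub>i] = 2 \<xi>\<^sub>i\<close>, the part of lowest order in
  \<open>\<Theta>\<close> of \<open>t \<xi>\<^sub>i m\<close> comes from \<open>\<Theta>\<^sup>a \<mapsto> - 2 a \<Theta>\<^sup>a\<^sup>-\<^sup>1 \<eta>\<^sub>i\<close>; so the lowest coefficient of \<open>m\<close>, at \<open>\<Theta>\<^sup>a \<eta>\<^sub>I\<close>, vanishes as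
  soon as \<open>a > 0\<close> and some \<open>i\<close> is not in \<open>I\<close>.  For \<open>k > 3\<close> the only other coefficient is the vector \<open>w\<close> at
  \<open>\<Theta>\<^sup>a \<eta>\<^sub>1\<^sub>2\<^sub>3\<^sub>4\<close> for \<open>k = 2 a + 4\<close>.  The part of \<open>\<xi>\<^sub>1\<^sub>2\<^sub>3 m\<close> in \<open>\<Theta>\<^sup>a \<Lambda>\<^sup>3\<close> shows that \<open>\<xi>\<^sub>1\<^sub>2\<close>, \<open>\<xi>\<^sub>1\<^sub>3\<close> and \<open>\<xi>\<^sub>2\<^sub>3\<close>
  kill \<open>w\<close>; then \<open>t \<xi>\<^sub>1 m = t \<xi>\<^sub>2 m = 0\<close> kills the coefficients at \<open>\<Theta>\<^sup>a\<^sup>+\<^sup>1 \<eta>\<^sub>i\<^sub>4\<close>, and what remains of the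
  coefficient of \<open>\<xi>\<^sub>1\<^sub>2\<^sub>3 m\<close> at \<open>\<Theta>\<^sup>a\<^sup>+\<^sup>1 \<eta>\<^sub>4\<close> is a nonzero multiple of \<open>w\<close>.
\<close>

section \<open>The Grassmann algebra and the bracket of \<open>K(1,4)\<^sub>+\<close>\<close>

lemma sum_Pow_insert:
  assumes "finite A" "a \<notin> A"
  shows "sum f (Pow (insert a A)) = sum f (Pow A) + (\<Sum>I\<in>Pow A. f (insert a I))"
proof -
  have "inj_on (insert a) (Pow A)"
    using assms(2) by (auto simp: inj_on_def)
  moreover have "Pow A \<inter> insert a ` Pow A = {}" using assms(2) by auto
  ultimately show ?thesis
    using assms(1) by (simp add: Pow_insert sum.union_disjoint sum.reindex)
qed

lemma finite_ix [simp]: "finite (A :: ix set)"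
  by (rule finite_subset[OF subset_UNIV finite])

text \<open>In product form the sign is visibly multiplicative in each argument, and rewriting
  evaluates it on explicit sets.\<close>

lemma gsign_prod: "gsign I J = (\<Prod>i\<in>I. \<Prod>j\<in>J. if pos j < pos i then - 1 else 1)"
proof -
  let ?P = "\<lambda>p. pos (snd p) < pos (fst p)"
  have "(\<Prod>i\<in>I. \<Prod>j\<in>J. if pos j < pos i then - 1 else (1 :: complex))
    = (\<Prod>p\<in>I \<times> J. if ?P p then - 1 else 1)"
    by (simp only: prod.cartesian_product case_prod_beta')
  also have "\<dots> = (- 1) ^ card (I \<times> J \<inter> Collect ?P)"
    by (subst prod.If_cases) simp_all
  also have "I \<times> J \<inter> Collect ?P = {(i, j). i \<in> I \<and> j \<in> J \<and> pos j < pos i}" by auto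
  finally show ?thesis by (simp only: gsign_def)
qed

text \<open>With only sixteen subsets, sign identities in \<Lambda>(4) can be checked set by
  set.\<close>

lemma ix_set_cases:
  fixes K :: "ix set"
  obtains "K = {}" | "K = {X1}" | "K = {X2}" | "K = {X3}" | "K = {X4}"
    | "K = {X1, X2}" | "K = {X1, X3}" | "K = {X1, X4}" | "K = {X2, X3}" | "K = {X2, X4}"
    | "K = {X3, X4}" | "K = {X1, X2, X3}" | "K = {X1, X2, X4}" | "K = {X1, X3, X4}"
    | "K = {X2, X3, X4}" | "K = {X1, X2, X3, X4}"
proof -
  have "K \<in> Pow {X1, X2, X3, X4}" using UNIV_ix by auto
  then show thesis
    unfolding Pow_insert Pow_empty image_Un image_insert image_empty Un_insert_left Un_empty_left
      insert_iff empty_iff simp_thms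
    by (elim disjE; metis that)
qed

text \<open>Oriented towards increasing indices, so that set literals are rewritten to a normal
  form.\<close>

lemmas ix_sort = insert_commute[of X2 X1] insert_commute[of X3 X1] insert_commute[of X4 X1]
  insert_commute[of X3 X2] insert_commute[of X4 X2] insert_commute[of X4 X3]

lemmas grass_eval = sum_Pow_insert gsign_prod insert_Diff_if ix_sort

abbreviation gxi :: "ix \<Rightarrow> grass" where "gxi i \<equiv> gmono 0 {i}"

abbreviation gone :: grass where "gone \<equiv> gmono 0 {}"

section \<open>Linearity of the operations on \<complex>[t] \<otimes> \<Lambda>(4)\<close>

lemma smult_sum: "smult c (sum f A) = (\<Sum>a\<in>A. smult c (f a))"
  by (induction A rule: infinite_finite_induct) (simp_all add: smult_add_right)

lemma pderiv_sum: "pderiv (sum f A) = (\<Sum>a\<in>A. pderiv (f a))"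
  by (induction A rule: infinite_finite_induct) (simp_all add: pderiv_add)

lemma sum_grass: "sum f A K = (\<Sum>a\<in>A. (f a :: grass) K)"
  by (induction A rule: infinite_finite_induct) simp_all

lemma gmul_add_left: "gmul (f + f') g = gmul f g + gmul f' g"
  by (rule ext) (simp add: gmul_def distrib_right smult_add_right sum.distrib)

lemma gmul_add_right: "gmul f (g + g') = gmul f g + gmul f g'"
  by (rule ext) (simp add: gmul_def distrib_left smult_add_right sum.distrib)

lemma gmul_scale_left: "gmul (gscale c f) g = gscale c (gmul f g)"
  by (rule ext) (simp add: gmul_def gscale_def smult_sum mult.commute)

lemma gmul_scale_right: "gmul f (gscale c g) = gscale c (gmul f g)"
  by (rule ext) (simp add: gmul_def gscale_def smult_sum mult.commute)

lemma gmul_zero [simp]: "gmul 0 g = 0" "gmul f 0 = 0"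
  by (auto simp: gmul_def)

lemma d_t_add: "d_t (f + g) = d_t f + d_t g" by (rule ext) (simp add: d_t_def pderiv_add)

lemma d_t_scale: "d_t (gscale c f) = gscale c (d_t f)"
  by (rule ext) (simp add: d_t_def gscale_def pderiv_smult)

lemma d_xi_add: "d_xi i (f + g) = d_xi i f + d_xi i g"
  by (rule ext) (simp add: d_xi_def smult_add_right)

lemma d_xi_scale: "d_xi i (gscale c f) = gscale c (d_xi i f)"
  by (rule ext) (simp add: d_xi_def gscale_def mult_ac)

lemma gparity_add: "gparity (f + g) = gparity f + gparity g"
  by (rule ext) (simp add: gparity_def smult_add_right)

lemma gparity_scale: "gparity (gscale c f) = gscale c (gparity f)"
  by (rule ext) (simp add: gparity_def gscale_def mult_ac)

lemma gscale_add: "gscale c (f + g) = gscale c f + gscale c g"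
  by (rule ext) (simp add: gscale_def smult_add_right)

lemma gscale_gscale: "gscale c (gscale d f) = gscale (c * d) f"
  by (rule ext) (simp add: gscale_def)

lemma gscale_minus_one: "gscale (- 1) f = - f"
  by (rule ext) (simp add: gscale_def)

lemma gscale_one [simp]: "gscale 1 f = f"
  by (rule ext) (simp add: gscale_def)

lemma d_t_zero [simp]: "d_t 0 = 0"
  by (rule ext) (simp add: d_t_def)

lemma d_t_minus: "d_t (- f) = - d_t f"
  using d_t_scale[of "- 1" f] by (simp only: gscale_minus_one)

lemma d_t_diff: "d_t (f - g) = d_t f - d_t g"
  using d_t_add[of f "- g"] by (simp add: d_t_minus)

lemma d_xi_zero [simp]: "d_xi i 0 = 0"
  by (rule ext) (simp add: d_xi_def)

lemma d_xi_minus: "d_xi i (- f) = - d_xi i f"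
  using d_xi_scale[of i "- 1" f] by (simp only: gscale_minus_one)

lemma d_xi_diff: "d_xi i (f - g) = d_xi i f - d_xi i g"
  using d_xi_add[of i f "- g"] by (simp add: d_xi_minus)

lemma gparity_zero [simp]: "gparity 0 = 0"
  by (rule ext) (simp add: gparity_def)

lemma gparity_minus: "gparity (- f) = - gparity f"
  using gparity_scale[of "- 1" f] by (simp only: gscale_minus_one)

lemma gparity_diff: "gparity (f - g) = gparity f - gparity g"
  using gparity_add[of f "- g"] by (simp add: gparity_minus)

lemma gmul_minus_left: "gmul (- f) g = - gmul f g"
  using gmul_scale_left[of "- 1" f g] by (simp only: gscale_minus_one)

lemma gmul_minus_right: "gmul f (- g) = - gmul f g"
  using gmul_scale_right[of f "- 1" g] by (simp only: gscale_minus_one)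

lemma gmul_diff_left: "gmul (f - f') g = gmul f g - gmul f' g"
  using gmul_add_left[of f "- f'" g] by (simp add: gmul_minus_left)

lemma gmul_diff_right: "gmul f (g - g') = gmul f g - gmul f g'"
  using gmul_add_right[of f g "- g'"] by (simp add: gmul_minus_right)

lemma gscale_zero [simp]: "gscale 0 f = 0" "gscale c 0 = 0"
  by (auto simp: gscale_def)

lemma gscale_add_left: "gscale (c + d) f = gscale c f + gscale d f"
  by (rule ext) (simp add: gscale_def smult_add_left)

lemma gscale_diff: "gscale c (f - g) = gscale c f - gscale c g"
  by (rule ext) (simp add: gscale_def smult_diff_right)

lemma gscale_two: "gscale 2 f = f + f"
  using gscale_add_left[of 1 1 f] by simp

section \<open>Derivations, parity and the Euler operator\<close>

lemma gsign_empty [simp]: "gsign {} J = 1" "gsign I {} = 1"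
  by (simp_all add: gsign_def)

lemma gsign_squared [simp]: "gsign I J * gsign I J = 1"
  by (simp add: gsign_def flip: power_add mult_2)

lemma gmul_gxi: "gmul (gxi i) g K = (if i \<in> K then smult (gsign {i} (K - {i})) (g (K
  - {i})) else 0)"
proof -
  have "gmul (gxi i) g K = (\<Sum>I\<in>Pow K. if I = {i} then smult (gsign {i} (K - {i})) (g (K
      - {i})) else 0)"
    unfolding gmul_def by (rule sum.cong) (auto simp: gmono_def monom_0)
  then show ?thesis by simp
qed

text \<open>Each \<xi>_i \<partial>_i fixes the monomials that contain i, because its two signs are
  equal and cancel, and kills the others.\<close>

lemma euler_eq: "euler f = (\<lambda>I. smult (of_nat (card I)) (f I))"
proof
  fix K
  have "euler f K = (\<Sum>i\<in>UNIV. if i \<in> K then f K else 0)"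
    unfolding euler_def sum_grass by (simp add: gmul_gxi d_xi_def insert_absorb cong: if_cong)
  also have "\<dots> = smult (of_nat (card K)) (f K)"
    by (simp add: sum.If_cases of_nat_poly)
  finally show "euler f K = smult (of_nat (card K)) (f K)" .
qed

lemma gmul_gone [simp]: "gmul gone f = f"
proof
  fix K
  have "gmul gone f K = (\<Sum>I\<in>Pow K. if I = {} then f K else 0)"
    unfolding gmul_def by (rule sum.cong) (auto simp: gmono_def monom_0)
  then show "gmul gone f K = f K" by simp
qed

lemma gmul_gone_right [simp]: "gmul f gone = f"
proof
  fix K
  have "gmul f gone K = (\<Sum>I\<in>Pow K. if I = K then f K else 0)"
    unfolding gmul_def by (rule sum.cong) (auto simp: gmono_def monom_0)
  then show "gmul f gone K = f K" by simp
qed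

lemma d_t_gmul: "d_t (gmul f g) = gmul (d_t f) g + gmul f (d_t g)"
  by (rule ext) (simp add: d_t_def gmul_def pderiv_sum pderiv_smult pderiv_mult smult_add_right
      sum.distrib mult.commute[of "pderiv (f _)"])

lemma gparity_gparity [simp]: "gparity (gparity f) = f"
  by (rule ext) (simp add: gparity_def flip: power_add mult_2)

lemma gparity_gmul: "gparity (gmul f g) = gmul (gparity f) (gparity g)"
proof
  fix K :: "ix set"
  have "(- 1 :: complex) ^ card K = (- 1) ^ card I * (- 1) ^ card (K - I)" if "I \<subseteq> K" for I
  proof -
    have "card K = card I + card (K - I)"
      using card_mono[of K I] that by (simp add: card_Diff_subset)
    then show ?thesis by (simp only: power_add)
  qed
  then show "gparity (gmul f g) K = gmul (gparity f) (gparity g) K"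
    unfolding gparity_def gmul_def smult_sum by (intro sum.cong) (auto simp: mult_ac)
qed

lemma gparity_d_t: "gparity (d_t f) = d_t (gparity f)"
  by (rule ext) (simp add: gparity_def d_t_def pderiv_smult)

lemma gparity_d_xi: "gparity (d_xi i f) = - d_xi i (gparity f)"
  by (rule ext) (simp add: gparity_def d_xi_def mult_ac)

lemma gparity_euler: "gparity (euler f) = euler (gparity f)"
  by (rule ext) (simp add: gparity_def euler_eq mult_ac)

lemma d_t_d_xi: "d_t (d_xi i f) = d_xi i (d_t f)"
  by (rule ext) (simp add: d_t_def d_xi_def pderiv_smult)

lemma d_t_euler: "d_t (euler f) = euler (d_t f)"
  by (rule ext) (simp add: d_t_def euler_eq pderiv_smult)

lemma gsign_insert_right: "j \<notin> J \<Longrightarrow> gsign I (insert j J) = gsign I {j} * gsign I J"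
  by (simp add: gsign_prod prod.distrib)

lemma gsign_swap: "i \<noteq> j \<Longrightarrow> gsign {i} {j} = - gsign {j} {i}"
  by (cases i; cases j; simp add: gsign_prod)

lemma d_xi_d_xi: "d_xi i (d_xi j f) = - d_xi j (d_xi i f)"
proof
  fix K
  have "gsign {i} K * gsign {j} (insert i K) = - (gsign {j} K * gsign {i} (insert j K))"
    if "i \<notin> K" "j \<notin> K" "i \<noteq> j"
    by (simp only: gsign_insert_right[OF that(1)] gsign_insert_right[OF that(2)] gsign_swap[OF
        that(3)])
      simp
  then have "i \<notin> K \<Longrightarrow> j \<notin> K \<Longrightarrow> i \<noteq> j \<Longrightarrow>
    smult (gsign {i} K) (smult (gsign {j} (insert i K)) p) =
    - smult (gsign {j} K) (smult (gsign {i} (insert j K)) p)" for p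
    by (simp only: smult_smult smult_minus_left[symmetric] simp_thms)
  then show "d_xi i (d_xi j f) K = (- d_xi j (d_xi i f)) K"
    by (simp add: d_xi_def insert_commute)
qed

lemma d_xi_gone [simp]: "d_xi i gone = 0" by (rule ext) (simp add: d_xi_def gmono_def)

lemma d_xi_gxi: "d_xi i (gxi j) = (if i = j then gone else 0)"
  by (rule ext) (auto simp: d_xi_def gmono_def gsign_def)

lemma gparity_gxi: "gparity (gxi i) = - gxi i"
  by (rule ext) (simp add: gparity_def gmono_def minus_monom monom_0 one_pCons)

lemma gparity_gone: "gparity gone = gone" by (rule ext) (simp add: gparity_def gmono_def)

lemma d_t_gmono_0 [simp]: "d_t (gmono 0 I) = 0" by (rule ext) (simp add: d_t_def gmono_def monom_0)

lemma euler_gmono: "euler (gmono m I) = gscale (of_nat (card I)) (gmono m I)"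
  by (rule ext) (simp add: euler_eq gmono_def gscale_def)

text \<open>The super Leibniz rule. Having \<open>gparity f\<close> in place of a sign keeps it
  linear in f, so that it applies to inhomogeneous f; the same device recurs below.\<close>

lemma d_xi_gmul: "d_xi i (gmul f g) = gmul (d_xi i f) g + gmul (gparity f) (d_xi i g)"
proof
  fix K show "d_xi i (gmul f g) K = (gmul (d_xi i f) g + gmul (gparity f) (d_xi i g)) K"
    by (cases i; cases K rule: ix_set_cases;
      simp add: d_xi_def gmul_def gparity_def grass_eval smult_add_right add_ac mult_ac)
qed

text \<open>Associativity with an odd generator in front is what makes ad \<xi>_i a derivation of
  the product.\<close>

lemma gxi_gmul: "gmul (gxi i) (gmul f g) = gmul (gmul (gxi i) f) g"
proof
  fix K show "gmul (gxi i) (gmul f g) K = gmul (gmul (gxi i) f) g K"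
    by (cases i; cases K rule: ix_set_cases;
      simp add: gmul_gxi gmul_def[of f g] gmul_def[of
          "gmul _ _"] grass_eval smult_add_right add_ac mult_ac)
qed

lemma gmul_gxi_right: "gmul f (gmul (gxi i) g) = gmul (gmul (gxi i) (gparity f)) g"
proof
  fix K show "gmul f (gmul (gxi i) g) K = gmul (gmul (gxi i) (gparity f)) g K"
    by (cases i; cases K rule: ix_set_cases;
      simp add: gmul_gxi gmul_def[of f] gmul_def[of
          "gmul _ _"] gparity_def grass_eval smult_add_right add_ac mult_ac)
qed

lemma d_t_gxi_gmul: "d_t (gmul (gxi i) f) = gmul (gxi i) (d_t f)"
  by (simp add: d_t_gmul)

lemma d_xi_gxi_gmul: "d_xi i (gmul (gxi j) f) = (if i = j then f else 0) - gmul (gxi j) (d_xi i f)"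
  by (simp add: d_xi_gmul d_xi_gxi gparity_gxi gmul_minus_left)

lemma euler_gxi_gmul: "euler (gmul (gxi i) f) = gmul (gxi i) f + gmul (gxi i) (euler f)"
proof
  fix K
  show "euler (gmul (gxi i) f) K = (gmul (gxi i) f + gmul (gxi i) (euler f)) K"
    using card_Suc_Diff1[of K i]
    by (auto simp: euler_eq gmul_gxi mult_ac left_diff_distrib smult_diff_left)
qed

lemma euler_d_xi: "euler (d_xi i f) = d_xi i (euler f) - d_xi i f"
  by (rule ext) (simp add: euler_eq d_xi_def smult_add_left smult_add_right mult.commute)

lemma euler_add: "euler (f + g) = euler f + euler g"
  by (rule ext) (simp add: euler_eq smult_add_right)

lemma euler_scale: "euler (gscale c f) = gscale c (euler f)"
  by (rule ext) (simp add: euler_eq gscale_def mult_ac)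

lemma euler_diff: "euler (f - g) = euler f - euler g"
  by (rule ext) (simp add: euler_eq smult_diff_right)

lemma gmul_gxi_comm: "gmul f (gxi i) = gmul (gxi i) (gparity f)"
  using gmul_gxi_right[of f i gone] by simp

section \<open>The operators ad 1 and ad \<xi>_i on K(1,4)_+\<close>

lemma K_bracket_gxi: "K_bracket (gxi i) f = gmul (gxi i) (d_t f) - d_xi i f"
  by (cases i) (simp_all add: K_bracket_def euler_gmono gparity_gxi d_xi_minus d_xi_gxi UNIV_ix
    gmul_minus_left gscale_two)

lemma K_bracket_gone: "K_bracket gone f = gscale 2 (d_t f)"
  by (simp add: K_bracket_def euler_gmono gparity_gone gmul_scale_left gscale_zero)

lemma K_bracket_gone_right: "K_bracket f gone = - K_bracket gone f"
  by (simp add: K_bracket_gone) (simp add: K_bracket_def euler_gmono gscale_zero gmul_scale_right)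

lemma K_bracket_gxi_right: "K_bracket f (gxi i) = - K_bracket (gxi i) (gparity f)"
  unfolding K_bracket_gxi
  by (cases i) (simp_all add: K_bracket_def euler_gmono d_xi_gxi UNIV_ix gscale_two gmul_gxi_comm
      gparity_d_t)

text \<open>The operator Q = ad \<xi>_i is an odd superderivation of the product and commutes with
  \<partial>_t. Commuting it with N = 2 - E, where E is the Euler operator, and anticommuting it
  with \<partial>_i produce one correction each, and these cancel in the bracket.\<close>

lemma K_bracket_jacobi:
  "K_bracket (gxi i) (K_bracket f g) = K_bracket (K_bracket (gxi i) f) g
    + K_bracket (gparity f) (K_bracket (gxi i) g)"
proof -
  define N where "N h = gscale 2 h - euler h" for h
  define Q where "Q h = gmul (gxi i) (d_t h) - d_xi i h" for h
  define R where "R h = gmul (gxi i) (d_t h) + d_xi i h" for h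
  have Q_add: "Q (h + k) = Q h + Q k" for h k
    by (simp add: Q_def d_t_add d_xi_add gmul_add_right)
  have Q_minus: "Q (- h) = - Q h" for h
    by (simp add: Q_def d_t_minus d_xi_minus gmul_minus_right)
  have Q_diff: "Q (h - k) = Q h - Q k" for h k
    using Q_add[of h "- k"] by (simp add: Q_minus)
  have Q_gmul: "Q (gmul h k) = gmul (Q h) k + gmul (gparity h) (Q k)" for h k
    by (simp add: Q_def d_t_gmul d_xi_gmul gmul_add_left gmul_add_right gmul_diff_left
      gmul_diff_right gxi_gmul gmul_gxi_right gparity_gmul)
  \<comment> \<open>Multiplication by \<xi>_i raises the Euler degree and \<partial>_i lowers it, so
    the correction R differs from Q in the sign of \<partial>_i.\<close>
  have Q_N: "Q (N h) = N (Q h) + R h" for h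
    by (simp add: Q_def N_def R_def d_t_diff d_xi_diff d_t_scale d_xi_scale gmul_diff_right
      gmul_scale_right euler_diff euler_gxi_gmul euler_d_xi d_t_euler gscale_diff algebra_simps)
  have Q_d_t: "Q (d_t h) = d_t (Q h)" for h
    by (simp add: Q_def d_t_diff d_t_gxi_gmul d_t_d_xi)
  have Q_d_xi: "Q (d_xi j h) = - d_xi j (Q h) + (if i = j then d_t h else 0)" for j h
    using d_xi_d_xi[of i j h]
    by (simp add: Q_def d_xi_diff d_xi_gxi_gmul d_t_d_xi)
  have Q_parity: "gparity (Q h) = - Q (gparity h)" for h
    by (simp add: Q_def gparity_diff gparity_gmul gparity_gxi gparity_d_t gparity_d_xi
        gmul_minus_left)
  have N_parity: "gparity (N h) = N (gparity h)" for h
    by (simp add: N_def gparity_diff gparity_scale gparity_euler)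
  have br: "K_bracket h k = gmul (N h) (d_t k) - gmul (d_t h) (N k)
    + (\<Sum>j\<in>UNIV. gmul (d_xi j (gparity h)) (d_xi j k))" for h k
    by (simp add: K_bracket_def N_def)
  have Q_0: "Q 0 = 0" by (simp add: Q_def)
  have Q_sum: "Q (sum F A) = (\<Sum>a\<in>A. Q (F a))" for F and A :: "ix set"
  proof (induction A rule: infinite_finite_induct)
    case (insert a A)
    then show ?case by (simp only: sum.insert[OF insert.hyps] Q_add)
  qed (simp_all only: sum.infinite sum.empty not_False_eq_True Q_0)
  have pt: "Q (gmul (d_xi j (gparity f)) (d_xi j g)) =
      gmul (d_xi j (gparity (Q f))) (d_xi j g) + gmul (d_xi j f) (d_xi j (Q g))
      + (if i = j then gmul (d_t (gparity f)) (d_xi i g) - gmul (d_xi i f) (d_t g) else 0)" for j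
    by (simp add: Q_gmul Q_d_xi gparity_d_xi Q_parity d_xi_minus gmul_add_left gmul_add_right
       gmul_diff_left gmul_diff_right gmul_minus_left gmul_minus_right)
  have Q_S: "Q (\<Sum>j\<in>UNIV. gmul (d_xi j (gparity f)) (d_xi j g)) =
      (\<Sum>j\<in>UNIV. gmul (d_xi j (gparity (Q f))) (d_xi j g))
          + (\<Sum>j\<in>UNIV. gmul (d_xi j f) (d_xi j (Q g)))
      + (gmul (d_t (gparity f)) (d_xi i g) - gmul (d_xi i f) (d_t g))"
    unfolding Q_sum pt sum.distrib by simp
  \<comment> \<open>The corrections from N and from \<partial>_i, collected. The \<partial>_i terms
    cancel directly, the \<xi>_i terms after \<xi>_i is moved to the left.\<close>
  have "gmul (R f) (d_t g) - gmul (d_t (gparity f)) (R g)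
     + (gmul (d_t (gparity f)) (d_xi i g) - gmul (d_xi i f) (d_t g)) = 0"
    by (simp add: R_def gmul_add_left gmul_add_right gmul_gxi_right gparity_d_t)
  then have "Q (K_bracket f g) = K_bracket (Q f) g + K_bracket (gparity f) (Q g)"
    by (simp add: br Q_add Q_diff Q_S Q_gmul Q_N Q_d_t gmul_add_left gmul_add_right
       gparity_d_t N_parity algebra_simps)
  then show ?thesis by (simp add: K_bracket_gxi Q_def)
qed

section \<open>Coefficients and the cocycle \<psi>\<close>

lemma Compl_ix:
  "- {X1} = {X2, X3, X4}" "- {X2} = {X1, X3, X4}" "- {X3} = {X1, X2, X4}" "- {X4} = {X1, X2, X3}"
  by (auto intro: ix.exhaust)

lemma gcoeff_gmono: "gcoeff (gmono m I) n J = (if J = I \<and> n = m then 1 else 0)"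
  by (auto simp: gcoeff_def gmono_def)

lemma gcoeff_linear [simp]:
  "gcoeff (f + g) m I = gcoeff f m I + gcoeff g m I"
  "gcoeff (f - g) m I = gcoeff f m I - gcoeff g m I"
  "gcoeff (- f) m I = - gcoeff f m I"
  "gcoeff 0 m I = 0"
  "gcoeff (gscale c f) m I = c * gcoeff f m I"
  by (simp_all add: gcoeff_def gscale_def)

lemma gcoeff_gparity: "gcoeff (gparity f) m I = (- 1) ^ card I * gcoeff f m I"
  by (simp add: gcoeff_def gparity_def)

lemma gcoeff_euler: "gcoeff (euler f) m I = of_nat (card I) * gcoeff f m I"
  by (simp add: gcoeff_def euler_eq)

lemma gcoeff_d_t: "gcoeff (d_t f) m I = of_nat (Suc m) * gcoeff f (Suc m) I"
  by (simp add: gcoeff_def d_t_def coeff_pderiv)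

lemma gcoeff_d_xi: "gcoeff (d_xi i f) m I
  = (if i \<in> I then 0 else gsign {i} I * gcoeff f m (insert i I))"
  by (simp add: gcoeff_def d_xi_def)

lemma gcoeff_gmul_0: "gcoeff (gmul f g) 0 K = (\<Sum>I\<in>Pow K. gsign I (K
  - I) * (gcoeff f 0 I * gcoeff g 0 (K - I)))"
  by (simp add: gcoeff_def gmul_def coeff_sum coeff_mult)

lemma gcoeff_gxi_gmul: "gcoeff (gmul (gxi i) f) m K =
    (if i \<in> K then gsign {i} (K - {i}) * gcoeff f m (K - {i}) else 0)"
  by (simp add: gcoeff_def gmul_gxi)

lemma gcoeff_sum: "gcoeff (sum f A) m I = (\<Sum>a\<in>A. gcoeff (f a) m I)"
  by (simp add: gcoeff_def sum_grass coeff_sum)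

text \<open>The cocycle and membership in \<open>lie_nonneg\<close> read only coefficients at t^0,
  and in these a bracket involves its arguments only up to t^1.\<close>

lemma gcoeff_K_bracket_0: "gcoeff (K_bracket f g) 0 K =
  (\<Sum>I\<in>Pow K. gsign I (K - I) * ((2 - of_nat (card I)) * gcoeff f 0 I * gcoeff g 1 (K - I)
     - (2 - of_nat (card (K - I))) * gcoeff f 1 I * gcoeff g 0 (K - I)))
   + (\<Sum>i\<in>UNIV. \<Sum>I\<in>Pow K. gsign I (K - I) * (gcoeff (d_xi i (gparity f)) 0 I * gcoeff (d_xi i g) 0
       (K - I)))"
  by (simp add: K_bracket_def gcoeff_sum gcoeff_gmul_0 gcoeff_d_t gcoeff_euler algebra_simps
     sum.distrib sum_subtractf)

lemma psi_gone: "psi gone g = - 2 * gcoeff g 0 UNIV"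
  by (simp add: psi_def gcoeff_gmono UNIV_ix Compl_ix)

lemma psi_gxi: "psi (gxi i) g = - gsign {i} (- {i}) * gcoeff g 0 (- {i})"
  by (cases i) (simp_all add: psi_def gcoeff_gmono UNIV_ix Compl_ix)

lemma psi_gone_right: "psi g gone = - psi gone g"
  by (simp add: psi_def gcoeff_gmono UNIV_ix Compl_ix)

lemma psi_gxi_right: "psi g (gxi i) = - psi (gxi i) (gparity g)"
  by (cases i) (simp_all add: psi_def gcoeff_gmono UNIV_ix Compl_ix gcoeff_gparity)

text \<open>Since \<psi>(\<xi>_i, -) is a single coefficient up to sign, the cocycle identity with
  \<xi>_i as first argument is a finite comparison of coefficients.\<close>

lemma psi_jacobi:
  "psi (gxi i) (K_bracket f g) = psi (K_bracket (gxi i) f) g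
      + psi (gparity f) (K_bracket (gxi i) g)"
  unfolding psi_gxi K_bracket_gxi
  by (cases i) (simp_all add: gcoeff_K_bracket_0 psi_def gcoeff_d_t gcoeff_d_xi gcoeff_gparity
     gcoeff_gxi_gmul Compl_ix UNIV_ix grass_eval algebra_simps)

lemma K_bracket_add_left: "K_bracket (f + f') g = K_bracket f g + K_bracket f' g"
  unfolding K_bracket_def gparity_add euler_add gscale_add d_t_add d_xi_add add_diff_add
    gmul_add_left gmul_add_right sum.distrib
        by (simp add: gmul_add_left gmul_add_right algebra_simps)

lemma K_bracket_add_right: "K_bracket f (g + g') = K_bracket f g + K_bracket f g'"
  unfolding K_bracket_def gparity_add euler_add gscale_add d_t_add d_xi_add add_diff_add
    gmul_add_left gmul_add_right sum.distrib
        by (simp add: gmul_add_left gmul_add_right algebra_simps)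

lemma gscale_sum: "gscale c (sum f A) = (\<Sum>a\<in>A. gscale c (f a))"
proof
  fix K show "gscale c (sum f A) K = (\<Sum>a\<in>A. gscale c (f a)) K"
    unfolding sum_grass by (simp add: gscale_def sum_grass smult_sum)
qed

lemma K_bracket_scale_left: "K_bracket (gscale c f) g = gscale c (K_bracket f g)"
  by (simp add: K_bracket_def euler_scale d_t_scale gparity_scale d_xi_scale gmul_scale_left
    gmul_scale_right gscale_add gscale_diff gscale_sum gscale_gscale mult.commute[of 2]
    gmul_diff_left gmul_diff_right)

lemma K_bracket_scale_right: "K_bracket f (gscale c g) = gscale c (K_bracket f g)"
  by (simp add: K_bracket_def euler_scale d_t_scale gparity_scale d_xi_scale gmul_scale_left
    gmul_scale_right gscale_add gscale_diff gscale_sum gscale_gscale mult.commute[of 2]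
    gmul_diff_left gmul_diff_right)

lemma psi_add_left: "psi (f + f') g = psi f g + psi f' g"
  by (simp add: psi_def UNIV_ix algebra_simps)

lemma psi_add_right: "psi f (g + g') = psi f g + psi f g'"
  by (simp add: psi_def UNIV_ix algebra_simps)

lemma psi_scale_left: "psi (gscale c f) g = c * psi f g"
  by (simp add: psi_def UNIV_ix algebra_simps)

lemma psi_scale_right: "psi f (gscale c g) = c * psi f g"
  by (simp add: psi_def UNIV_ix algebra_simps)

section \<open>Brackets with \<open>\<gg>\<^sub><\<^sub>0\<close>\<close>

definition xi :: "ix \<Rightarrow> lie" where "xi i = (gxi i, 0)"

definition lone :: lie where "lone = (gone, 0)"

text \<open>The parity involution \<sigma>. It replaces the sign (-1)^p(x), which makes the
  identities below linear in x.\<close>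

definition lie_parity :: "lie \<Rightarrow> lie" where "lie_parity x = (gparity (fst x), snd x)"

lemma lie_bracket_add_left: "lie_bracket (x + x') y = lie_bracket x y + lie_bracket x' y"
  by (simp add: lie_bracket_def K_bracket_add_left psi_add_left)

lemma lie_bracket_add_right: "lie_bracket x (y + y') = lie_bracket x y + lie_bracket x y'"
  by (simp add: lie_bracket_def K_bracket_add_right psi_add_right)

lemma lie_bracket_scale_left: "lie_bracket (lie_scale c x) y = lie_scale c (lie_bracket x y)"
  by (simp add: lie_bracket_def lie_scale_def K_bracket_scale_left psi_scale_left)

lemma lie_bracket_scale_right: "lie_bracket x (lie_scale c y) = lie_scale c (lie_bracket x y)"
  by (simp add: lie_bracket_def lie_scale_def K_bracket_scale_right psi_scale_right)

lemma lie_scale_minus_one: "lie_scale (- 1) x = - x"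
  by (simp add: lie_scale_def gscale_minus_one uminus_prod_def)

lemma lie_scale_one [simp]: "lie_scale 1 x = x"
  by (simp add: lie_scale_def)

lemma lie_scale_add: "lie_scale c (x + y) = lie_scale c x + lie_scale c y"
  by (simp add: lie_scale_def gscale_add algebra_simps)

lemma lie_scale_add_left: "lie_scale (c + d) x = lie_scale c x + lie_scale d x"
  by (simp add: lie_scale_def gscale_add_left algebra_simps)

lemma lie_scale_scale: "lie_scale c (lie_scale d x) = lie_scale (c * d) x"
  by (simp add: lie_scale_def gscale_gscale)

lemma lie_bracket_minus_left: "lie_bracket (- x) y = - lie_bracket x y"
  using lie_bracket_scale_left[of "- 1" x y] by (simp only: lie_scale_minus_one)

lemma lie_bracket_minus_right: "lie_bracket x (- y) = - lie_bracket x y"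
  using lie_bracket_scale_right[of x "- 1" y] by (simp only: lie_scale_minus_one)

lemma lie_parity_add: "lie_parity (x + y) = lie_parity x + lie_parity y"
  by (simp add: lie_parity_def gparity_add)

lemma lie_parity_scale: "lie_parity (lie_scale c x) = lie_scale c (lie_parity x)"
  by (simp add: lie_parity_def lie_scale_def gparity_scale)

lemma lie_parity_parity [simp]: "lie_parity (lie_parity x) = x"
  by (simp add: lie_parity_def)

lemma lie_parity_xi: "lie_parity (xi i) = - xi i"
  by (simp add: lie_parity_def xi_def gparity_gxi uminus_prod_def)

lemma lie_parity_lone: "lie_parity lone = lone"
  by (simp add: lie_parity_def lone_def gparity_gone)

lemma lie_parity_bracket_xi: "lie_parity (lie_bracket (xi i) x) =
  - lie_bracket (xi i) (lie_parity x)"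
  by (cases i) (simp_all add: lie_parity_def xi_def lie_bracket_def K_bracket_gxi gparity_diff
      gparity_gmul
    gparity_gxi gparity_d_t gparity_d_xi gmul_minus_left uminus_prod_def psi_gxi gcoeff_gparity
        Compl_ix)

text \<open>The Clifford relations that come from [\<xi>_i, \<xi>_j] = - \<delta>_ij 1; the central
  component is compared separately, coefficient by coefficient.\<close>

lemma lie_bracket_xi_xi:
  "lie_bracket (xi i) (lie_bracket (xi j) x) + lie_bracket (xi j) (lie_bracket (xi i) x)
    = (if i = j then - lie_bracket lone x else 0)"
proof -
  have "K_bracket (gxi i) (K_bracket (gxi j) f) + K_bracket (gxi j) (K_bracket (gxi i) f)
     = (if i = j then - K_bracket gone f else 0)" for f
  proof -
    have "gmul (gxi i) (gmul (gxi j) h) = - gmul (gxi j) (gmul (gxi i) h)" for h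
      using gmul_gxi_right[of "gxi i" j h]
      by (simp add: gparity_gxi gmul_minus_left gmul_minus_right flip: gxi_gmul)
    then show ?thesis
      by (simp add: K_bracket_gxi K_bracket_gone d_t_diff d_t_gxi_gmul d_t_d_xi gmul_diff_right
          d_xi_diff
        d_xi_gxi_gmul gscale_two d_xi_d_xi[of i j])
  qed
  moreover have "psi (gxi i) (K_bracket (gxi j) f) + psi (gxi j) (K_bracket (gxi i) f)
     = (if i = j then - psi gone f else 0)" for f
    by (cases i; cases j; simp add: psi_gxi psi_gone K_bracket_gxi Compl_ix UNIV_ix gcoeff_d_xi
      gcoeff_gxi_gmul grass_eval)
  ultimately show ?thesis
    by (simp add: lie_bracket_def xi_def lone_def uminus_prod_def zero_prod_def)
qed

lemma lie_bracket_xi_jacobi: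
  "lie_bracket (xi i) (lie_bracket x y) = lie_bracket (lie_bracket (xi i) x) y
    + lie_bracket (lie_parity x) (lie_bracket (xi i) y)"
  by (simp add: lie_bracket_def xi_def lie_parity_def K_bracket_jacobi psi_jacobi)

text \<open>Since 1 = - [\<xi>_i, \<xi>_i], the properties of ad 1 can be read off from those of ad
  \<xi>_i for any choice of i.\<close>

lemma lie_bracket_lone: "lie_bracket lone x =
    - lie_scale 2 (lie_bracket (xi i) (lie_bracket (xi i) x))"
  using lie_bracket_xi_xi[of i i x] lie_scale_add_left[of 1 1
      "lie_bracket (xi i) (lie_bracket (xi i) x)"] by simp

lemma lie_bracket_lone_xi: "lie_bracket lone (lie_bracket (xi i) x)
  = lie_bracket (xi i) (lie_bracket lone x)"
  by (simp add: lie_bracket_lone[of _ i] lie_bracket_minus_right lie_bracket_scale_right)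

lemma lie_parity_minus: "lie_parity (- x) = - lie_parity x"
  by (simp add: lie_parity_def gparity_minus)

lemma lie_parity_bracket_lone: "lie_parity (lie_bracket lone x) = lie_bracket lone (lie_parity x)"
  by (simp add: lie_bracket_lone[of _ X1] lie_parity_minus lie_parity_scale lie_parity_bracket_xi
    lie_bracket_minus_right)

text \<open>Two applications of the identity for \<xi>_1; the mixed terms cancel because \<sigma>
  anticommutes with ad \<xi>_1.\<close>

lemma lie_bracket_lone_jacobi:
  "lie_bracket lone (lie_bracket x y) = lie_bracket (lie_bracket lone x) y
    + lie_bracket x (lie_bracket lone y)"
  by (simp add: lie_bracket_lone[of _ X1] lie_bracket_xi_jacobi[of X1 x y]
    lie_bracket_xi_jacobi[of X1 "lie_bracket (xi X1) x" y]
    lie_bracket_xi_jacobi[of X1 "lie_parity x"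
        "lie_bracket (xi X1) y"] lie_bracket_add_right lie_parity_bracket_xi
    lie_scale_add lie_bracket_minus_left lie_bracket_minus_right lie_bracket_scale_left
        lie_bracket_scale_right)

lemma lie_bracket_xi_right: "lie_bracket x (xi i) = - lie_bracket (xi i) (lie_parity x)"
  by (simp add: lie_bracket_def xi_def lie_parity_def K_bracket_gxi_right[of
      "fst x"] psi_gxi_right[of "fst x"] uminus_prod_def)

lemma lie_bracket_lone_right: "lie_bracket x lone = - lie_bracket lone x"
  by (simp add: lie_bracket_def lone_def K_bracket_gone_right[of "fst x"] psi_gone_right[of
      "fst x"] uminus_prod_def)

text \<open>Homogeneous elements become eigenvectors of \<sigma>, which turns parity bookkeeping
  into linear rewriting.\<close>

lemma lie_part_iff:
  assumes "p \<in> {0, 1}"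
  shows "x \<in> lie_part p \<longleftrightarrow> lie_parity x = lie_scale ((- 1) ^ p) x"
proof -
  have sgn: "(- 1 :: complex) ^ n = (- 1) ^ p \<longleftrightarrow> n mod 2 = p" for n :: nat
    using assms by (cases "even n") (auto simp: mod_2_eq_odd)
  have "smult ((- 1) ^ card I) q = smult ((- 1) ^ p) q \<longleftrightarrow> q \<noteq> 0 \<longrightarrow> card I mod 2 = p"
    for I :: "ix set" and q :: "complex poly"
    using smult_diff_left[of "(- 1) ^ card I" "(- 1) ^ p" q] by (auto simp flip: sgn)
  moreover have "z = (- 1) ^ p * z \<longleftrightarrow> z \<noteq> 0 \<longrightarrow> p = 0" for z :: complex
    using assms by auto
  ultimately show ?thesis
    by (simp add: lie_part_def lie_parity_def lie_scale_def prod_eq_iff fun_eq_iff gparity_def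
        gscale_def)
qed

lemma lie_part_xi_bracket:
  assumes "p \<in> {0, 1}" "x \<in> lie_part p"
  shows "lie_bracket (xi i) x \<in> lie_part (1 - p)"
proof -
  have "1 - p \<in> {0, 1}" "(- 1 :: complex) ^ (1 - p) = - ((- 1) ^ p)" using assms by auto
  then show ?thesis
    using assms lie_scale_scale[of "-1" "(- 1) ^ p" "lie_bracket (xi i) x"]
    by (simp only: lie_part_iff lie_parity_bracket_xi lie_bracket_scale_right lie_scale_minus_one
        mult_minus1)
qed

lemma lie_part_lone_bracket:
  "p \<in> {0, 1} \<Longrightarrow> x \<in> lie_part p \<Longrightarrow> lie_bracket lone x \<in> lie_part p"
  by (simp only: lie_part_iff lie_parity_bracket_lone lie_bracket_scale_right)

section \<open>A free \<open>\<gg>\<close>-module over \<open>U(\<gg>\<^sub><\<^sub>0)\<close>\<close>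

lemma lie_degrees_subset_iff: "lie_degrees x \<subseteq> D \<longleftrightarrow>
  (\<forall>m I. gcoeff (fst x) m I \<noteq> 0 \<longrightarrow> 2 * int m + int (card I) - 2 \<in> D) \<and> (snd x \<noteq> 0 \<longrightarrow> 0 \<in> D)"
  unfolding lie_degrees_def by blast

lemma lie_nonneg_iff:
  "x \<in> lie_nonneg \<longleftrightarrow> gcoeff (fst x) 0 {} = 0 \<and> (\<forall>i. gcoeff (fst x) 0 {i} = 0)"
proof -
  have small: "m = 0 \<and> (I = {} \<or> (\<exists>i. I = {i}))" if "\<not> 2 \<le> 2 * int m + int (card I)"
      for m and I :: "ix set"
  proof -
    have "m = 0" "card I = 0 \<or> card I = 1" using that by linarith+
    then show ?thesis by (auto simp: card_1_singleton_iff)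
  qed
  have "x \<in> lie_nonneg \<longleftrightarrow> (\<forall>m I. gcoeff (fst x) m I \<noteq> 0 \<longrightarrow> 2 \<le> 2 * int m + int (card I))"
    by (auto simp: lie_nonneg_def lie_degrees_subset_iff)
  also have "\<dots> \<longleftrightarrow> gcoeff (fst x) 0 {} = 0 \<and> (\<forall>i. gcoeff (fst x) 0 {i} = 0)" (is "?L \<longleftrightarrow> ?R")
  proof
    assume L: ?L
    show ?R using L[rule_format, of 0 "{}"] L[rule_format, of 0 "{_}"] by auto
  next
    assume R: ?R
    show ?L
    proof (intro allI impI, rule ccontr)
      fix m I assume "gcoeff (fst x) m I \<noteq> 0" and *: "\<not> 2 \<le> 2 * int m + int (card I)"
      then show False using small[OF *] R by metis
    qed
  qed
  finally show ?thesis .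
qed

section \<open>Additive maps on finitely supported functions\<close>

lemma poly_mapping_single_induct [case_names zero add]:
  assumes "P 0" and "\<And>f k v. P f \<Longrightarrow> P (f + Poly_Mapping.single k (v :: 'b :: ab_group_add))"
  shows "P f"
proof (induction f rule: update_induct)
  case (update f k v)
  have "Poly_Mapping.update k v f = f + Poly_Mapping.single k v"
    using update.hyps by (intro poly_mapping_eqI)
        (auto simp: lookup_update lookup_add lookup_single in_keys_iff when_def)
  then show ?case using assms(2)[OF update.IH] by simp
qed (rule assms(1))

text \<open>The additive extension of a map given on monomials. Its additivity asks only for
  additivity in the coefficient, so it serves for coefficients in F as well as in
  \<complex>.\<close>

definition mext :: "('k \<Rightarrow> 'b :: zero \<Rightarrow> 'm :: comm_monoid_add) \<Rightarrow> ('k \<Rightarrow>\<^sub>0 'b) \<Rightarrow> 'm" where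
  "mext b m = (\<Sum>k\<in>Poly_Mapping.keys m. b k (Poly_Mapping.lookup m k))"

lemma mext_zero [simp]: "mext b 0 = 0"
  by (simp add: mext_def)

lemma mext_add:
  assumes "\<And>k v w. b k (v + w) = b k v + b k w"
  shows "mext b (m + m') = mext b m + (mext b m' :: 'm :: ab_group_add)"
proof -
  have "b k 0 = 0" for k using assms[of k 0 0] by simp
  then show ?thesis unfolding mext_def
    using assms setsum_keys_plus_distrib[of b m m'] by blast
qed

lemma mext_single: "b k 0 = 0 \<Longrightarrow> mext b (Poly_Mapping.single k v) = b k v"
  by (simp add: mext_def)

definition ixlist :: "ix set \<Rightarrow> ix list" where
  "ixlist I = filter (\<lambda>i. i \<in> I) [X1, X2, X3, X4]"

lemma ixlist_empty: "ixlist {} = []" by (simp add: ixlist_def)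

lemma ixlist_insert:
  assumes "\<And>i. i \<in> I \<Longrightarrow> pos j < pos i"
  shows "ixlist (insert j I) = j # ixlist I"
  using assms by (cases j; cases I rule: ix_set_cases) (fastforce simp: ixlist_def)+

context nonneg_module begin

section \<open>The model \<complex>[\<Theta>] \<otimes> \<Lambda>(\<eta>) \<otimes> F and its
  operators \<Theta> and \<eta>_i\<close>

definition mscale :: "complex \<Rightarrow> (nat \<times> ix set \<Rightarrow>\<^sub>0 'f) \<Rightarrow> (nat \<times> ix set \<Rightarrow>\<^sub>0 'f)" where
  "mscale c m = Poly_Mapping.map (scale c) m"

lemma lookup_mscale: "Poly_Mapping.lookup (mscale c m) k = scale c (Poly_Mapping.lookup m k)"
  by (simp add: mscale_def Poly_Mapping.map.rep_eq when_def)

sublocale M: vector_space mscale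
  by standard (auto intro!: poly_mapping_eqI simp: lookup_mscale lookup_add scale_right_distrib
      scale_left_distrib)

lemma mscale_single: "mscale c (Poly_Mapping.single k v) = Poly_Mapping.single k (scale c v)"
  by (intro poly_mapping_eqI) (simp add: lookup_mscale lookup_single when_def)

text \<open>
  \<open>Poly_Mapping.single (a, I) v\<close> stands for \<open>\<Theta>\<^sup>a \<eta>\<^sub>I \<otimes> v\<close>, where \<open>\<Theta>\<close> and \<open>\<eta>\<^sub>i\<close> are
  the images of \<open>1\<close> and \<open>\<xi>\<^sub>i\<close> in the enveloping algebra.  There \<open>\<eta>\<^sub>i \<eta>\<^sub>j + \<eta>\<^sub>j \<eta>\<^sub>i = - \<delta>\<^sub>i\<^sub>j \<Theta>\<close>, hence the factor \<open>- 1 / 2\<close>.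
\<close>

definition theta :: "(nat \<times> ix set \<Rightarrow>\<^sub>0 'f) \<Rightarrow> (nat \<times> ix set \<Rightarrow>\<^sub>0 'f)" where
  "theta = mext (\<lambda>(a, I) v. Poly_Mapping.single (Suc a, I) v)"

definition eta :: "ix \<Rightarrow> (nat \<times> ix set \<Rightarrow>\<^sub>0 'f) \<Rightarrow> (nat \<times> ix set \<Rightarrow>\<^sub>0 'f)" where
  "eta i = mext (\<lambda>(a, I) v.
     if i \<in> I then Poly_Mapping.single (Suc a, I - {i}) (scale (- gsign {i} (I - {i}) / 2) v)
     else Poly_Mapping.single (a, insert i I) (scale (gsign {i} I) v))"

lemma theta_add: "theta (m + m') = theta m + theta m'"
  unfolding theta_def by (rule mext_add) (auto simp: single_add)

lemma theta_single: "theta (Poly_Mapping.single (a, I) v) = Poly_Mapping.single (Suc a, I) v"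
  by (simp add: theta_def mext_single)

lemma eta_add: "eta i (m + m') = eta i m + eta i m'"
  unfolding eta_def by (rule mext_add) (auto simp: single_add single_diff single_uminus
      scale_right_distrib)

lemma eta_single: "eta i (Poly_Mapping.single (a, I) v) =
     (if i \<in> I then Poly_Mapping.single (Suc a, I - {i}) (scale (- gsign {i} (I - {i}) / 2) v)
     else Poly_Mapping.single (a, insert i I) (scale (gsign {i} I) v))"
  unfolding eta_def by (subst mext_single) auto

lemma M_induct [case_names add single]:
  assumes "\<And>m m'. P m \<Longrightarrow> P m' \<Longrightarrow> P (m + m')" "\<And>a I v. P (Poly_Mapping.single (a, I) v)"
  shows "P (m :: nat \<times> ix set \<Rightarrow>\<^sub>0 'f)"
proof (induction m rule: poly_mapping_single_induct)
  case zero
  show ?case using assms(2)[of 0 "{}" 0] by simp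
next
  case (add f k v)
  then show ?case using assms by (cases k) auto
qed

lemma theta_zero [simp]: "theta 0 = 0" by (simp add: theta_def)

lemma eta_zero [simp]: "eta i 0 = 0" by (simp add: eta_def)

lemma theta_scale: "theta (mscale c m) = mscale c (theta m)"
  by (induction m rule: M_induct) (simp_all add: theta_add M.scale_right_distrib mscale_single
      theta_single)

lemma eta_scale: "eta i (mscale c m) = mscale c (eta i m)"
  by (induction m rule: M_induct)
    (simp_all add: eta_add M.scale_right_distrib mscale_single eta_single mult.commute)

lemma theta_minus: "theta (- m) = - theta m"
  using theta_add[of m "- m"] by (simp add: eq_neg_iff_add_eq_0 add.commute)

lemma eta_minus: "eta i (- m) = - eta i m"
  using eta_add[of i m "- m"] by (simp add: eq_neg_iff_add_eq_0 add.commute)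

lemma theta_diff: "theta (m - m') = theta m - theta m'"
  using theta_add[of m "- m'"] by (simp add: theta_minus)

lemma eta_diff: "eta i (m - m') = eta i m - eta i m'"
  using eta_add[of i m "- m'"] by (simp add: eta_minus)

lemma eta_theta: "eta i (theta m) = theta (eta i m)"
  by (induction m rule: M_induct) (simp_all add: eta_add theta_add eta_single theta_single)

text \<open>For i = j the two signs in \<open>eta_single\<close> cancel and the factors - 1 / 2 add
  up to - 1; for distinct indices the signs are compared on all sixteen sets.\<close>

lemma eta_eta: "eta i (eta j m) + eta j (eta i m) = (if i = j then - theta m else 0)"
proof (induction m rule: M_induct)
  case (add m m')
  have "eta i (eta j (m + m')) + eta j (eta i (m + m')) =
    (eta i (eta j m) + eta j (eta i m)) + (eta i (eta j m') + eta j (eta i m'))"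
    by (simp add: eta_add)
  then show ?case unfolding add.IH by (simp add: theta_add)
next
  case (single a I v)
  show ?case
  proof (cases "i = j")
    case True
    have "eta i (eta i (Poly_Mapping.single (a, I) v))
        = Poly_Mapping.single (Suc a, I) (scale (- 1 / 2) v)"
      by (simp add: eta_single insert_absorb)
    moreover have "scale (- 1 / 2) v + scale (- 1 / 2) v = - v"
      by (simp only: scale_left_distrib[symmetric]) simp
    ultimately show ?thesis using True
      by (simp only: theta_single single_add[symmetric] single_uminus simp_thms if_True)
  next
    case False
    then show ?thesis
      by (cases i; cases j; cases I rule: ix_set_cases)
          (simp_all add: eta_single eta_minus grass_eval single_uminus)
  qed
qed

section \<open>The action of \<gg> on the model\<close>

definition nneg :: "lie \<Rightarrow> lie" where
  "nneg x = x - lie_scale (gcoeff (fst x) 0 {}) lone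
      - (\<Sum>i\<in>UNIV. lie_scale (gcoeff (fst x) 0 {i}) (xi i))"

text \<open>The value of x at 1 \<otimes> v. The projection \<open>nneg\<close> along the span of 1
  and the \<xi>_i gives the part that acts on F, while \<xi>_i and 1 yield \<eta>_i and
  \<Theta>.\<close>

definition rho_vac :: "lie \<Rightarrow> 'f \<Rightarrow> (nat \<times> ix set \<Rightarrow>\<^sub>0 'f)" where
  "rho_vac x v = Poly_Mapping.single (0, {}) (act (nneg x) v)
     + (\<Sum>i\<in>UNIV. Poly_Mapping.single (0, {i}) (scale (gcoeff (fst x) 0 {i}) v))
     + Poly_Mapping.single (1, {}) (scale (gcoeff (fst x) 0 {}) v)"

text \<open>
  The recursion moves \<open>x\<close> to the right by \<open>x \<eta>\<^sub>i = \<eta>\<^sub>i \<sigma>(x) - [\<xi>\<^sub>i, \<sigma>(x)]\<close> and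
  \<open>x \<Theta> = \<Theta> x - [1, x]\<close>, where \<open>\<sigma>\<close> is the parity involution, so that \<open>x\<close> need not be homogeneous.
\<close>

fun rho_mono :: "lie \<Rightarrow> nat \<Rightarrow> ix list \<Rightarrow> 'f \<Rightarrow> (nat \<times> ix set \<Rightarrow>\<^sub>0 'f)" where
  "rho_mono x 0 [] v = rho_vac x v"
| "rho_mono x 0 (i # is) v = eta i (rho_mono (lie_parity x) 0 is v)
     - rho_mono (lie_bracket (xi i) (lie_parity x)) 0 is v"
| "rho_mono x (Suc a) is v = theta (rho_mono x a is v) - rho_mono (lie_bracket lone x) a is v"

definition rho :: "lie \<Rightarrow> (nat \<times> ix set \<Rightarrow>\<^sub>0 'f) \<Rightarrow> (nat \<times> ix set \<Rightarrow>\<^sub>0 'f)" where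
  "rho x = mext (\<lambda>(a, I). rho_mono x a (ixlist I))"

lemma gcoeff_fst_sum: "gcoeff (fst (sum f A :: lie)) m I = (\<Sum>a\<in>A. gcoeff (fst (f a)) m I)"
  using additive.sum[of "\<lambda>x. gcoeff (fst x) m I" f A] by (simp add: additive_def)

lemma fst_xi: "fst (xi i) = gxi i" and fst_lone: "fst lone = gone"
  and fst_lie_scale: "fst (lie_scale c x) = gscale c (fst x)"
  by (simp_all add: xi_def lone_def lie_scale_def)

lemma nneg_nonneg: "nneg x \<in> lie_nonneg"
  by (simp add: lie_nonneg_iff nneg_def gcoeff_fst_sum fst_xi fst_lone fst_lie_scale gcoeff_gmono
    if_distrib[of "times _"] cong: if_cong)

lemma nneg_eq: "x \<in> lie_nonneg \<Longrightarrow> nneg x = x"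
  by (simp add: lie_nonneg_iff nneg_def lie_scale_def zero_prod_def[symmetric])

lemma nneg_add: "nneg (x + y) = nneg x + nneg y"
  by (simp add: nneg_def lie_scale_add_left sum.distrib)

lemma lie_scale_sum: "lie_scale c (sum f A) = (\<Sum>a\<in>A. lie_scale c (f a))"
  by (rule additive.sum) (simp add: additive_def lie_scale_add)

lemma lie_scale_minus: "lie_scale c (- x) = - lie_scale c x"
  by (simp add: lie_scale_scale mult.commute flip: lie_scale_minus_one)

lemma lie_scale_diff: "lie_scale c (x - y) = lie_scale c x - lie_scale c y"
  using lie_scale_add[of c x "- y"] by (simp add: lie_scale_minus)

lemma nneg_scale: "nneg (lie_scale c x) = lie_scale c (nneg x)"
  by (simp add: nneg_def lie_scale_diff lie_scale_sum lie_scale_scale fst_lie_scale)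

lemma rho_vac_add: "rho_vac x (v + w) = rho_vac x v + rho_vac x w"
  by (simp add: rho_vac_def act_add_right nneg_nonneg scale_right_distrib single_add sum.distrib)

lemma rho_vac_add_left: "rho_vac (x + y) v = rho_vac x v + rho_vac y v"
  by (simp add: rho_vac_def nneg_add act_add_left nneg_nonneg scale_left_distrib single_add
      sum.distrib)

lemma mscale_sum: "mscale c (sum f A) = (\<Sum>a\<in>A. mscale c (f a))"
  by (rule M.scale_sum_right)

lemma rho_vac_scale: "rho_vac x (scale c v) = mscale c (rho_vac x v)"
  by (simp add: rho_vac_def act_scale_right nneg_nonneg M.scale_right_distrib mscale_sum
      mscale_single
    mult.commute)

lemma rho_vac_scale_left: "rho_vac (lie_scale c x) v = mscale c (rho_vac x v)"
  by (simp add: rho_vac_def nneg_scale act_scale_left nneg_nonneg M.scale_right_distrib mscale_sum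
      mscale_single
    fst_lie_scale)

lemma rho_mono_add: "rho_mono x a is (v + w) = rho_mono x a is v + rho_mono x a is w"
  by (induction x a "is" v rule: rho_mono.induct) (simp_all add: rho_vac_add eta_add theta_add)

lemma rho_mono_scale: "rho_mono x a is (scale c v) = mscale c (rho_mono x a is v)"
  by (induction x a "is" v rule: rho_mono.induct)
    (simp_all add: rho_vac_scale eta_scale theta_scale M.scale_right_diff_distrib)

lemma rho_mono_add_left: "rho_mono (x + y) a is v = rho_mono x a is v + rho_mono y a is v"
proof (induction x a "is" v arbitrary: y rule: rho_mono.induct)
qed (simp_all add: rho_vac_add_left eta_add theta_add lie_parity_add lie_bracket_add_right)

lemma rho_mono_scale_left: "rho_mono (lie_scale c x) a is v = mscale c (rho_mono x a is v)"
  by (induction x a "is" v rule: rho_mono.induct)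
    (simp_all add: rho_vac_scale_left eta_scale theta_scale M.scale_right_diff_distrib
      lie_parity_scale lie_bracket_scale_right)

lemma rho_add: "rho x (m + m') = rho x m + rho x m'"
  unfolding rho_def by (rule mext_add) (auto simp: rho_mono_add)

lemma rho_mono_zero [simp]: "rho_mono x a is 0 = 0"
  using rho_mono_add[of x a "is" 0 0] by simp

lemma rho_single: "rho x (Poly_Mapping.single (a, I) v) = rho_mono x a (ixlist I) v"
  unfolding rho_def by (subst mext_single) auto

lemma rho_zero [simp]: "rho x 0 = 0" by (simp add: rho_def)

lemma rho_scale: "rho x (mscale c m) = mscale c (rho x m)"
  by (induction m rule: M_induct) (simp_all add: rho_add M.scale_right_distrib mscale_single
      rho_single rho_mono_scale)

lemma rho_minus: "rho x (- m) = - rho x m"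
  using rho_add[of x m "- m"] by (simp add: eq_neg_iff_add_eq_0 add.commute)

lemma rho_diff: "rho x (m - m') = rho x m - rho x m'"
  using rho_add[of x m "- m'"] by (simp add: rho_minus)

lemma rho_add_left: "rho (x + y) m = rho x m + rho y m"
  by (induction m rule: M_induct) (simp_all add: rho_add rho_single rho_mono_add_left)

lemma rho_scale_left: "rho (lie_scale c x) m = mscale c (rho x m)"
  by (induction m rule: M_induct) (simp_all add: rho_add M.scale_right_distrib rho_single
      rho_mono_scale_left)

lemma rho_minus_left: "rho (- x) m = - rho x m"
  using rho_scale_left[of "- 1" x m] by (simp add: lie_scale_minus_one)

lemma rho_zero_left [simp]: "rho 0 m = 0"
  using rho_add_left[of 0 0 m] by simp

lemma rho_theta: "rho x (theta m) = theta (rho x m) - rho (lie_bracket lone x) m"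
  by (induction m rule: M_induct) (simp_all add: rho_add theta_add theta_single rho_single)

text \<open>The defining recursion, freed from the requirement that \<open>j\<close> is the smallest index.\<close>

lemma rho_eta_least:
  assumes "\<And>i. i \<in> I \<Longrightarrow> pos j < pos i"
  shows "rho x (eta j (Poly_Mapping.single (a, I) v)) =
    eta j (rho (lie_parity x) (Poly_Mapping.single (a, I) v))
    - rho (lie_bracket (xi j) (lie_parity x)) (Poly_Mapping.single (a, I) v)"
proof (induction a arbitrary: x)
  case 0
  have "j \<notin> I" "gsign {j} I = 1" using assms by (fastforce simp: gsign_prod intro!: prod.neutral)+
  then show ?case
    by (simp add: eta_single rho_single ixlist_insert[OF assms])
next
  case (Suc a)
  have *: "Poly_Mapping.single (Suc a, I) v = theta (Poly_Mapping.single (a, I) v)"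
    by (simp add: theta_single)
  show ?case unfolding * eta_theta rho_theta Suc.IH
    by (simp add: theta_diff eta_diff eta_theta lie_parity_bracket_lone lie_bracket_lone_xi)
qed

text \<open>If i lies below I, this is the recursion. Otherwise the least index j of I is split off.
  For i = j, the squares of \<eta>_j and ad \<xi>_j are - 1 / 2 times \<Theta> and ad 1. For other
  i, \<eta>_i is moved past \<eta>_j; the rule holds for \<eta>_j by the recursion and for \<eta>_i
  by induction on the size of I.\<close>

lemma rho_eta_single_0: "rho x (eta i (Poly_Mapping.single (0, I) v)) =
    eta i (rho (lie_parity x) (Poly_Mapping.single (0, I) v))
    - rho (lie_bracket (xi i) (lie_parity x)) (Poly_Mapping.single (0, I) v)"
proof (induction "card I" arbitrary: I x v i rule: less_induct)
  case less
  show ?case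
  proof (cases "\<forall>k\<in>I. pos i < pos k")
    case True
    then show ?thesis by (intro rho_eta_least) auto
  next
    case False
    then have "I \<noteq> {}" by auto
    define j where "j = arg_min_on pos I"
    have j: "j \<in> I" "\<And>k. k \<in> I \<Longrightarrow> pos j \<le> pos k"
      using \<open>I \<noteq> {}\<close> by (auto simp: j_def intro: arg_min_if_finite arg_min_least)
    have pos_inj: "pos k = pos l \<Longrightarrow> k = l" for k l by (cases k; cases l; simp)
    define J where "J = I - {j}"
    have J: "I = insert j J" "j \<notin> J" "card J < card I" "\<And>k. k \<in> J \<Longrightarrow> pos j < pos k"
      using j(1) card_Diff1_less[OF finite_ix j(1)] j(2) pos_inj
      by (auto simp: J_def simp del: card_Diff_insert intro: le_neq_implies_less)
    define e where "e = Poly_Mapping.single (0 :: nat, J) v"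
    have sgn: "gsign {j} J = 1" using J(4) by (fastforce simp: gsign_prod intro!: prod.neutral)
    have e: "Poly_Mapping.single (0, I) v = eta j e"
      using J sgn by (simp add: e_def eta_single)
    have IH: "rho y (eta k e) = eta k (rho (lie_parity y) e)
        - rho (lie_bracket (xi k) (lie_parity y)) e" for y k
      unfolding e_def by (rule less.hyps) (rule J)
    show ?thesis
    proof (cases "i = j")
      case True
      have sq: "eta j (eta j m) = - mscale (1 / 2) (theta m)" for m
      proof -
        have "mscale (1 / 2) (eta j (eta j m) + eta j (eta j m)) = eta j (eta j m)"
          by (simp add: M.scale_right_distrib flip: M.scale_left_distrib)
        then show ?thesis by (simp add: eta_eta)
      qed
      have lsq: "rho (lie_bracket (xi j) (lie_bracket (xi j) y)) m =
          - mscale (1 / 2) (rho (lie_bracket lone y) m)" for y m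
        by (simp add: lie_bracket_lone[of _ j] rho_minus_left rho_scale_left)
      show ?thesis unfolding True e sq IH
        by (simp add: rho_minus rho_scale rho_theta eta_diff sq lsq lie_parity_bracket_xi
            lie_bracket_minus_right
           rho_minus_left eta_minus M.scale_right_diff_distrib)
    next
      case neq: False
      then have anti: "eta i (eta j m) = - eta j (eta i m)" for m
        using eta_eta[of i j m] by (simp add: eq_neg_iff_add_eq_0)
      have anti': "lie_bracket (xi i) (lie_bracket (xi j) y) =
          - lie_bracket (xi j) (lie_bracket (xi i) y)" for y
        using lie_bracket_xi_xi[of i j y] neq by (simp add: eq_neg_iff_add_eq_0)
      have "rho x (eta j (eta i e)) = eta j (rho (lie_parity x) (eta i e))
        - rho (lie_bracket (xi j) (lie_parity x)) (eta i e)"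
      \<comment> \<open>Here \<eta>_i e is again a monomial whose indices all exceed j, with a
        factor \<Theta> if i is in J; hence \<open>rho_eta_least\<close> allows any
        exponent.\<close>
      proof (cases "i \<in> J")
        case True
        then show ?thesis unfolding e_def eta_single using J(4)
            by (simp only: if_True, intro rho_eta_least) auto
      next
        case nin: False
        obtain k where "k \<in> I" "pos k \<le> pos i" using False by (auto simp: not_less)
        then have "pos j \<le> pos i" using j(2)[of k] by simp
        then have "pos j < pos i" using neq pos_inj[of j i] by (auto simp: le_less)
        then show ?thesis unfolding e_def eta_single using J(4) nin by (auto intro!: rho_eta_least)
      qed
      then show ?thesis unfolding e anti rho_minus IH
        by (simp add: anti anti' eta_diff eta_minus rho_minus_left lie_parity_bracket_xi
            lie_bracket_minus_right)
    qed
  qed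
qed

lemma rho_eta: "rho x (eta i m) = eta i (rho (lie_parity x) m)
  - rho (lie_bracket (xi i) (lie_parity x)) m"
proof (induction m arbitrary: x rule: M_induct)
  case (single a I v)
  show ?case
  proof (induction a arbitrary: x)
    case (Suc a)
    have *: "Poly_Mapping.single (Suc a, I) v = theta (Poly_Mapping.single (a, I) v)"
      by (simp add: theta_single)
    show ?case unfolding * eta_theta rho_theta Suc.IH
      by (simp add: theta_diff eta_diff eta_theta lie_parity_bracket_lone lie_bracket_lone_xi)
  qed (rule rho_eta_single_0)
qed (simp add: rho_add eta_add)

end

section \<open>The Lie superalgebra relations on the model\<close>

lemma lie_parity_bracket: "lie_parity (lie_bracket x y) = lie_bracket (lie_parity x) (lie_parity y)"
proof -
  have "gparity (K_bracket f g) = K_bracket (gparity f) (gparity g)" for f g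
  proof -
    have "gparity (\<Sum>i\<in>UNIV. gmul (d_xi i (gparity f)) (d_xi i g))
      = (\<Sum>i\<in>UNIV. gmul (d_xi i (gparity (gparity f))) (d_xi i (gparity g)))"
      using additive.sum[of gparity "\<lambda>i. gmul (d_xi i (gparity f)) (d_xi i g)" UNIV]
      by (simp add: additive_def gparity_add gparity_gmul gparity_d_xi gmul_minus_left
          gmul_minus_right)
    then show ?thesis
      by (simp add: K_bracket_def gparity_add gparity_diff gparity_gmul gparity_scale
          gparity_euler gparity_d_t)
  qed
  moreover have "psi (gparity f) (gparity g) = psi f g" for f g
    by (simp add: psi_def gcoeff_gparity UNIV_ix Compl_ix)
  ultimately show ?thesis by (simp add: lie_parity_def lie_bracket_def)
qed

lemma lie_part_add: "p \<in> {0, 1} \<Longrightarrow> x \<in> lie_part p \<Longrightarrow> y \<in> lie_part p \<Longrightarrow> x + y \<in> lie_part p"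
  by (simp only: lie_part_iff lie_parity_add lie_scale_add)

lemma lie_part_scale: "p \<in> {0, 1} \<Longrightarrow> x \<in> lie_part p \<Longrightarrow> lie_scale c x \<in> lie_part p"
  by (simp only: lie_part_iff lie_parity_scale lie_scale_scale mult.commute)

lemma lie_part_zero: "0 \<in> lie_part p"
  by (simp add: lie_part_def)

lemma lie_part_diff: "p \<in> {0, 1} \<Longrightarrow> x \<in> lie_part p \<Longrightarrow> y \<in> lie_part p \<Longrightarrow> x - y \<in> lie_part p"
  using lie_part_add[of p x "- y"] lie_part_scale[of p y "- 1"] by (simp add: lie_scale_minus_one)

lemma lie_part_sum: "p \<in> {0, 1} \<Longrightarrow> (\<And>a. a \<in> A \<Longrightarrow> f a \<in> lie_part p) \<Longrightarrow> sum f A \<in> lie_part p"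
  by (induction A rule: infinite_finite_induct) (auto simp: lie_part_zero intro: lie_part_add)

lemma xi_part: "xi i \<in> lie_part 1"
  by (simp add: lie_part_def xi_def gmono_def)

lemma lone_part: "lone \<in> lie_part 0"
  by (simp add: lie_part_def lone_def gmono_def)

lemma lie_bracket_lone_lone: "lie_bracket lone lone = 0"
  by (simp add: lie_bracket_def lone_def K_bracket_gone psi_gone gcoeff_gmono zero_prod_def UNIV_ix)

lemma lie_bracket_xi_lone: "lie_bracket (xi i) lone = 0"
  by (cases i) (simp_all add: lie_bracket_def lone_def xi_def K_bracket_gxi psi_gxi gcoeff_gmono
      zero_prod_def Compl_ix)

lemma lie_bracket_xi_xi_eq: "lie_bracket (xi i) (xi j) = (if i = j then - lone else 0)"
  by (cases i; cases j) (simp_all add: lie_bracket_def lone_def xi_def K_bracket_gxi psi_gxi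
      gcoeff_gmono
     zero_prod_def Compl_ix d_xi_gxi uminus_prod_def)

lemma lie_nonneg_bracket:
  assumes "x \<in> lie_nonneg" "y \<in> lie_nonneg"
  shows "lie_bracket x y \<in> lie_nonneg"
proof -
  have "gcoeff (K_bracket f g) 0 {} = 0" "gcoeff (K_bracket f g) 0 {i} = 0"
    if "gcoeff f 0 {} = 0" "\<And>i. gcoeff f 0 {i} = 0" "gcoeff g 0 {} = 0" "\<And>i. gcoeff g 0 {i} = 0"
        for f g i
    using that by (simp_all add: gcoeff_K_bracket_0 grass_eval gcoeff_d_xi gcoeff_gparity)
  then show ?thesis using assms by (simp add: lie_nonneg_iff lie_bracket_def)
qed

context nonneg_module begin

abbreviation vac :: "'f \<Rightarrow> (nat \<times> ix set \<Rightarrow>\<^sub>0 'f)" where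
  "vac v \<equiv> Poly_Mapping.single (0, {}) v"

text \<open>The model is generated from 1 \<otimes> F by the \<eta>_i and \<Theta>, so an operator
  identity needs to hold on 1 \<otimes> F and to pass through these operators.\<close>

lemma verma_induct [case_names add vac eta theta]:
  assumes add: "\<And>m m'. P m \<Longrightarrow> P m' \<Longrightarrow> P (m + m')" and vac: "\<And>v. P (vac v)"
    and eta: "\<And>i m. P m \<Longrightarrow> P (eta i m)" and theta: "\<And>m. P m \<Longrightarrow> P (theta m)"
  shows "P (m :: nat \<times> ix set \<Rightarrow>\<^sub>0 'f)"
proof (induction m rule: M_induct)
  case (single a I v)
  show ?case
  proof (induction a)
    case 0
    have "finite I" by simp
    then show ?case
    proof (induction I arbitrary: v)
      case (insert i I)
      have "eta i (Poly_Mapping.single (0, I) (scale (gsign {i} I) v))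
          = Poly_Mapping.single (0, insert i I) v"
        using insert.hyps by (simp add: eta_single)
      then show ?case using eta[OF insert.IH] by metis
    qed (rule vac)
  next
    case (Suc a)
    then show ?case using theta[OF Suc] by (simp add: theta_single)
  qed
qed (rule add)

lemma act_zero_left: "act 0 v = 0"
proof -
  have "0 \<in> lie_nonneg" by (simp add: lie_nonneg_iff)
  then show ?thesis using act_add_left[of 0 0 v] by simp
qed

lemma rho_vac_eq: "rho x (vac v) = rho_vac x v"
  by (simp add: rho_single ixlist_empty)

lemma rho_vac_nonneg: "x \<in> lie_nonneg \<Longrightarrow> rho x (vac v) = vac (act x v)"
  unfolding rho_vac_eq rho_vac_def by (simp add: nneg_eq) (simp add: lie_nonneg_iff)

lemma nneg_lone: "nneg lone = 0"
  by (simp add: nneg_def fst_lone gcoeff_gmono) (simp add: lie_scale_def zero_prod_def[symmetric])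

lemma nneg_xi: "nneg (xi i) = 0"
proof -
  have "(\<Sum>j\<in>UNIV. lie_scale (gcoeff (gxi i) 0 {j}) (xi j)) = (\<Sum>j\<in>UNIV. if j = i then xi i else 0)"
    by (rule sum.cong) (auto simp: gcoeff_gmono lie_scale_def zero_prod_def)
  then show ?thesis
    by (simp add: nneg_def fst_xi) (simp add: gcoeff_gmono lie_scale_def zero_prod_def[symmetric])
qed

lemma rho_lone: "rho lone m = theta m"
proof (induction m rule: verma_induct)
  case (vac v)
  show ?case unfolding rho_vac_eq rho_vac_def nneg_lone
    by (simp add: act_zero_left fst_lone gcoeff_gmono theta_single)
qed (simp_all add: rho_add theta_add rho_eta rho_theta lie_parity_lone lie_bracket_xi_lone
    lie_bracket_lone_lone eta_theta)

lemma rho_xi: "rho (xi i) m = eta i m"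
proof (induction m rule: verma_induct)
  case (vac v)
  have "(\<Sum>j\<in>UNIV. Poly_Mapping.single (0 :: nat, {j}) (scale (gcoeff (gxi i) 0 {j}) v))
     = (\<Sum>j\<in>UNIV. if j = i then Poly_Mapping.single (0, {i}) v else 0)"
    by (rule sum.cong) (auto simp: gcoeff_gmono)
  then show ?case unfolding rho_vac_eq rho_vac_def nneg_xi
    by (simp add: act_zero_left fst_xi) (simp add: gcoeff_gmono eta_single)
next
  case (eta j m)
  then show ?case using eta_eta[of i j m]
    by (auto simp: rho_eta lie_parity_xi lie_bracket_minus_right lie_bracket_xi_xi_eq rho_minus_left
      eta_minus rho_lone algebra_simps eq_neg_iff_add_eq_0)
next
  case (theta m)
  have "lie_bracket lone (xi i) = 0"
    using lie_bracket_lone_right[of "xi i"] by (simp add: lie_bracket_xi_lone)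
  then show ?case using theta by (simp add: rho_theta eta_theta)
qed (simp add: rho_add eta_add)

text \<open>
  It vanishes by induction on the length of the monomial: moving it past \<open>\<eta>\<^sub>i\<close> replaces \<open>x\<close> or \<open>y\<close>
  by its bracket with \<open>\<xi>\<^sub>i\<close>.
\<close>

definition comm :: "nat \<Rightarrow> nat \<Rightarrow> lie \<Rightarrow> lie \<Rightarrow> (nat \<times> ix set \<Rightarrow>\<^sub>0 'f) \<Rightarrow> (nat \<times> ix set \<Rightarrow>\<^sub>0 'f)" where
  "comm p q x y m = rho x (rho y m) - mscale ((- 1) ^ (p * q)) (rho y (rho x m))
      - rho (lie_bracket x y) m"

lemma comm_add_left: "comm p q (x + x') y m = comm p q x y m + comm p q x' y m"
  by (simp add: comm_def rho_add_left rho_add lie_bracket_add_left M.scale_right_distrib)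

lemma comm_add_right: "comm p q x (y + y') m = comm p q x y m + comm p q x y' m"
  by (simp add: comm_def rho_add_left rho_add lie_bracket_add_right M.scale_right_distrib)

lemma comm_scale_left: "comm p q (lie_scale c x) y m = mscale c (comm p q x y m)"
  by (simp add: comm_def rho_scale_left rho_scale lie_bracket_scale_left
      M.scale_right_diff_distrib mult.commute)

lemma comm_scale_right: "comm p q x (lie_scale c y) m = mscale c (comm p q x y m)"
  by (simp add: comm_def rho_scale_left rho_scale lie_bracket_scale_right
      M.scale_right_diff_distrib mult.commute)

lemma comm_add: "comm p q x y (m + m') = comm p q x y m + comm p q x y m'"
  by (simp add: comm_def rho_add M.scale_right_distrib)

lemma rho_diff_left: "rho (x - y) m = rho x m - rho y m"
  using rho_add_left[of x "- y" m] by (simp add: rho_minus_left)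

lemma rho_part_eta:
  assumes "p \<in> {0, 1}" "x \<in> lie_part p"
  shows "rho x (eta i m) = mscale ((- 1) ^ p) (eta i (rho x m) - rho (lie_bracket (xi i) x) m)"
  using assms by (simp add: rho_eta lie_part_iff rho_scale_left eta_scale lie_bracket_scale_right
    M.scale_right_diff_distrib del: insert_iff)

text \<open>After \<open>rho_xi\<close> this is the recursion \<open>rho_eta\<close> for a
  homogeneous element.\<close>

lemma comm_xi_left: "q \<in> {0, 1} \<Longrightarrow> y \<in> lie_part q \<Longrightarrow> comm 1 q (xi i) y m = 0"
  by (simp add: comm_def rho_xi rho_part_eta flip: power_add del: insert_iff)

lemma comm_lone_left: "comm 0 q lone y m = 0"
  by (simp add: comm_def rho_lone rho_theta)

lemma comm_swap:
  assumes "p \<in> {0, 1}" "q \<in> {0, 1}" "lie_bracket y x =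
      - lie_scale ((- 1) ^ (p * q)) (lie_bracket x y)"
  shows "comm q p y x m = - mscale ((- 1) ^ (p * q)) (comm p q x y m)"
  unfolding comm_def assms(3)
  by (simp add: rho_minus_left rho_scale_left M.scale_right_diff_distrib mult.commute[of q] flip:
      power_add)

lemma comm_xi_right:
  assumes "p \<in> {0, 1}" "x \<in> lie_part p"
  shows "comm p 1 x (xi i) m = 0"
proof -
  have "lie_bracket x (xi i) = - lie_scale ((- 1) ^ p) (lie_bracket (xi i) x)"
    using assms by (simp add: lie_bracket_xi_right[of x] lie_part_iff lie_bracket_scale_right del:
        insert_iff)
  then have "comm p 1 x (xi i) m = - mscale ((- 1) ^ p) (comm 1 p (xi i) x m)"
    using comm_swap[of 1 p x "xi i" m] assms by simp
  then show ?thesis using assms by (simp only: comm_xi_left) simp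
qed

lemma comm_lone_right: "comm p 0 x lone m = 0"
  by (simp add: comm_def rho_lone rho_theta lie_bracket_lone_right[of x] rho_minus_left)

lemma lie_split_part:
  assumes "p \<in> {0, 1}" "x \<in> lie_part p"
  shows "nneg x \<in> lie_part p"
    "p = 0 \<Longrightarrow> x = nneg x + lie_scale (gcoeff (fst x) 0 {}) lone"
    "p = 1 \<Longrightarrow> x = nneg x + (\<Sum>i\<in>UNIV. lie_scale (gcoeff (fst x) 0 {i}) (xi i))"
proof -
  have z: "lie_scale 0 y = 0" for y by (simp add: lie_scale_def zero_prod_def)
  have c: "gcoeff (fst x) 0 I = 0" if "card I mod 2 \<noteq> p" for I
  proof -
    have "fst x I = 0" using assms(2) that unfolding lie_part_def mem_Collect_eq by metis
    then show ?thesis by (simp add: gcoeff_def)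
  qed
  show "p = 0 \<Longrightarrow> x = nneg x + lie_scale (gcoeff (fst x) 0 {}) lone"
    by (simp add: nneg_def c z)
  show "p = 1 \<Longrightarrow> x = nneg x + (\<Sum>i\<in>UNIV. lie_scale (gcoeff (fst x) 0 {i}) (xi i))"
    by (simp add: nneg_def c z)
  consider "p = 0" | "p = 1" using assms by auto
  then show "nneg x \<in> lie_part p"
  proof cases
    case 1
    then have "nneg x = x - lie_scale (gcoeff (fst x) 0 {}) lone" by (simp add: nneg_def c z)
    then show ?thesis using 1 assms by (simp add: lie_part_diff lie_part_scale lone_part)
  next
    case 2
    then have "nneg x = x - (\<Sum>i\<in>UNIV. lie_scale (gcoeff (fst x) 0 {i}) (xi i))"
        by (simp add: nneg_def c z)
    moreover have "(\<Sum>i\<in>UNIV. lie_scale (gcoeff (fst x) 0 {i}) (xi i)) \<in> lie_part 1"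
      by (intro lie_part_sum lie_part_scale xi_part) simp_all
    ultimately show ?thesis using 2 assms lie_part_diff[of 1 x] by simp
  qed
qed

text \<open>Both arguments are split along \<open>nneg\<close>. For two nonnegative parts the
  identity is the module axiom of F; if one argument is 1 or \<xi>_i, it is the recursion.\<close>

lemma comm_vac:
  assumes p: "p \<in> {0, 1}" "x \<in> lie_part p" and q: "q \<in> {0, 1}" "y \<in> lie_part q"
  shows "comm p q x y (vac v) = 0"
proof -
  have *: "comm p q (nneg x) (nneg y) (vac v) = 0"
    using act_bracket[OF p(1) q(1) nneg_nonneg nneg_nonneg lie_split_part(1)[OF p]
        lie_split_part(1)[OF q], of v]
    by (simp add: comm_def rho_vac_nonneg nneg_nonneg lie_nonneg_bracket mscale_single single_diff)
  have sum_right: "comm p q z (\<Sum>i\<in>UNIV. f i) m = (\<Sum>i\<in>UNIV. comm p q z (f i) m)"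
      for z m and f :: "ix \<Rightarrow> lie"
    by (rule additive.sum) (simp add: additive_def comm_add_right)
  have sum_left: "comm p q (\<Sum>i\<in>UNIV. f i) z m = (\<Sum>i\<in>UNIV. comm p q (f i) z m)"
      for z m and f :: "ix \<Rightarrow> lie"
    using additive.sum[of "\<lambda>x. comm p q x z m"] by (simp add: additive_def comm_add_left)
  have **: "comm p q (nneg x) y (vac v) = 0"
  proof (cases "q = 0")
    case True
    show ?thesis
      by (subst lie_split_part(2)[OF q True])
          (simp add: comm_add_right comm_scale_right *, simp add: True comm_lone_right)
  next
    case False
    then have q1: "q = 1" using q by simp
    show ?thesis
      by (subst lie_split_part(3)[OF q q1]) (simp add: comm_add_right comm_scale_right sum_right *,
        simp add: q1 comm_xi_right[OF p(1) lie_split_part(1)[OF p], unfolded One_nat_def])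
  qed
  show ?thesis
  proof (cases "p = 0")
    case True
    show ?thesis
      by (subst lie_split_part(2)[OF p True])
          (simp add: comm_add_left comm_scale_left **, simp add: True comm_lone_left)
  next
    case False
    then have p1: "p = 1" using p by simp
    show ?thesis
      by (subst lie_split_part(3)[OF p p1]) (simp add: comm_add_left comm_scale_left sum_left **,
        simp add: p1 comm_xi_left[OF q, unfolded One_nat_def])
  qed
qed

lemma comm_zero:
  assumes "p \<in> {0, 1}" "x \<in> lie_part p" "q \<in> {0, 1}" "y \<in> lie_part q"
  shows "comm p q x y m = 0"
  using assms
proof (induction m arbitrary: p q x y rule: verma_induct)
  case (add m m')
  then show ?case by (simp add: comm_add)
next
  case (vac v)
  then show ?case by (rule comm_vac)
next
  case (theta m)
  have "comm p q (lie_bracket lone x) y m = 0" "comm p q x (lie_bracket lone y) m = 0"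
      "comm p q x y m = 0"
    using theta by (simp_all add: lie_part_lone_bracket)
  \<comment> \<open>\<Theta> passes through the supercommutator because ad 1 is a derivation of the
    bracket.\<close>
  moreover have "comm p q x y (theta m) = theta (comm p q x y m)
     - comm p q (lie_bracket lone x) y m - comm p q x (lie_bracket lone y) m"
    by (simp add: comm_def rho_theta rho_diff theta_diff theta_add theta_scale
        lie_bracket_lone_jacobi rho_add_left
      M.scale_right_diff_distrib algebra_simps)
  ultimately show ?case by simp
next
  case (eta i m)
  have p: "1 - p \<in> {0, 1}" and q: "1 - q \<in> {0, 1}" by auto
  have IH: "comm (1 - p) q (lie_bracket (xi i) x) y m = 0"
    by (rule eta.IH[OF p lie_part_xi_bracket[OF eta.prems(1,2)] eta.prems(3,4)])
  have IH': "comm p (1 - q) x (lie_bracket (xi i) y) m = 0"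
    by (rule eta.IH[OF eta.prems(1,2) q lie_part_xi_bracket[OF eta.prems(3,4)]])
  have par: "lie_parity x = lie_scale ((- 1) ^ p) x" "lie_parity y = lie_scale ((- 1) ^ q) y"
    using eta.prems by (simp_all only: lie_part_iff)
  \<comment> \<open>The same for \<eta>_i, by the Jacobi identity with \<xi>_i. The bracket with
    \<xi>_i flips a parity, whence the indices 1 - p and 1 - q.\<close>
  have "comm p q x y (eta i m) = mscale ((- 1) ^ (p + q)) (eta i (comm p q x y m)
     - comm (1 - p) q (lie_bracket (xi i) x) y m) - mscale ((- 1) ^ q) (comm p (1
         - q) x (lie_bracket (xi i) y) m)"
    unfolding comm_def rho_eta[of "lie_bracket x y"] lie_parity_bracket par rho_part_eta[OF
        eta.prems(1,2)] rho_part_eta[OF eta.prems(3,4)]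
      lie_bracket_xi_jacobi lie_bracket_scale_left lie_bracket_scale_right
    using eta.prems(1,3)
    by (auto simp: rho_diff rho_minus eta_diff eta_minus eta_add rho_part_eta[OF eta.prems(1,2)]
        rho_part_eta[OF eta.prems(3,4)]
       lie_scale_minus_one rho_add_left rho_diff_left rho_minus_left lie_bracket_xi_jacobi par
           lie_bracket_minus_left algebra_simps)
  then show ?case by (simp only: IH IH' eta.IH[OF eta.prems]) simp
qed

lemma rho_bracket:
  assumes "p \<in> {0, 1}" "x \<in> lie_part p" "q \<in> {0, 1}" "y \<in> lie_part q"
  shows "rho (lie_bracket x y) m = rho x (rho y m) - mscale ((- 1) ^ (p * q)) (rho y (rho x m))"
  using comm_zero[OF assms, of m] by (simp add: comm_def)

end

section \<open>The comparison with \<open>Ind(F)\<close>\<close>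

lemma iota_add: "iota (x + y) = iota x + iota y"
proof transfer
  fix x y
  have "1 * (letter (x + y) - letter x - letter y) * 1 \<in> U_ideal"
    by (rule U_ideal.gen) (unfold U_relators_def, blast)
  then show "U_rel (letter (x + y)) (letter x + letter y)" by (simp add: U_rel_def algebra_simps)
qed

lemma iota_scale: "iota (lie_scale c x) = U_scale c (iota x)"
  unfolding U_scale_def
proof transfer
  fix x c
  have "1 * (letter (lie_scale c x) - scalar c * letter x) * 1 \<in> U_ideal"
    by (rule U_ideal.gen) (unfold U_relators_def, blast)
  then show "U_rel (letter (lie_scale c x)) (scalar c * letter x)" by (simp add: U_rel_def)
qed

lemma iota_bracket:
  assumes "p \<in> {0, 1}" "q \<in> {0, 1}" "x \<in> lie_part p" "y \<in> lie_part q"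
  shows "iota x * iota y = U_scale ((- 1) ^ (p * q)) (iota y * iota x) + iota (lie_bracket x y)"
  using assms unfolding U_scale_def
proof transfer
  fix p q x y
  assume *: "p \<in> {0, 1 :: nat}" "q \<in> {0, 1 :: nat}" "x \<in> lie_part p" "y \<in> lie_part q"
  have "1 * (letter x * letter y - scalar ((- 1) ^ (p * q)) * letter y * letter x
           - letter (lie_bracket x y)) * 1 \<in> U_ideal"
    by (rule U_ideal.gen) (unfold U_relators_def, use * in blast)
  then show "U_rel (letter x * letter y) (scalar ((- 1) ^ (p * q)) * (letter y * letter x)
      + letter (lie_bracket x y))"
    by (simp add: U_rel_def algebra_simps)
qed

interpretation UV: vector_space U_scale by (rule vector_space_U)

context nonneg_module begin

section \<open>U(\<gg>) acting on the model\<close>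

definition free_act :: "free_alg \<Rightarrow> (nat \<times> ix set \<Rightarrow>\<^sub>0 'f) \<Rightarrow> (nat \<times> ix set \<Rightarrow>\<^sub>0 'f)" where
  "free_act a m = mext (\<lambda>w c. mscale c (foldr rho (letters w) m)) a"

lemma free_act_add: "free_act (a + b) m = free_act a m + free_act b m"
  unfolding free_act_def by (rule mext_add) (simp add: M.scale_left_distrib)

lemma free_act_single: "free_act (Poly_Mapping.single w c) m = mscale c (foldr rho (letters w) m)"
  unfolding free_act_def by (subst mext_single) simp_all

lemma foldr_rho_add: "foldr rho xs (m + m') = foldr rho xs m + foldr rho xs m'"
  by (induction xs) (simp_all add: rho_add)

lemma foldr_rho_scale: "foldr rho xs (mscale c m) = mscale c (foldr rho xs m)"
  by (induction xs) (simp_all add: rho_scale)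

lemma foldr_rho_zero: "foldr rho xs 0 = 0"
  by (induction xs) simp_all

lemma free_act_zero [simp]: "free_act 0 m = 0" by (simp add: free_act_def)

lemma free_act_add_right: "free_act a (m + m') = free_act a m + free_act a m'"
  by (induction a rule: poly_mapping_single_induct)
    (simp_all add: free_act_add free_act_single foldr_rho_add M.scale_right_distrib)

lemma free_act_scale_right: "free_act a (mscale c m) = mscale c (free_act a m)"
  by (induction a rule: poly_mapping_single_induct)
    (simp_all add: free_act_add free_act_single foldr_rho_scale M.scale_right_distrib mult.commute)

lemma free_act_mult: "free_act (a * b) m = free_act a (free_act b m)"
proof (induction a rule: poly_mapping_single_induct)
  case (add a w c)
  have "free_act (Poly_Mapping.single w c * b) m
      = free_act (Poly_Mapping.single w c) (free_act b m)"
  proof (induction b rule: poly_mapping_single_induct)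
    case zero
    show ?case by (simp add: free_act_single foldr_rho_zero)
  next
    case (add b w' c')
    then show ?case
      by (simp add: distrib_left free_act_add mult_single free_act_single foldr_rho_add
          foldr_rho_scale
        M.scale_right_distrib plus_word_def)
  qed
  then show ?case using add by (simp add: distrib_right free_act_add)
qed simp

lemma free_act_letter: "free_act (letter x) m = rho x m"
  by (simp add: letter_def free_act_single)

lemma free_act_scalar: "free_act (scalar c) m = mscale c m"
  by (simp add: scalar_def free_act_single zero_word_def)

lemma free_act_diff: "free_act (a - b) m = free_act a m - free_act b m"
  using free_act_add[of "a - b" b m] by simp

lemma free_act_relator:
  assumes "r \<in> U_relators" shows "free_act r m = 0"
proof -
  consider x y where "r = letter (x + y) - letter x - letter y"
    | c x where "r = letter (lie_scale c x) - scalar c * letter x"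
    | x y p q where "r = letter x * letter y - scalar ((- 1) ^ (p * q)) * letter y * letter x
        - letter (lie_bracket x y)"
       "p \<in> {0, 1}" "q \<in> {0, 1}" "x \<in> lie_part p" "y \<in> lie_part q"
    using assms unfolding U_relators_def by blast
  then show ?thesis
  proof cases
    case 3
    then show ?thesis
      by (simp only: free_act_diff free_act_letter free_act_mult free_act_scalar rho_bracket) simp
  qed (simp_all add: free_act_diff free_act_letter free_act_mult free_act_scalar rho_add_left
      rho_scale_left)
qed

lemma free_act_ideal: "a \<in> U_ideal \<Longrightarrow> free_act a m = 0"
proof (induction rule: U_ideal.induct)
  case (gen r a b)
  have "free_act a 0 = 0" using free_act_scale_right[of a 0 0] by simp
  then show ?case using gen by (simp add: free_act_mult free_act_relator)
qed (simp_all add: free_act_add)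

definition U_act :: "U \<Rightarrow> (nat \<times> ix set \<Rightarrow>\<^sub>0 'f) \<Rightarrow> (nat \<times> ix set \<Rightarrow>\<^sub>0 'f)" where
  "U_act u = free_act (rep_U u)"

text \<open>The representative chosen by \<open>rep_U\<close> differs from a by an element of the
  ideal, and the ideal acts as zero.\<close>

lemma U_act_abs: "U_act (abs_U a) m = free_act a m"
proof -
  have "U_rel (rep_U (abs_U a)) a"
    using Quotient3_rep_abs[OF Quotient3_U, of a] by (simp add: U_rel_refl)
  then show ?thesis
    using free_act_ideal[of "rep_U (abs_U a) - a" m]
        by (simp add: U_act_def U_rel_def free_act_diff)
qed

lemma U_act_add: "U_act (u + u') m = U_act u m + U_act u' m"
  by (induction u rule: U.abs_induct; induction u' rule: U.abs_induct)
    (simp add: plus_U.abs_eq U_act_abs free_act_add)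

lemma U_act_mult: "U_act (u * u') m = U_act u (U_act u' m)"
  by (induction u rule: U.abs_induct; induction u' rule: U.abs_induct)
    (simp add: times_U.abs_eq U_act_abs free_act_mult)

lemma U_act_iota: "U_act (iota x) m = rho x m"
  by (simp add: iota.abs_eq U_act_abs free_act_letter)

lemma U_act_one: "U_act 1 m = m"
  by (simp add: one_U.abs_eq U_act_abs free_act_single[of 0 1, simplified] zero_word_def)

lemma U_act_scale: "U_act (U_scale c u) m = mscale c (U_act u m)"
  by (simp add: U_scale_def U_act_mult) (simp add: U_scalar.abs_eq U_act_abs free_act_scalar)

lemma U_act_add_right: "U_act u (m + m') = U_act u m + U_act u m'"
  by (simp add: U_act_def free_act_add_right)

lemma U_act_scale_right: "U_act u (mscale c m) = mscale c (U_act u m)"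
  by (simp add: U_act_def free_act_scale_right)

text \<open>The map u \<otimes> v \<mapsto> u (1 \<otimes> v) on formal sums. It annihilates the
  relators of Ind(F), so it depends only on the class.\<close>

definition ev :: "'f pre_ind \<Rightarrow> (nat \<times> ix set \<Rightarrow>\<^sub>0 'f)" where
  "ev = mext (\<lambda>(u, v) c. mscale c (U_act u (vac v)))"

lemma ev_add: "ev (S + T) = ev S + ev T"
  unfolding ev_def by (rule mext_add) (auto simp: M.scale_left_distrib)

lemma ev_single: "ev (Poly_Mapping.single (u, v) c) = mscale c (U_act u (vac v))"
  unfolding ev_def by (subst mext_single) auto

lemma ev_zero [simp]: "ev 0 = 0" by (simp add: ev_def)

lemma ev_tens: "ev (tens u v) = U_act u (vac v)"
  by (simp add: tens_def ev_single)

lemma ev_diff: "ev (S - T) = ev S - ev T"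
  using ev_add[of "S - T" T] by simp

lemma pre_scale_single: "pre_scale c (Poly_Mapping.single k d) = Poly_Mapping.single k (c * d)"
  by (rule poly_mapping_eqI) (simp add: lookup_pre_scale lookup_single when_def)

lemma ev_scale: "ev (pre_scale c T) = mscale c (ev T)"
proof (induction T rule: poly_mapping_single_induct)
  case zero
  show ?case by simp
next
  case (add T k d)
  then show ?case by (cases k) (simp add: pre.scale_right_distrib ev_add pre_scale_single
      ev_single M.scale_right_distrib)
qed

lemma ev_relator:
  assumes "T \<in> ind_relators scale act" shows "ev T = 0"
proof -
  consider u u' v where "T = tens (u + u') v - tens u v - tens u' v"
    | u v v' where "T = tens u (v + v') - tens u v - tens u v'"
    | c u v where "T = tens (U_scale c u) v - pre_scale c (tens u v)"
    | c u v where "T = tens u (scale c v) - pre_scale c (tens u v)"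
    | u y v where "T = tens (u * iota y) v - tens u (act y v)" "y \<in> lie_nonneg"
    using assms unfolding ind_relators_def by blast
  then show ?thesis
    by cases (simp_all add: ev_diff ev_tens ev_scale U_act_add U_act_scale U_act_mult U_act_iota
      rho_vac_nonneg single_add U_act_add_right U_act_scale_right flip: mscale_single)
qed

lemma ev_span: "T \<in> pre.span (ind_relators scale act) \<Longrightarrow> ev T = 0"
  by (induction rule: pre.span_induct_alt) (simp_all add: ev_add ev_scale ev_relator)

lemma ev_pre_act: "ev (pre_act x T) = rho x (ev T)"
proof (induction T rule: poly_mapping_single_induct)
  case zero
  show ?case by (simp add: pre_act_def)
next
  case (add T k c)
  obtain u v where k: "k = (u, v)" by fastforce
  have "Poly_Mapping.single k c = pre_scale c (tens u v)" by (simp add: k tens_def pre_scale_single)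
  then show ?case using add
    by (simp add: pre_act_add ev_add rho_add pre_act_scale pre_act_tens ev_scale ev_tens
        U_act_mult U_act_iota rho_scale)
qed

end

section \<open>The ordered monomials \<Theta>^a \<eta>_I in U(\<gg>)\<close>

definition U_mono :: "nat \<times> ix set \<Rightarrow> U" where
  "U_mono k = iota lone ^ fst k * prod_list (map (\<lambda>i. iota (xi i)) (ixlist (snd k)))"

lemma iota_zero: "iota 0 = 0" using iota_add[of 0 0] by simp

lemma iota_minus: "iota (- x) = - iota x" using iota_add[of x "- x"]
  by (simp add: iota_zero eq_neg_iff_add_eq_0 add.commute)

lemma iota_xi_lone: "iota (xi i) * iota lone = iota lone * iota (xi i)"
  using iota_bracket[of 1 0 "xi i" lone] by
      (simp add: xi_part[simplified] lone_part lie_bracket_xi_lone iota_zero)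

lemma iota_xi_xi: "iota (xi i) * iota (xi j) = - (iota (xi j) * iota (xi i)) + (if i = j then
  - iota lone else 0)"
  using iota_bracket[of 1 1 "xi i" "xi j"]
  by (simp add: xi_part[simplified] lie_bracket_xi_xi_eq iota_zero iota_minus split: if_splits)

lemma iota_xi_square: "iota (xi i) * iota (xi i) = U_scale (- 1 / 2) (iota lone)"
proof -
  have "U_scale (1 / 2) (iota (xi i) * iota (xi i) + iota (xi i) * iota (xi i))
      = iota (xi i) * iota (xi i)"
    by (simp only: UV.scale_right_distrib UV.scale_left_distrib[symmetric]) simp
  moreover have "iota (xi i) * iota (xi i) + iota (xi i) * iota (xi i) = - iota lone"
    using iota_xi_xi[of i i] by (simp add: eq_neg_iff_add_eq_0 algebra_simps)
  ultimately show ?thesis by simp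
qed

lemma iota_xi_lone_power: "iota (xi i) * iota lone ^ a = iota lone ^ a * iota (xi i)"
  by (induction a) (simp_all add: mult.assoc power_Suc2 flip: power_Suc, metis iota_xi_lone
      mult.assoc)

lemma U_scale_left_commute: "u * U_scale c w = U_scale c (u * w)"
  unfolding U_scale_def
proof transfer
  fix u c w
  have "u * (scalar c * w) = scalar c * (u * w)"
    by (simp only: mult.assoc[symmetric] scalar_central[of c u])
  then show "U_rel (u * (scalar c * w)) (scalar c * (u * w))" by (simp only: U_rel_refl)
qed

lemma U_scale_mult_left: "U_scale c u * w = U_scale c (u * w)"
  by (simp add: U_scale_def mult.assoc)

text \<open>Sorting \<xi>_i into the ordered product produces the sign; a repeated factor becomes -
  \<Theta> / 2, and \<Theta> commutes with all factors.\<close>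

lemma U_mono_xi_0: "iota (xi i) * prod_list (map (\<lambda>i. iota (xi i)) (ixlist I)) =
     (if i \<in> I then U_scale (- gsign {i} (I
         - {i}) / 2) (iota lone * prod_list (map (\<lambda>i. iota (xi i)) (ixlist (I - {i}))))
     else U_scale (gsign {i} I) (prod_list (map (\<lambda>i. iota (xi i)) (ixlist (insert i I)))))"
proof -
  have sq: "iota (xi j) * (iota (xi j) * u) = U_scale (- 1 / 2) (iota lone * u)" for j u
    by (simp only: mult.assoc[symmetric] iota_xi_square U_scale_mult_left)
  have swap: "iota (xi j) * iota (xi k) = - (iota (xi k) * iota (xi j))" if "j \<noteq> k" for j k
    using that iota_xi_xi[of j k] by simp
  have swap': "iota (xi j) * (iota (xi k) * u) = - (iota (xi k) * (iota (xi j) * u))" if "j \<noteq> k"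
      for j k u
    using swap[OF that] by (simp flip: mult.assoc)
  have lone: "iota (xi j) * (iota lone * u) = iota lone * (iota (xi j) * u)" for j u
    by (simp add: iota_xi_lone flip: mult.assoc)
  \<comment> \<open>Only decreasing pairs are swapped, so that rewriting sorts a product and
    stops.\<close>
  note rules = swap[of X2 X1, simplified] swap[of X3 X1, simplified] swap[of X4 X1, simplified]
    swap[of X3 X2, simplified] swap[of X4 X2, simplified] swap[of X4 X3, simplified]
    swap'[of X2 X1, simplified] swap'[of X3 X1, simplified] swap'[of X4 X1, simplified]
    swap'[of X3 X2, simplified] swap'[of X4 X2, simplified] swap'[of X4 X3, simplified]
  show ?thesis
    by (cases i; cases I rule: ix_set_cases)
      (simp_all add: ixlist_def grass_eval rules sq iota_xi_square lone iota_xi_lone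
        U_scale_left_commute mult.assoc)
qed

text \<open>The coefficients are those of \<open>eta_single\<close>: left multiplication by \<xi>_i
  in U(\<gg>) matches \<eta>_i on the model.\<close>

lemma U_mono_xi: "iota (xi i) * U_mono (a, I) =
     (if i \<in> I then U_scale (- gsign {i} (I - {i}) / 2) (U_mono (Suc a, I - {i}))
     else U_scale (gsign {i} I) (U_mono (a, insert i I)))"
proof -
  have "iota (xi i) * U_mono (a, I) = iota lone ^ a * (iota (xi i) * prod_list (map (\<lambda>i. iota (xi
      i)) (ixlist I)))"
    by (simp add: U_mono_def iota_xi_lone_power flip: mult.assoc)
  then show ?thesis unfolding U_mono_xi_0
    by (simp add: U_mono_def U_scale_left_commute power_Suc2 mult.assoc del: power_Suc)
qed

lemma U_mono_lone: "iota lone * U_mono (a, I) = U_mono (Suc a, I)"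
  by (simp add: U_mono_def mult.assoc)

lemma grass_eq_iff: "f = g \<longleftrightarrow> (\<forall>m I. gcoeff f m I = gcoeff g m I)"
  by (auto simp: gcoeff_def fun_eq_iff poly_eq_iff)

context nonneg_module begin

lemma gcoeff_nneg: "gcoeff (fst (nneg x)) m I =
   (if m = 0 \<and> card I \<le> 1 then 0 else gcoeff (fst x) m I)"
proof -
  have "(\<Sum>i\<in>UNIV. gcoeff (fst x) 0 {i} * (if I = {i} \<and> m = 0 then 1 else 0)) =
    (if m = 0 \<and> card I = 1 then gcoeff (fst x) 0 I else 0)"
  proof (cases "m = 0 \<and> card I = 1")
    case True
    then obtain j where "I = {j}" by (auto simp: card_1_singleton_iff)
    then show ?thesis using True by (simp add: if_distrib[of "times _"] cong: if_cong)
  next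
    case False
    then show ?thesis by (auto intro!: sum.neutral)
  qed
  then show ?thesis
    by (auto simp: nneg_def fst_lone fst_xi fst_lie_scale gcoeff_fst_sum gcoeff_gmono le_Suc_eq)
qed

lemma snd_nneg: "snd (nneg x) = snd x"
proof -
  have "snd (\<Sum>i\<in>UNIV. lie_scale (gcoeff (fst x) 0 {i}) (xi i))
      = (\<Sum>i\<in>UNIV. snd (lie_scale (gcoeff (fst x) 0 {i}) (xi i)))"
    by (rule additive.sum) (simp add: additive_def)
  then show ?thesis by (simp add: nneg_def lie_scale_def lone_def xi_def)
qed

text \<open>The only monomials of negative degree are the \<xi>_i and 1, in degrees - 1 and - 2; a
  lower degree leaves x = 0.\<close>

lemma lie_neg_cases:
  assumes "d < 0" "x \<in> lie_comp d"
  obtains "d = - 1" "x = (\<Sum>i\<in>UNIV. lie_scale (gcoeff (fst x) 0 {i}) (xi i))"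
  | "d = - 2" "x = lie_scale (gcoeff (fst x) 0 {}) lone" | "x = 0"
proof -
  have c: "2 * int m + int (card I) - 2 = d" if "gcoeff (fst x) m I \<noteq> 0" for m I
    using assms that by (auto simp: lie_comp_def lie_degrees_subset_iff)
  have "snd x = 0" using assms by (auto simp: lie_comp_def lie_degrees_subset_iff)
  moreover have "gcoeff (fst (nneg x)) m I = 0" for m I
    using c[of m I] assms(1) by (cases "gcoeff (fst x) m I = 0") (auto simp: gcoeff_nneg)
  ultimately have n: "nneg x = 0" by (simp add: prod_eq_iff grass_eq_iff snd_nneg)
  have z: "lie_scale 0 y = 0" for y by (simp add: lie_scale_def zero_prod_def)
  have x: "x = lie_scale (gcoeff (fst x) 0 {}) lone
      + (\<Sum>i\<in>UNIV. lie_scale (gcoeff (fst x) 0 {i}) (xi i))"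
    using n unfolding nneg_def by (simp add: algebra_simps)
  have l: "gcoeff (fst x) 0 {} = 0" if "d \<noteq> - 2" using c[of 0 "{}"] that by auto
  have s: "gcoeff (fst x) 0 {i} = 0" if "d \<noteq> - 1" for i using c[of 0 "{i}"] that by auto
  consider "d = - 1" | "d = - 2" | "d \<noteq> - 1" "d \<noteq> - 2" by blast
  then show thesis
  proof cases
    case 1
    then show thesis using x that(1) by (simp add: l z)
  next
    case 2
    then show thesis using x that(2) by (simp add: s z)
  next
    case 3
    then show thesis using x that(3) by (simp add: l s z)
  qed
qed

section \<open>Reduction to ordered monomials in Ind(F)\<close>

definition ind_eq :: "'f pre_ind \<Rightarrow> 'f pre_ind \<Rightarrow> bool" where
  "ind_eq S T \<longleftrightarrow> S - T \<in> pre.span (ind_relators scale act)"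

lemma ind_eq_refl: "ind_eq S S" by (simp add: ind_eq_def pre.span_zero)

lemma ind_eq_sym: "ind_eq S T \<Longrightarrow> ind_eq T S"
  unfolding ind_eq_def by (drule pre.span_neg) simp

lemma ind_eq_trans [trans]: "ind_eq S T \<Longrightarrow> ind_eq T W \<Longrightarrow> ind_eq S W"
  unfolding ind_eq_def by (drule (1) pre.span_add) simp

lemma ind_eq_add: "ind_eq S T \<Longrightarrow> ind_eq S' T' \<Longrightarrow> ind_eq (S + S') (T + T')"
  unfolding ind_eq_def by (drule (1) pre.span_add) (simp add: algebra_simps)

lemma ind_eq_scale: "ind_eq S T \<Longrightarrow> ind_eq (pre_scale c S) (pre_scale c T)"
  unfolding ind_eq_def pre.scale_right_diff_distrib[symmetric] by (rule pre.span_scale)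

lemma ind_eq_pre_act: "ind_eq S T \<Longrightarrow> ind_eq (pre_act x S) (pre_act x T)"
  unfolding ind_eq_def pre_act_diff[symmetric] by (rule pre_act_span)

lemma ind_eq_ev: "ind_eq S T \<Longrightarrow> ev S = ev T"
  using ev_span[of "S - T"] by (simp add: ind_eq_def ev_diff)

lemma ind_eq_tens:
  "ind_eq (tens (u + u') v) (tens u v + tens u' v)"
  "ind_eq (tens u (v + v')) (tens u v + tens u v')"
  "ind_eq (tens (U_scale c u) v) (pre_scale c (tens u v))"
  "ind_eq (tens u (scale c v)) (pre_scale c (tens u v))"
  unfolding ind_eq_def diff_diff_eq[symmetric] by (intro pre.span_base ind_relatorsI)+

lemma ind_eq_tens_zero: "ind_eq (tens u 0) 0" "ind_eq (tens 0 v) 0"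
  using ind_eq_tens(4)[of u 0 0] ind_eq_tens(3)[of 0 0 v] by simp_all

text \<open>The candidate inverse of \<open>ev\<close>. Since \<open>tens\<close> is additive in the
  vector only modulo the relators, the same holds for \<open>canon\<close>.\<close>

definition canon :: "(nat \<times> ix set \<Rightarrow>\<^sub>0 'f) \<Rightarrow> 'f pre_ind" where
  "canon = mext (\<lambda>k. tens (U_mono k))"

lemma ind_eq_sum: "(\<And>a. a \<in> A \<Longrightarrow> ind_eq (f a) (g a)) \<Longrightarrow> ind_eq (sum f A) (sum g A)"
  by (induction A rule: infinite_finite_induct) (auto simp: ind_eq_refl intro: ind_eq_add)

text \<open>A vanishing coefficient contributes u \<otimes> 0, which is a nonzero formal symbol but
  zero in Ind(F).\<close>

lemma canon_superset:
  assumes "finite A" "Poly_Mapping.keys m \<subseteq> A"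
  shows "ind_eq (\<Sum>k\<in>A. tens (U_mono k) (Poly_Mapping.lookup m k)) (canon m)"
proof -
  have "ind_eq (\<Sum>k\<in>A. tens (U_mono k) (Poly_Mapping.lookup m k))
     (\<Sum>k\<in>A. if k \<in> Poly_Mapping.keys m then tens (U_mono k) (Poly_Mapping.lookup m k) else 0)"
    by (rule ind_eq_sum) (auto simp: in_keys_iff ind_eq_refl ind_eq_tens_zero)
  also have "(\<Sum>k\<in>A. if k \<in> Poly_Mapping.keys m then tens (U_mono k) (Poly_Mapping.lookup m k) else
      0) = canon m"
    unfolding canon_def mext_def using assms
        by (simp add: sum.inter_restrict[symmetric] Int_absorb1)
  finally show ?thesis .
qed

lemma canon_add: "ind_eq (canon (m + m')) (canon m + canon m')"
proof -
  let ?A = "Poly_Mapping.keys m \<union> Poly_Mapping.keys m'"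
  have "ind_eq (canon (m + m')) (\<Sum>k\<in>?A. tens (U_mono k) (Poly_Mapping.lookup (m + m') k))"
    by (rule ind_eq_sym, rule canon_superset) (use keys_add[of m m'] in auto)
  also have "ind_eq \<dots> (\<Sum>k\<in>?A. tens (U_mono k) (Poly_Mapping.lookup m k)
      + tens (U_mono k) (Poly_Mapping.lookup m' k))"
    by (rule ind_eq_sum) (simp add: lookup_add ind_eq_tens)
  also have "ind_eq \<dots> (canon m + canon m')"
    unfolding sum.distrib by (intro ind_eq_add canon_superset) auto
  finally show ?thesis .
qed

lemma canon_single: "ind_eq (canon (Poly_Mapping.single k v)) (tens (U_mono k) v)"
  using canon_superset[of "{k}" "Poly_Mapping.single k v", THEN ind_eq_sym] by simp

lemma canon_scale: "ind_eq (canon (mscale c m)) (pre_scale c (canon m))"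
proof (induction m rule: M_induct)
  case (add m m')
  have "ind_eq (canon (mscale c m + mscale c m')) (canon (mscale c m) + canon (mscale c m'))"
      by (rule canon_add)
  also have "ind_eq \<dots> (pre_scale c (canon m) + pre_scale c (canon m'))" by (intro ind_eq_add add)
  also have "ind_eq \<dots> (pre_scale c (canon (m + m')))"
    unfolding pre.scale_right_distrib[symmetric] by (intro ind_eq_scale ind_eq_sym[OF canon_add])
  finally show ?case by (simp add: M.scale_right_distrib)
next
  case (single a I v)
  have "ind_eq (canon (mscale c (Poly_Mapping.single (a, I) v))) (tens (U_mono (a, I)) (scale c v))"
    unfolding mscale_single by (rule canon_single)
  also have "ind_eq \<dots> (pre_scale c (tens (U_mono (a, I)) v))" by (rule ind_eq_tens)
  also have "ind_eq \<dots> (pre_scale c (canon (Poly_Mapping.single (a, I) v)))"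
    by (intro ind_eq_scale ind_eq_sym[OF canon_single])
  finally show ?case .
qed

lemma canon_hom:
  assumes add: "\<And>m m'. F (m + m') = F m + F m'"
    and single: "\<And>a I v. ind_eq (tens (iota x * U_mono (a, I)) v) (canon (F (Poly_Mapping.single
        (a, I) v)))"
  shows "ind_eq (pre_act x (canon m)) (canon (F m))"
proof (induction m rule: M_induct)
  case (add m m')
  have "ind_eq (pre_act x (canon (m + m'))) (pre_act x (canon m) + pre_act x (canon m'))"
    unfolding pre_act_add[symmetric] by (intro ind_eq_pre_act canon_add)
  also have "ind_eq \<dots> (canon (F m) + canon (F m'))" by (intro ind_eq_add add)
  also have "ind_eq \<dots> (canon (F (m + m')))" unfolding assms(1) by (rule ind_eq_sym[OF canon_add])
  finally show ?case .
next
  case (single a I v)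
  have "ind_eq (pre_act x (canon (Poly_Mapping.single (a, I) v))) (tens (iota x * U_mono (a, I)) v)"
    unfolding pre_act_tens[symmetric] by (intro ind_eq_pre_act canon_single)
  also note assms(2)
  finally show ?case .
qed

lemma canon_theta: "ind_eq (pre_act lone (canon m)) (canon (theta m))"
  by (rule canon_hom) (simp_all add: theta_add theta_single U_mono_lone canon_single[THEN
      ind_eq_sym])

lemma canon_eta: "ind_eq (pre_act (xi i) (canon m)) (canon (eta i m))"
proof (rule canon_hom)
  fix a I v
  have *: "ind_eq (tens (U_scale c (U_mono k)) v) (canon (Poly_Mapping.single k (scale c v)))"
      for c k
    by (rule ind_eq_trans[OF ind_eq_tens(3) ind_eq_trans[OF ind_eq_sym[OF ind_eq_tens(4)]
        ind_eq_sym[OF canon_single]]])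
  show "ind_eq (tens (iota (xi i) * U_mono (a, I)) v) (canon (eta i (Poly_Mapping.single (a, I)
      v)))"
    unfolding U_mono_xi eta_single using * by (simp only: split: if_splits) blast
qed (rule eta_add)

text \<open>T can be recovered from its image in the model; on such T the map \<open>ev\<close> is
  injective modulo the relators.\<close>

definition standard :: "'f pre_ind \<Rightarrow> bool" where
  "standard T \<longleftrightarrow> ind_eq T (canon (ev T))"

lemma standard_cong: "ind_eq S T \<Longrightarrow> standard T \<Longrightarrow> standard S"
  using ind_eq_ev[of S T] by (auto simp: standard_def intro: ind_eq_trans)

lemma standard_add: "standard S \<Longrightarrow> standard T \<Longrightarrow> standard (S + T)"
  unfolding standard_def ev_add by (rule ind_eq_trans[OF ind_eq_add ind_eq_sym[OF canon_add]])

lemma standard_scale: "standard T \<Longrightarrow> standard (pre_scale c T)"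
  unfolding standard_def ev_scale by (rule ind_eq_trans[OF ind_eq_scale ind_eq_sym[OF canon_scale]])

lemma standard_zero: "standard 0"
  by (simp add: standard_def canon_def ind_eq_refl)

lemma standard_theta: "standard T \<Longrightarrow> standard (pre_act lone T)"
  unfolding standard_def ev_pre_act rho_lone by (rule ind_eq_trans[OF ind_eq_pre_act canon_theta])

lemma standard_eta: "standard T \<Longrightarrow> standard (pre_act (xi i) T)"
  unfolding standard_def ev_pre_act rho_xi by (rule ind_eq_trans[OF ind_eq_pre_act canon_eta])

lemma standard_one: "standard (tens 1 v)"
  using canon_single[of "(0, {})" v, THEN ind_eq_sym]
  by (simp add: standard_def ev_tens U_act_one U_mono_def ixlist_empty)

lemma standard_tens_add: "standard (tens u v) \<Longrightarrow> standard (tens u' v) \<Longrightarrow> standard (tens (u + u') v)"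
  by (rule standard_cong[OF ind_eq_tens(1) standard_add])

lemma standard_tens_scale: "standard (tens u v) \<Longrightarrow> standard (tens (U_scale c u) v)"
  by (rule standard_cong[OF ind_eq_tens(3) standard_scale])

lemma standard_tens_zero: "standard (tens 0 v)"
  by (rule standard_cong[OF ind_eq_tens_zero(2) standard_zero])

lemma standard_tens_sum: "(\<And>a. a \<in> A \<Longrightarrow> standard (tens (f a) v)) \<Longrightarrow> standard (tens (sum f A) v)"
  by (induction A rule: infinite_finite_induct)
      (auto simp: standard_tens_zero intro: standard_tens_add)

text \<open>By linearity this reduces to 1 and \<xi>_i, whose left multiplications correspond to
  \<Theta> and \<eta>_i.\<close>

lemma standard_neg:
  assumes "standard (tens u v)" "d < 0" "x \<in> lie_comp d"
  shows "standard (tens (iota x * u) v)"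
proof -
  have l: "standard (tens (iota lone * u) v)" and s: "standard (tens (iota (xi i) * u) v)" for i
    using standard_theta[OF assms(1)] standard_eta[OF assms(1)] by (simp_all add: pre_act_tens)
  from assms(2,3) show ?thesis
  proof (cases rule: lie_neg_cases)
    case 1
    have "iota (\<Sum>i\<in>UNIV. lie_scale (gcoeff (fst x) 0 {i}) (xi i))
        = (\<Sum>i\<in>UNIV. iota (lie_scale (gcoeff (fst x) 0 {i}) (xi i)))"
      by (rule additive.sum) (simp add: additive_def iota_add)
    then have "iota x * u = (\<Sum>i\<in>UNIV. U_scale (gcoeff (fst x) 0 {i}) (iota (xi i) * u))"
      using 1(2) by (simp add: sum_distrib_right iota_scale U_scale_mult_left)
    then show ?thesis using s by (simp add: standard_tens_sum standard_tens_scale)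
  next
    case 2
    have "iota x * u = U_scale (gcoeff (fst x) 0 {}) (iota lone * u)"
      by (subst 2(2)) (simp add: iota_scale U_scale_mult_left)
    then show ?thesis using l by (simp add: standard_tens_scale)
  next
    case 3
    then show ?thesis by (simp add: iota_zero standard_tens_zero)
  qed
qed

section \<open>The grading of the model\<close>

definition M_comp :: "nat \<Rightarrow> (nat \<times> ix set \<Rightarrow>\<^sub>0 'f) set" where
  "M_comp k = {m. \<forall>a I. Poly_Mapping.lookup m (a, I) \<noteq> 0 \<longrightarrow> 2 * a + card I = k}"

lemma M_comp_add: "m \<in> M_comp k \<Longrightarrow> m' \<in> M_comp k \<Longrightarrow> m + m' \<in> M_comp k"
  unfolding M_comp_def by (auto simp: lookup_add) (metis add_0)+

lemma M_comp_scale: "m \<in> M_comp k \<Longrightarrow> mscale c m \<in> M_comp k"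
  unfolding M_comp_def by (auto simp: lookup_mscale)

lemma M_comp_zero: "0 \<in> M_comp k"
  by (simp add: M_comp_def)

lemma M_comp_single: "2 * a + card I = k \<Longrightarrow> Poly_Mapping.single (a, I) v \<in> M_comp k"
  by (auto simp: M_comp_def lookup_single when_def)

lemma M_comp_sum: "(\<And>a. a \<in> A \<Longrightarrow> f a \<in> M_comp k) \<Longrightarrow> sum f A \<in> M_comp k"
  by (induction A rule: infinite_finite_induct) (auto simp: M_comp_zero intro: M_comp_add)

lemma M_comp_hom:
  assumes add: "\<And>m m'. F (m + m') = F m + F m'"
    and single: "\<And>a I v. 2 * a + card I = k \<Longrightarrow> F (Poly_Mapping.single (a, I) v) \<in> M_comp l"
    and m: "m \<in> M_comp k"
  shows "F m \<in> M_comp l"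
proof -
  have "m = (\<Sum>p\<in>Poly_Mapping.keys m. Poly_Mapping.single p (Poly_Mapping.lookup m p))"
    by (rule poly_mapping_eqI) (simp add: lookup_sum lookup_single when_def in_keys_iff)
  moreover have "F (\<Sum>p\<in>A. Poly_Mapping.single p (f p)) = (\<Sum>p\<in>A. F (Poly_Mapping.single p (f p)))"
      for A f
    by (rule additive.sum) (simp add: additive_def add)
  ultimately have "F m = (\<Sum>p\<in>Poly_Mapping.keys m. F (Poly_Mapping.single p (Poly_Mapping.lookup m
      p)))"
    by metis
  also have "\<dots> \<in> M_comp l"
    using m by (intro M_comp_sum) (auto simp: M_comp_def[of k] in_keys_iff intro!: single)
  finally show ?thesis .
qed

lemma theta_comp: "m \<in> M_comp k \<Longrightarrow> theta m \<in> M_comp (k + 2)"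
  by (rule M_comp_hom[OF theta_add]) (auto simp: theta_single intro: M_comp_single)

lemma eta_comp: "m \<in> M_comp k \<Longrightarrow> eta i m \<in> M_comp (k + 1)"
proof (rule M_comp_hom[OF eta_add])
  fix a v and I :: "ix set" assume "2 * a + card I = k"
  then show "eta i (Poly_Mapping.single (a, I) v) \<in> M_comp (k + 1)"
    using card_Suc_Diff1[of I i] by (auto simp: eta_single intro!: M_comp_single)
qed

lemma rho_neg_comp:
  assumes "m \<in> M_comp k" "d < 0" "x \<in> lie_comp d" "int l = int k - d"
  shows "rho x m \<in> M_comp l"
  using assms(2,3)
proof (cases rule: lie_neg_cases)
  case 1
  have "rho (\<Sum>i\<in>UNIV. lie_scale (gcoeff (fst x) 0 {i}) (xi i)) m
      = (\<Sum>i\<in>UNIV. rho (lie_scale (gcoeff (fst x) 0 {i}) (xi i)) m)"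
    using additive.sum[of "\<lambda>x. rho x m"] by (simp add: additive_def rho_add_left)
  then have "rho x m = (\<Sum>i\<in>UNIV. mscale (gcoeff (fst x) 0 {i}) (eta i m))"
    using 1(2) by (simp add: rho_scale_left rho_xi)
  moreover have "l = k + 1" using 1 assms by simp
  ultimately show ?thesis using assms(1) by
      (auto intro!: M_comp_sum M_comp_scale eta_comp simp del: One_nat_def)
next
  case 2
  have "rho x m = mscale (gcoeff (fst x) 0 {}) (theta m)"
    by (subst 2(2)) (simp add: rho_scale_left rho_lone)
  moreover have "l = k + 2" using 2 assms by simp
  ultimately show ?thesis using theta_comp[OF assms(1)] by (simp add: M_comp_scale)
next
  case 3
  then show ?thesis by (simp add: M_comp_zero)
qed

lemma neg_word:
  assumes "list_all2 (\<lambda>x d. d < 0 \<and> x \<in> lie_comp d) xs ds" "sum_list ds = - int k"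
  shows "standard (tens (prod_list (map iota xs)) v)
    \<and> U_act (prod_list (map iota xs)) (vac v) \<in> M_comp k"
  using assms
proof (induction xs ds arbitrary: k rule: list_all2_induct)
  case Nil
  then show ?case by (simp add: standard_one U_act_one M_comp_single)
next
  case (Cons x xs d ds)
  \<comment> \<open>Every letter has negative degree, so the tail has degree - l for some natural
    number l.\<close>
  have "sum_list ds \<le> 0"
    using Cons.hyps(2) by (induction rule: list_all2_induct) auto
  then obtain l where l: "sum_list ds = - int l"
      by (metis int_nat_eq minus_minus neg_0_le_iff_le nonneg_int_cases)
  show ?case
    using Cons.IH[OF l] Cons.hyps(1) Cons.prems l
    by (auto simp: U_act_mult U_act_iota intro!: standard_neg rho_neg_comp[of _ l d])
qed

lemma U_neg_standard:
  assumes "u \<in> U_neg k"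
  shows "standard (tens u v) \<and> U_act u (vac v) \<in> M_comp k"
  using assms unfolding U_neg_def
proof (induction rule: UV.span_induct_alt)
  case base
  have "U_act 0 m = 0" for m using U_act_scale[of 0 0 m] by simp
  then show ?case by (simp add: standard_tens_zero M_comp_zero)
next
  case (step c u u')
  then have "standard (tens u v) \<and> U_act u (vac v) \<in> M_comp k" by (auto dest: neg_word)
  then show ?case using step
    by (simp add: standard_tens_add standard_tens_scale U_act_add U_act_scale M_comp_add
        M_comp_scale)
qed

lemma ind_comp_standard:
  assumes "Poly_Mapping.keys T \<subseteq> U_neg k \<times> UNIV"
  shows "standard T \<and> ev T \<in> M_comp k"
proof -
  have T: "T = (\<Sum>p\<in>Poly_Mapping.keys T. pre_scale (Poly_Mapping.lookup T p) (tens (fst p) (snd p)))"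
    by (rule poly_mapping_eqI) (simp add: lookup_sum lookup_pre_scale tens_def lookup_single
        when_def in_keys_iff
       if_distrib[of "times _"] cong: if_cong)
  have "standard (\<Sum>p\<in>A. pre_scale (c p) (tens (fst p) (snd p))) \<and> ev (\<Sum>p\<in>A. pre_scale (c p) (tens
      (fst p) (snd p))) \<in> M_comp k"
    if "A \<subseteq> U_neg k \<times> UNIV" for A c
    using that
    by (induction A rule: infinite_finite_induct)
      (auto simp: standard_zero M_comp_zero ev_add ev_scale ev_tens U_neg_standard intro!:
          standard_add standard_scale M_comp_add M_comp_scale)
  from this[OF assms, of "Poly_Mapping.lookup T"] show ?thesis using T by metis
qed

lemma ind_class_eq_zero: "ind_class scale act T = ind_zero scale act
  \<longleftrightarrow> T \<in> pre.span (ind_relators scale act)"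
  unfolding ind_zero_def ind_class_def
  using eq_equiv_class_iff[OF equiv_ind_rel, of T 0 scale act] by (simp add: ind_rel_def)

text \<open>The only consequence of the freeness of \<open>Ind(F)\<close> over \<open>U(\<gg>\<^sub><\<^sub>0)\<close> that is needed.\<close>

lemma singular_model_vector:
  assumes "X \<in> ind_comp scale act k" "X \<noteq> ind_zero scale act" "singular scale act X"
  obtains m where "m \<in> M_comp k" "m \<noteq> 0" "\<And>x. x \<in> lie_pos \<Longrightarrow> rho x m = 0"
proof -
  obtain T where T: "X = ind_class scale act T" "Poly_Mapping.keys T \<subseteq> U_neg k \<times> UNIV"
    using assms(1) unfolding ind_comp_def by blast
  have st: "standard T" "ev T \<in> M_comp k" using ind_comp_standard[OF T(2)] by auto
  show thesis
  proof
    \<comment> \<open>If the image vanished, T, being standard, would be equivalent to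
      \<open>canon 0\<close>, which is 0.\<close>
    show "ev T \<noteq> 0"
    proof
      assume "ev T = 0"
      then have "T \<in> pre.span (ind_relators scale act)"
        using st(1) by (simp add: standard_def ind_eq_def canon_def)
      then show False using assms(2) T(1) by (simp add: ind_class_eq_zero)
    qed
    fix x assume "x \<in> lie_pos"
    then have "pre_act x T \<in> pre.span (ind_relators scale act)"
      using assms(3) unfolding T(1) singular_def by (simp add: ind_act_class ind_class_eq_zero)
    then show "rho x (ev T) = 0" using ev_span by (simp flip: ev_pre_act)
  qed (rule st(2))
qed

end

section \<open>\<open>\<gg>\<^sub>>\<^sub>0\<close> acts trivially on \<open>F\<close>\<close>

definition lmono :: "nat \<Rightarrow> ix set \<Rightarrow> lie" where "lmono m I = (gmono m I, 0)"

text \<open>The element x is a finite combination of t^m \<xi>_I and C, which are homogeneous for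
  both gradings. The module axioms need homogeneous parity, the eigenvalue argument homogeneous
  degree.\<close>

lemma lie_homogeneous_induct [consumes 1, case_names zero add homogeneous]:
  assumes "lie_degrees x \<subseteq> D"
    and zero: "P 0"
    and add: "\<And>x y. lie_degrees x \<subseteq> D \<Longrightarrow> lie_degrees y \<subseteq> D \<Longrightarrow> P x \<Longrightarrow> P y \<Longrightarrow> P (x + y)"
    and homogeneous: "\<And>d p x. d \<in> D \<Longrightarrow> x \<in> lie_comp d \<Longrightarrow> p \<in> {0, 1} \<Longrightarrow> x \<in> lie_part p \<Longrightarrow> P x"
  shows "P x"
proof -
  have D: "2 * int m + int (card I) - 2 \<in> D" if "gcoeff (fst x) m I \<noteq> 0" for m I
    using assms(1) that by (auto simp: lie_degrees_subset_iff)
  have D0: "snd x \<noteq> 0 \<Longrightarrow> 0 \<in> D"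
    using assms(1) by (auto simp: lie_degrees_subset_iff)
  \<comment> \<open>The degree bound is carried along because \<open>add\<close> demands it of both
    summands.\<close>
  define Q where "Q y \<longleftrightarrow> lie_degrees y \<subseteq> D \<and> P y" for y
  have Q_add: "Q (y + z)" if "Q y" "Q z" for y z
    using that add[of y z] by (auto simp: Q_def lie_degrees_subset_iff) (metis add_0)+
  have Q_0: "Q 0" using zero by (simp add: Q_def lie_degrees_subset_iff)
  have Q_sum: "Q (sum f A)" if "\<And>a. a \<in> A \<Longrightarrow> Q (f a)" for f and A :: "'a set"
    using that by (induction A rule: infinite_finite_induct) (auto simp: Q_0 intro: Q_add)
  have Q_h: "Q y" if "d \<in> D" "y \<in> lie_comp d" "p \<in> {0, 1}" "y \<in> lie_part p" for d y p
    using homogeneous[OF that] that by (auto simp: Q_def lie_comp_def)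
  have mono: "Q (lie_scale (gcoeff (fst x) m I) (lmono m I))" for m I
  proof (cases "gcoeff (fst x) m I = 0")
    case True
    then show ?thesis using Q_0 by (simp add: lie_scale_def zero_prod_def)
  next
    case False
    show ?thesis
    proof (rule Q_h[OF D[OF False], of _ "card I mod 2"])
      show "lie_scale (gcoeff (fst x) m I) (lmono m I) \<in> lie_comp (2 * int m + int (card I) - 2)"
        by (auto simp: lie_comp_def lie_degrees_subset_iff lmono_def lie_scale_def gcoeff_gmono
            split: if_splits)
      show "lie_scale (gcoeff (fst x) m I) (lmono m I) \<in> lie_part (card I mod 2)"
        by (auto simp: lie_part_def lmono_def lie_scale_def gscale_def gmono_def split: if_splits)
    qed auto
  qed
  have central: "Q (0, snd x)"
  proof (cases "snd x = 0")
    case True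
    then show ?thesis using Q_0 by (simp add: zero_prod_def)
  next
    case False
    show ?thesis
      by (rule Q_h[OF D0[OF False], of _ 0])
          (auto simp: lie_comp_def lie_degrees_subset_iff lie_part_def)
  qed
  \<comment> \<open>A common bound on the powers of t makes the expansion finite.\<close>
  define N where "N = Max ((\<lambda>I. degree (fst x I)) ` UNIV)"
  have N: "degree (fst x I) \<le> N" for I unfolding N_def by (rule Max_ge) auto
  have fst_sum: "fst (sum f A) = (\<Sum>a\<in>A. fst (f a))" for f :: "'b \<Rightarrow> lie" and A
    by (rule additive.sum) (simp add: additive_def)
  have snd_sum: "snd (sum f A) = (\<Sum>a\<in>A. snd (f a))" for f :: "'b \<Rightarrow> lie" and A
    by (rule additive.sum) (simp add: additive_def)
  have "x = (0, snd x) + (\<Sum>I\<in>UNIV. \<Sum>m\<le>N. lie_scale (gcoeff (fst x) m I) (lmono m I))"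
  proof (rule prod_eqI)
    have "gcoeff (fst x) m I = (if m \<le> N then gcoeff (fst x) m I else 0)" for m I
      using N[of I] by (auto simp: gcoeff_def intro!: coeff_eq_0)
    moreover have "(\<Sum>n\<le>N. c n * (if m = n then 1 else 0)) = (if m \<le> N then c m else 0)"
      for m and c :: "nat \<Rightarrow> complex"
    proof -
      have "(\<Sum>n\<le>N. c n * (if m = n then 1 else 0)) = (\<Sum>n\<le>N. if n = m then c n else 0)"
        by (intro sum.cong) auto
      then show ?thesis by simp
    qed
    moreover have "(\<Sum>J\<in>UNIV. \<Sum>n\<le>N. gcoeff (fst x) n J * (if I = J \<and> m = n then 1 else 0))
      = (\<Sum>J\<in>UNIV. if J = I then (\<Sum>n\<le>N. gcoeff (fst x) n J * (if m = n then 1 else 0)) else 0)"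
          for m I
      by (intro sum.cong refl) auto
    ultimately show "fst x = fst ((0, snd x)
        + (\<Sum>I\<in>UNIV. \<Sum>m\<le>N. lie_scale (gcoeff (fst x) m I) (lmono m I)))"
      by (simp add: fst_sum grass_eq_iff gcoeff_sum lie_scale_def lmono_def gcoeff_gmono)
    show "snd x = snd ((0, snd x) + (\<Sum>I\<in>UNIV. \<Sum>m\<le>N. lie_scale (gcoeff (fst x) m I) (lmono m I)))"
      by (simp add: snd_sum lie_scale_def lmono_def)
  qed
  moreover have "Q \<dots>" by (intro Q_add central Q_sum mono)
  ultimately show ?thesis unfolding Q_def by metis
qed

section \<open>The ideal \<gg>_{>0} of \<gg>_{\<ge>0} and the grading element t\<close>

lemma lie_pos_iff:
  "x \<in> lie_pos \<longleftrightarrow> gcoeff (fst x) 0 {} = 0 \<and> (\<forall>i. gcoeff (fst x) 0 {i} = 0) \<and> gcoeff (fst x) 1 {} = 0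
    \<and> (\<forall>I. card I = 2 \<longrightarrow> gcoeff (fst x) 0 I = 0) \<and> snd x = 0" (is "_ \<longleftrightarrow> ?R")
proof -
  have small: "m = 0 \<and> I = {} \<or> m = 0 \<and> (\<exists>i. I = {i}) \<or> m = 1 \<and> I = {} \<or> m = 0 \<and> card I = 2"
    if "\<not> 2 < 2 * int m + int (card I)" for m and I :: "ix set"
  proof -
    have "m = 0 \<and> card I = 0 \<or> m = 0 \<and> card I = 1 \<or> m = 1 \<and> card I = 0 \<or> m = 0 \<and> card I = 2"
      using that by linarith
    then show ?thesis by (auto simp: card_1_singleton_iff)
  qed
  have "x \<in> lie_pos \<longleftrightarrow> (\<forall>m I. gcoeff (fst x) m I \<noteq> 0 \<longrightarrow> 2 < 2 * int m + int (card I)) \<and> snd x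
      = 0" (is "_ \<longleftrightarrow> ?L \<and> _")
    by (auto simp: lie_pos_def lie_degrees_subset_iff)
  also have "\<dots> \<longleftrightarrow> ?R"
  proof (intro iffI conjI allI impI; (elim conjE)?)
    fix i I assume L: ?L
    show "gcoeff (fst x) 0 {} = 0" "gcoeff (fst x) 0 {i} = 0" "gcoeff (fst x) 1 {} = 0"
      using L[rule_format, of 0 "{}"] L[rule_format, of 0 "{i}"] L[rule_format, of 1 "{}"] by auto
    show "gcoeff (fst x) 0 I = 0" if "card I = 2"
      using L[rule_format, of 0 I] that by auto
  next
    fix m I assume "gcoeff (fst x) m I \<noteq> 0" "gcoeff (fst x) 0 {} = 0" "\<forall>i. gcoeff (fst x) 0 {i} = 0"
      "gcoeff (fst x) 1 {} = 0" "\<forall>I. card I = 2 \<longrightarrow> gcoeff (fst x) 0 I = 0"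
    then show "2 < 2 * int m + int (card I)" using small[of m I] by metis
  qed
  finally show ?thesis .
qed

lemma lie_pos_nonneg: "x \<in> lie_pos \<Longrightarrow> x \<in> lie_nonneg"
  by (simp add: lie_pos_iff lie_nonneg_iff)

lemma lie_pos_bracket:
  assumes "x \<in> lie_pos" "y \<in> lie_nonneg"
  shows "lie_bracket x y \<in> lie_pos"
proof -
  obtain f g where fg: "f = fst x" "g = fst y" by simp
  have f: "gcoeff f 0 {} = 0" "gcoeff f 0 {i} = 0" "gcoeff f (Suc 0) {} = 0" "card I = 2
      \<Longrightarrow> gcoeff f 0 I = 0"
    and g: "gcoeff g 0 {} = 0" "gcoeff g 0 {i} = 0" for i I
    using assms by (auto simp: fg lie_pos_iff lie_nonneg_iff)
  \<comment> \<open>The literal {i, j} may be a singleton, where the condition on \<xi>_i applies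
    instead.\<close>
  have f2: "gcoeff f 0 {i, j} = 0" for i j using f(4)[of "{i, j}"] f(2)[of i]
      by (cases "i = j") simp_all
  have "gcoeff (K_bracket f g) 1 {} = 0"
  proof -
    have m: "gcoeff (gmul u v) (Suc 0) {} = gcoeff u 0 {} * gcoeff v (Suc 0) {}
        + gcoeff u (Suc 0) {} * gcoeff v 0 {}" for u v
      by (simp add: gcoeff_def gmul_def coeff_mult atMost_Suc)
    show ?thesis using f g
      by (simp add: K_bracket_def gcoeff_sum m gcoeff_d_t gcoeff_euler gcoeff_d_xi gcoeff_gparity)
  qed
  moreover have "gcoeff (K_bracket f g) 0 I = 0" if "card I = 2" for I
    using that f g by (cases I rule: ix_set_cases)
      (simp_all add: gcoeff_K_bracket_0 grass_eval gcoeff_d_xi gcoeff_gparity f2 UNIV_ix)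
  moreover have "psi f g = 0" using f g by (simp add: psi_def UNIV_ix)
  ultimately show ?thesis
    using lie_nonneg_bracket[OF lie_pos_nonneg[OF assms(1)] assms(2)]
    by (simp add: lie_pos_iff lie_nonneg_iff lie_bracket_def fg)
qed

text \<open>On K(1,4)_+, bracketing with t is the operator 2 t \<partial>_t + E - 2, whose
  eigenvalues are the degrees. The cocycle reads only coefficients at t^0, so there is no central
  term.\<close>

lemma lie_bracket_t:
  assumes "x \<in> lie_comp d"
  shows "lie_bracket (lmono 1 {}) x = lie_scale (of_int d) x"
proof -
  have mt: "gcoeff (gmul (gmono (Suc 0) {}) f) m I = (case m of 0 \<Rightarrow> 0 | Suc n \<Rightarrow> gcoeff f n I)"
      for f m I
  proof -
    have "gmul (gmono (Suc 0) {}) f I = (\<Sum>J\<in>Pow I. if J = {} then monom 1 1 * f I else 0)"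
      unfolding gmul_def by (rule sum.cong) (auto simp: gmono_def)
    then have "gmul (gmono (Suc 0) {}) f I = monom 1 1 * f I" by simp
    then show ?thesis by (simp add: gcoeff_def coeff_monom_mult split: nat.split)
  qed
  have "d_t (gmono 1 {}) = gone" by (rule ext) (simp add: d_t_def gmono_def pderiv_monom monom_0)
  moreover have "d_xi i (gparity (gmono 1 {})) = 0" for i
      by (rule ext) (simp add: d_xi_def gparity_def gmono_def)
  ultimately have "gcoeff (K_bracket (gmono 1 {}) f) m I = (2 * of_nat m + of_nat (card I)
      - 2) * gcoeff f m I" for f m I
    by (simp add: K_bracket_def gmul_scale_left euler_gmono gcoeff_euler mt gcoeff_d_t
        algebra_simps split: nat.split)
  moreover have "(2 * of_nat m + of_nat (card I) - 2) * gcoeff (fst x) m I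
      = of_int d * gcoeff (fst x) m I" for m I
  proof (cases "gcoeff (fst x) m I = 0")
    case False
    then have "2 * int m + int (card I) - 2 = d" using assms
        by (auto simp: lie_comp_def lie_degrees_subset_iff)
    then show ?thesis by auto
  qed simp
  moreover have "0 = of_int d * snd x" using assms
      by (auto simp: lie_comp_def lie_degrees_subset_iff)
  ultimately show ?thesis
    by (simp add: lie_bracket_def lmono_def lie_scale_def prod_eq_iff grass_eq_iff psi_def
        gcoeff_gmono)
qed

text \<open>The vector q(T) v, computed by Horner's scheme.\<close>

definition papply :: "(complex \<Rightarrow> 'b \<Rightarrow> 'b :: ab_group_add) \<Rightarrow> ('b \<Rightarrow> 'b) \<Rightarrow> complex poly \<Rightarrow> 'b \<Rightarrow> 'b"
  where
  "papply s T q v = fold_coeffs (\<lambda>a w. s a v + T w) q 0"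

text \<open>The existence of an eigenvalue and the finiteness of the spectrum both come from a nonzero
  polynomial that annihilates \<open>T\<close>.\<close>

lemma exists_max_eigenvector:
  fixes s :: "complex \<Rightarrow> 'b \<Rightarrow> 'b :: ab_group_add"
  assumes "vector_space s" and T_add: "\<And>v w. T (v + w) = T v + T w" and T_scale: "\<And>c v. T (s c v)
      = s c (T v)"
    and B: "finite B" "module.span s B = UNIV" and v0: "v0 \<noteq> (0 :: 'b)"
  obtains l v where "v \<noteq> 0" "T v = s l v" "\<And>m w. w \<noteq> 0 \<Longrightarrow> T w = s m w \<Longrightarrow> Re m \<le> Re l"
proof -
  interpret V: vector_space s by fact
  have T_0: "T 0 = 0" using T_add[of 0 0] by simp
  let ?p = "papply s T"
  have p_0: "?p 0 v = 0" for v by (simp add: papply_def)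
  have p_pCons: "?p (pCons a q) v = s a v + T (?p q v)" for a q v
    by (cases "a = 0 \<and> q = 0") (auto simp: papply_def T_0 fold_coeffs_pCons_not_0_0_eq
        fold_coeffs_pCons_coeff_not_0_eq)
  have p_add: "?p q (v + w) = ?p q v + ?p q w" for q v w
    by (induction q) (simp_all add: p_0 p_pCons T_add V.scale_right_distrib)
  have p_scale: "?p q (s c v) = s c (?p q v)" for q c v
    by (induction q) (simp_all add: p_0 p_pCons T_scale V.scale_right_distrib mult.commute)
  have p_z: "?p q 0 = 0" for q using p_add[of q 0 0] by simp
  have p_plus: "?p (q + r) v = ?p q v + ?p r v" for q r v
    by (induction q r rule: poly_induct2) (simp_all add: p_0 p_pCons T_add V.scale_left_distrib)
  have p_smult: "?p (smult a q) v = s a (?p q v)" for a q v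
    by (induction q) (simp_all add: p_0 p_pCons T_scale V.scale_right_distrib)
  have p_mult: "?p (q * r) v = ?p q (?p r v)" for q r v
    by (induction q) (simp_all add: p_0 p_pCons p_plus p_smult)
  have p_monom: "?p (monom a n) v = s a ((T ^^ n) v)" for a n v
    by (induction n) (simp_all add: monom_0 monom_Suc p_pCons p_0 T_0 T_scale)
  have p_sum: "?p (sum f A) v = (\<Sum>a\<in>A. ?p (f a) v)" for f :: "nat \<Rightarrow> complex poly" and A v
    by (induction A rule: infinite_finite_induct) (simp_all add: p_0 p_plus)
  \<comment> \<open>With n the size of the spanning set, either two of v, T v, ..., T^n v coincide
    or these n + 1 distinct vectors are dependent.\<close>
  have ann1: "\<exists>q. q \<noteq> 0 \<and> ?p q v = 0" for v
  proof (cases "inj_on (\<lambda>i. (T ^^ i) v) {..card B}")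
    case False
    then obtain i j where ij: "i \<noteq> j" "(T ^^ i) v = (T ^^ j) v" by (auto simp: inj_on_def)
    have "?p (monom 1 i + monom (- 1) j) v = 0"
      by (simp add: p_plus p_monom ij)
    moreover have "monom 1 i + monom (- 1) j \<noteq> (0 :: complex poly)"
    proof
      assume "monom 1 i + monom (- 1) j = (0 :: complex poly)"
      then have "coeff (monom 1 i + monom (- 1) j) i = (0 :: complex)" by (simp only: coeff_0)
      then show False using ij(1) by simp
    qed
    ultimately show ?thesis by blast
  next
    case True
    let ?S = "(\<lambda>i. (T ^^ i) v) ` {..card B}"
    have "card ?S = Suc (card B)" using True by (simp add: card_image)
    then have "V.dependent ?S"
      using V.independent_span_bound[of B ?S] B by auto
    then obtain u where u: "\<exists>w\<in>?S. u w \<noteq> 0" "(\<Sum>w\<in>?S. s (u w) w) = 0"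
      using V.dependent_finite[of ?S] by auto
    let ?q = "\<Sum>i\<le>card B. monom (u ((T ^^ i) v)) i"
    have "?p ?q v = (\<Sum>w\<in>?S. s (u w) w)"
      unfolding p_sum p_monom using True by (simp add: sum.reindex)
    moreover have "?q \<noteq> 0"
    proof
      assume "?q = 0"
      then have "coeff ?q i = 0" for i by (simp only: coeff_0)
      moreover have "coeff ?q i = u ((T ^^ i) v)" if "i \<le> card B" for i
        using that by (simp add: coeff_sum)
      ultimately have "u ((T ^^ i) v) = 0" if "i \<le> card B" for i
        using that by metis
      then show False using u(1) by auto
    qed
    ultimately show ?thesis using u(2) by metis
  qed
  then obtain f where f: "\<And>v. f v \<noteq> 0" "\<And>v. ?p (f v) v = 0" by metis
  \<comment> \<open>Polynomials in T commute, so in the product the factor belonging to b can be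
    applied first, which kills b.\<close>
  define q where "q = (\<Prod>b\<in>B. f b)"
  have q_nz: "q \<noteq> 0" using f(1) B(1) by (simp add: q_def)
  have q_B: "?p q b = 0" if "b \<in> B" for b
  proof -
    have "q = (\<Prod>c\<in>B - {b}. f c) * f b"
      unfolding q_def using B(1) that by (simp add: prod.remove mult.commute)
    then show ?thesis by (simp add: p_mult f(2) p_z)
  qed
  have q_all: "?p q v = 0" for v
  proof -
    have "v \<in> V.span B" using B(2) by simp
    then show ?thesis
      by (induction rule: V.span_induct_alt) (simp_all add: p_z p_add p_scale q_B)
  qed
  define E where "E = {l. \<exists>v. v \<noteq> 0 \<and> T v = s l v}"
  \<comment> \<open>Every eigenvalue is a root of q, which leaves finitely many.\<close>
  have "poly q l = 0" if "l \<in> E" for l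
  proof -
    obtain v where v: "v \<noteq> 0" "T v = s l v" using \<open>l \<in> E\<close> by (auto simp: E_def)
    have "?p r v = s (poly r l) v" for r
      by (induction r) (simp_all add: p_0 p_pCons T_scale v(2) V.scale_left_distrib mult.commute)
    then show ?thesis using q_all[of v] v(1) by simp
  qed
  then have "finite E" using finite_subset[of E "{l. poly q l = 0}"] poly_roots_finite[OF q_nz]
      by blast
  have "E \<noteq> {}"
  proof -
    have "\<exists>r. r \<noteq> 0 \<and> ?p r v0 = 0" using q_nz q_all by blast
    \<comment> \<open>Splitting a linear factor off an annihilating polynomial of least degree
      leaves a vector that is nonzero by minimality; it is the eigenvector sought.\<close>
    then obtain r where r: "r \<noteq> 0" "?p r v0 = 0" "\<And>r'. r' \<noteq> 0 \<Longrightarrow> ?p r' v0 = 0 \<Longrightarrow> degree r \<le> degree r'"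
      using exists_least_iff[of "\<lambda>n. \<exists>r. (r \<noteq> 0 \<and> ?p r v0 = 0) \<and> degree r = n"] by (metis not_le)
    have "degree r \<noteq> 0"
    proof
      assume "degree r = 0"
      then obtain a where "r = [:a:]" by (rule degree_eq_zeroE)
      then show False using r v0 by (simp add: p_pCons p_0 T_0)
    qed
    then obtain l where "poly r l = 0"
      using fundamental_theorem_of_algebra[of r] by (auto simp: constant_degree)
    then obtain r' where r': "r = [:- l, 1:] * r'" by (auto simp: poly_eq_0_iff_dvd)
    have nz: "r' \<noteq> 0" using r(1) r' by auto
    then have "degree r = Suc (degree r')" unfolding r' by (subst degree_mult_eq) auto
    then have "?p r' v0 \<noteq> 0" using r(3)[of r'] nz by auto
    moreover have "?p r v0 = s (- l) (?p r' v0) + T (?p r' v0)"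
      unfolding r' p_mult by (simp add: p_pCons p_0 T_0)
    then have "T (?p r' v0) = s l (?p r' v0)" using r(2) by (simp add: add_eq_0_iff)
    ultimately show ?thesis by (auto simp: E_def)
  qed
  have fin: "finite (Re ` E)" "Re ` E \<noteq> {}" using \<open>finite E\<close> \<open>E \<noteq> {}\<close> by auto
  from Max_in[OF this] obtain l where l: "l \<in> E" "Re l = Max (Re ` E)" by auto
  then obtain v where "v \<noteq> 0" "T v = s l v" by (auto simp: E_def)
  then show thesis
    by (rule that) (use fin l(2) in \<open>auto simp: E_def intro!: Max_ge\<close>)
qed

lemma lie_comp_nonneg: "x \<in> lie_comp d \<Longrightarrow> 0 \<le> d \<Longrightarrow> x \<in> lie_nonneg"
  by (auto simp: lie_comp_def lie_nonneg_def)

lemma lie_comp_pos: "x \<in> lie_comp d \<Longrightarrow> 0 < d \<Longrightarrow> x \<in> lie_pos"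
  by (auto simp: lie_comp_def lie_pos_def)

context nonneg_module begin

lemma act_zero_right: "x \<in> lie_nonneg \<Longrightarrow> act x 0 = 0"
  using act_add_right[of x 0 0] by simp

lemma part_sum_zero:
  assumes "v \<in> part 0" "w \<in> part 1" "v + w = 0" shows "v = 0" "w = 0"
proof -
  have "v = - w" using assms(3) by (simp add: eq_neg_iff_add_eq_0)
  then have "v \<in> part 1" using assms(2) part_subspace[of 1] subspace_neg by auto
  then show "v = 0" using part_disjoint assms(1) by auto
  then show "w = 0" using assms(3) by simp
qed

text \<open>Stability holds because \<gg>_{>0} is an ideal of \<gg>_{\<ge>0}: for homogeneous x and
  y, x y w = [x, y] w \<plusminus> y x w, and both terms vanish.\<close>

lemma pos_kernel_submodule:
  "graded_submodule {v. \<forall>x\<in>lie_pos. act x v = 0}" (is "graded_submodule ?W")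
  unfolding graded_submodule_def
proof (intro conjI ballI)
  show "subspace ?W"
    by (rule subspaceI) (auto simp: act_zero_right act_add_right act_scale_right lie_pos_nonneg)
next
  fix w assume w: "w \<in> ?W"
  obtain w0 w1 where w01: "w0 \<in> part 0" "w1 \<in> part 1" "w = w0 + w1" using part_sum by blast
  \<comment> \<open>For homogeneous x the vectors x w0 and x w1 have opposite parities, so their
    vanishing sum forces both to vanish.\<close>
  have "act x w0 = 0 \<and> act x w1 = 0" if "x \<in> lie_pos" for x
  proof -
    have "lie_degrees x \<subseteq> {0<..}" using that by (simp add: lie_pos_def)
    then show ?thesis
    proof (induction rule: lie_homogeneous_induct)
      case zero
      show ?case by (simp add: act_zero_left)
    next
      case (add x y)
      then show ?case using act_add_left[of x y w0] act_add_left[of x y w1]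
        by (simp add: lie_pos_nonneg lie_pos_def)
    next
      case (homogeneous d p x)
      then have x: "x \<in> lie_pos" "x \<in> lie_nonneg" using lie_comp_pos lie_pos_nonneg by auto
      have "act x w0 + act x w1 = 0" using w w01 x act_add_right[of x w0 w1] by auto
      moreover have "act x w0 \<in> part p" "act x w1 \<in> part ((p + 1) mod 2)"
        using act_part[of p 0 x w0] act_part[of p 1 x w1] homogeneous x w01 by auto
      ultimately show ?case
        using part_sum_zero[of "act x w0" "act x w1"] part_sum_zero[of "act x w1"
            "act x w0"] homogeneous(3)
        by (auto simp: add.commute)
    qed
  qed
  then show "\<exists>w0\<in>?W \<inter> part 0. \<exists>w1\<in>?W \<inter> part 1. w = w0 + w1"
    using w01 by (intro bexI[of _ w0] bexI[of _ w1]) blast+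
next
  fix y w assume y: "y \<in> lie_nonneg" and w: "w \<in> ?W"
  have "act x (act y w) = 0" if x: "x \<in> lie_pos" for x
  proof -
    have "lie_degrees y \<subseteq> {0..}" using y by (simp add: lie_nonneg_def)
    then show ?thesis using x
    proof (induction arbitrary: x rule: lie_homogeneous_induct)
      case zero
      then show ?case by (simp add: act_zero_left act_zero_right lie_pos_nonneg)
    next
      case (add y z)
      then have "y \<in> lie_nonneg" "z \<in> lie_nonneg" "x \<in> lie_nonneg"
        using lie_pos_nonneg[of x] by (simp_all add: lie_nonneg_def)
      then show ?case using add by (simp add: act_add_left act_add_right)
    next
      case (homogeneous d q y)
      have y: "y \<in> lie_nonneg" using homogeneous lie_comp_nonneg by auto
      have "lie_degrees x \<subseteq> {0<..}" using homogeneous.prems by (simp add: lie_pos_def)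
      then show ?case
      proof (induction rule: lie_homogeneous_induct)
        case zero
        show ?case by (simp add: act_zero_left)
      next
        case (add x z)
        then show ?case using act_add_left[of x z "act y w"]
            by (simp add: lie_pos_nonneg lie_pos_def)
      next
        case (homogeneous e p x)
        have x: "x \<in> lie_pos" "x \<in> lie_nonneg" using homogeneous lie_comp_pos lie_pos_nonneg by auto
        have "act (lie_bracket x y) w = act x (act y w) - scale ((- 1) ^ (p * q)) (act y (act x w))"
          using homogeneous \<open>q \<in> {0, 1}\<close> \<open>y \<in> lie_part q\<close> x y by (intro act_bracket) auto
        moreover have "act (lie_bracket x y) w = 0" "act x w = 0"
          using w x lie_pos_bracket[OF x(1) y] by auto
        ultimately show ?case by (simp add: act_zero_right y)
      qed
    qed
  qed
  then show "act y w \<in> ?W" by simp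
qed

end

lemma (in fd_irreducible_nonneg_module) pos_acts_trivially:
  assumes "x \<in> lie_pos"
  shows "act x v = 0"
proof -
  let ?W = "{v. \<forall>x\<in>lie_pos. act x v = 0}" and ?t = "lmono 1 {}"
  obtain B where B: "finite B" "span B = UNIV" using finite_dim by blast
  obtain v0 :: 'f where v0: "v0 \<noteq> 0" using nonzero by blast
  have t: "?t \<in> lie_nonneg" "?t \<in> lie_part 0"
    by (simp add: lie_nonneg_iff lmono_def gcoeff_gmono)
        (simp add: lmono_def lie_part_def gmono_def)
  obtain l u where u: "u \<noteq> 0" "act ?t u = scale l u"
    and max: "\<And>m w. w \<noteq> 0 \<Longrightarrow> act ?t w = scale m w \<Longrightarrow> Re m \<le> Re l"
    by (rule exists_max_eigenvector[OF vector_space_axioms act_add_right[OF t(1)]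
        act_scale_right[OF t(1)] B v0])
      (rule that)
  have "act x u = 0" if "x \<in> lie_pos" for x
  proof -
    have "lie_degrees x \<subseteq> {0<..}" using that by (simp add: lie_pos_def)
    then show ?thesis
    proof (induction rule: lie_homogeneous_induct)
      case zero
      show ?case by (simp add: act_zero_left)
    next
      case (add x y)
      then show ?case using act_add_left[of x y u] by (simp add: lie_pos_nonneg lie_pos_def)
    next
      case (homogeneous d p x)
      then have x: "x \<in> lie_nonneg" "0 < d" using lie_comp_pos lie_pos_nonneg by auto
      have "scale (of_int d) (act x u) = act ?t (act x u) - act x (act ?t u)"
        using act_bracket[of 0 p ?t x u, unfolded lie_bracket_t[OF homogeneous(2)]] homogeneous t x
        by (simp add: act_scale_left)
      \<comment> \<open>The eigenvalue is shifted by d > 0, beyond the maximal real part; hence x u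
        = 0.\<close>
      then have "act ?t (act x u) = scale (of_int d + l) (act x u)"
        by (simp add: u[unfolded One_nat_def] act_scale_right x scale_left_distrib algebra_simps)
      then show ?case using max[of "act x u" "of_int d + l"] x(2) by auto
    qed
  qed
  then have "?W \<noteq> {0}" using u(1) by auto
  then have "?W = UNIV" using irreducible[OF pos_kernel_submodule] by blast
  then show ?thesis using assms by auto
qed

section \<open>Singular vectors of the model\<close>

definition lcen :: lie where "lcen = (0, 1)"

lemma lie_parity_lmono: "lie_parity (lmono m I) = lie_scale ((- 1) ^ card I) (lmono m I)"
  by (auto simp: prod_eq_iff grass_eq_iff lie_parity_def lmono_def lie_scale_def gcoeff_gparity
      gcoeff_gmono)

lemma lie_scale_zero: "lie_scale 0 x = 0" "lie_scale c 0 = 0"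
  by (simp_all add: lie_scale_def zero_prod_def)

lemma lie_parity_diff: "lie_parity (x - y) = lie_parity x - lie_parity y"
  using lie_parity_add[of x "- y"] by (simp add: lie_parity_minus)

lemma lie_parity_zero: "lie_parity 0 = 0"
  using lie_parity_add[of 0 0] by simp

lemma lie_bracket_diff_right: "lie_bracket x (y - z) = lie_bracket x y - lie_bracket x z"
  using lie_bracket_add_right[of x y "- z"] by (simp add: lie_bracket_minus_right)

lemma lie_bracket_zero_right: "lie_bracket x 0 = 0"
  using lie_bracket_add_right[of x 0 0] by simp

text \<open>For m = 0 the truncated exponent m - 1 is harmless, since its coefficient is 0; the last
  summand is the value of the cocycle.\<close>

lemma lie_bracket_xi_lmono: "lie_bracket (xi j) (lmono m I) =
   (if j \<in> I then - lie_scale (gsign {j} (I - {j})) (lmono m (I - {j}))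
    else lie_scale (of_nat m * gsign {j} I) (lmono (m - 1) (insert j I)))
   + lie_scale (if m = 0 \<and> I = - {j} then - gsign {j} (- {j}) else 0) lcen"
proof -
  have "psi (gxi j) (gmono m I) = (if m = 0 \<and> I = - {j} then - gsign {j} (- {j}) else 0)"
    by (auto simp: psi_gxi gcoeff_gmono)
  moreover have "K_bracket (gxi j) (gmono m I) =
    (if j \<in> I then - gscale (gsign {j} (I - {j})) (gmono m (I - {j}))
    else gscale (of_nat m * gsign {j} I) (gmono (m - 1) (insert j I)))"
    by (auto simp: K_bracket_gxi grass_eq_iff gcoeff_gxi_gmul gcoeff_d_t gcoeff_d_xi gcoeff_gmono
        insert_absorb)
  ultimately show ?thesis
    by (simp add: lie_bracket_def xi_def lmono_def lcen_def lie_scale_def uminus_prod_def)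
qed

lemma lie_bracket_lone_lmono: "lie_bracket lone (lmono m I) =
   lie_scale (2 * of_nat m) (lmono (m - 1) I)
   + lie_scale (if m = 0 \<and> I = UNIV then - 2 else 0) lcen"
proof -
  have "K_bracket gone (gmono m I) = gscale (2 * of_nat m) (gmono (m - 1) I)"
    by (auto simp: K_bracket_gone grass_eq_iff gcoeff_d_t gcoeff_gmono)
  then show ?thesis
    by (simp add: lie_bracket_def lone_def lmono_def lcen_def lie_scale_def psi_gone gcoeff_gmono)
qed

lemma lie_bracket_lcen: "lie_bracket x lcen = 0"
proof -
  have "K_bracket f 0 = 0" for f using K_bracket_scale_right[of f 0 0] by simp
  moreover have "psi f 0 = 0" for f using psi_scale_right[of f 0 0] by simp
  ultimately show ?thesis by (simp add: lie_bracket_def lcen_def zero_prod_def)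
qed

lemma lie_parity_lcen: "lie_parity lcen = lcen"
  by (simp add: lie_parity_def lcen_def)

lemma xi_eq_lmono: "xi i = lmono 0 {i}" and lone_eq_lmono: "lone = lmono 0 {}"
  by (simp_all add: xi_def lone_def lmono_def)

lemma ix_set_eq_iff: "I = J \<longleftrightarrow>
    (X1 \<in> I \<longleftrightarrow> X1 \<in> J) \<and> (X2 \<in> I \<longleftrightarrow> X2 \<in> J) \<and> (X3 \<in> I \<longleftrightarrow> X3 \<in> J) \<and> (X4 \<in> I \<longleftrightarrow> X4 \<in> J)"
  by (metis (full_types) ix.exhaust set_eqI)

lemma (in nonneg_module) rho_mono_zero_left: "rho_mono 0 a is v = 0"
  using rho_mono_add_left[of 0 0 a "is" v] by simp

lemma (in nonneg_module) rho_mono_minus_left: "rho_mono (- x) a is v = - rho_mono x a is v"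
  using rho_mono_scale_left[of "- 1" x a "is" v] by (simp add: lie_scale_minus_one)

lemma (in nonneg_module) rho_mono_diff_left:
  "rho_mono (x - y) a is v = rho_mono x a is v - rho_mono y a is v"
  using rho_mono_add_left[of x "- y" a "is" v] by (simp add: rho_mono_minus_left)

lemma (in nonneg_module) rho_vac_linear:
  "rho_vac 0 v = 0" "rho_vac (- x) v = - rho_vac x v"
  "rho_vac (x - y) v = rho_vac x v - rho_vac y v"
  unfolding rho_vac_eq[symmetric] by (simp_all add: rho_minus_left rho_diff_left)

context fd_irreducible_nonneg_module begin

text \<open>The cases are positive degree, which annihilates F, negative degree and degree 0. The
  exponent 1 - card I covers both negative degrees: it gives \<Theta> for the empty set and \<eta>_i
  for a singleton.\<close>

lemma rho_vac_lmono: "rho_vac (lmono m I) v =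
  (if 2 * m + card I > 2 then 0
   else if m = 0 \<and> card I \<le> 1 then Poly_Mapping.single (1 - card I, I) v
   else vac (act (lmono m I) v))"
proof -
  have "lmono m I \<in> lie_pos" if "2 * m + card I > 2"
    using that by (auto simp: lie_pos_iff lmono_def gcoeff_gmono)
  then have pos: "rho_vac (lmono m I) v = 0" if "2 * m + card I > 2"
    using that rho_vac_nonneg[of "lmono m I" v]
        by (simp add: rho_vac_eq lie_pos_nonneg pos_acts_trivially)
  have nn: "rho_vac (lmono m I) v = vac (act (lmono m I) v)" if "\<not> (m = 0 \<and> card I \<le> 1)"
  proof -
    have "lmono m I \<in> lie_nonneg" using that by (auto simp: lie_nonneg_iff lmono_def gcoeff_gmono)
    then show ?thesis using rho_vac_nonneg[of "lmono m I" v] by (simp add: rho_vac_eq)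
  qed
  have "rho_vac (lmono 0 I) v = Poly_Mapping.single (1 - card I, I) v" if "card I \<le> 1"
  proof -
    have "card I = 0 \<or> card I = 1" using that by linarith
    then consider "I = {}" | i where "I = {i}" by (auto simp: card_1_singleton_iff)
    then show ?thesis
      using rho_lone[of "vac v"] rho_xi[of _ "vac v"]
      by cases (simp_all add: rho_vac_eq xi_eq_lmono lone_eq_lmono theta_single eta_single)
  qed
  then show ?thesis using pos nn by auto
qed

lemma rho_vac_lcen: "rho_vac lcen v = vac (act lcen v)"
  using rho_vac_nonneg[of lcen v] by (simp add: rho_vac_eq lie_nonneg_iff lcen_def)

text \<open>These rules evaluate \<open>rho\<close> on explicit monomials: they unroll the
  recursion, compute the brackets and extract coefficients.\<close>

lemmas rho_compute = rho_single ixlist_def lie_parity_lmono lie_bracket_xi_lmono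
  lie_bracket_lone_lmono lie_bracket_lcen
  lie_scale_zero lie_scale_minus_one lie_parity_diff lie_parity_zero lie_bracket_diff_right
      lie_bracket_zero_right rho_mono_diff_left rho_vac_linear
  lie_parity_lcen lie_parity_scale lie_parity_add lie_parity_minus
  lie_bracket_scale_right lie_bracket_add_right lie_bracket_minus_right
  rho_mono_scale_left rho_mono_add_left rho_mono_minus_left rho_mono_zero_left
  rho_vac_scale_left rho_vac_add_left
  rho_vac_lmono rho_vac_lcen eta_single eta_add eta_diff eta_minus eta_scale theta_single
      theta_add theta_diff theta_minus theta_scale
  mscale_single lookup_add lookup_minus lookup_mscale lookup_single when_def Compl_ix ix_set_eq_iff

section \<open>Coefficients and powers of \<Theta>\<close>

lemma lookup_theta: "Poly_Mapping.lookup (theta m) (b, J)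
  = (case b of 0 \<Rightarrow> 0 | Suc c \<Rightarrow> Poly_Mapping.lookup m (c, J))"
proof (induction m rule: M_induct)
  case (single a I v)
  show ?case by (simp add: theta_single lookup_single when_def split: nat.split)
qed (simp add: theta_add lookup_add split: nat.split)

lemma lookup_theta_power: "Poly_Mapping.lookup ((theta ^^ n) m) (b, J)
  = (if b < n then 0 else Poly_Mapping.lookup m (b - n, J))"
  by (induction n arbitrary: b) (simp_all add: lookup_theta split: nat.split)

lemma theta_power_eq_0: "(theta ^^ n) m = 0 \<Longrightarrow> m = 0"
proof (rule poly_mapping_eqI)
  fix k :: "nat \<times> ix set" assume 0: "(theta ^^ n) m = 0"
  obtain b J where k: "k = (b, J)" by fastforce
  show "Poly_Mapping.lookup m k = Poly_Mapping.lookup 0 k"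
    using lookup_theta_power[of n m "b + n" J] by (simp add: 0 k)
qed

lemma theta_power_single: "(theta ^^ n) (Poly_Mapping.single (0, I) v)
  = Poly_Mapping.single (n, I) v"
  by (induction n) (simp_all add: theta_single)

text \<open>The bracket [1, \<xi>_I] vanishes except for the full set, where the cocycle makes it -
  2 C.\<close>

lemma rho_xi3_theta_power:
  "I \<noteq> UNIV \<Longrightarrow> rho (lmono 0 I) ((theta ^^ n) m) = (theta ^^ n) (rho (lmono 0 I) m)"
  by (induction n) (simp_all add: rho_theta lie_bracket_lone_lmono lie_scale_zero)

text \<open>Multiplied by \<open>\<Theta>\<close>, so that the exponent \<open>n - 1\<close> does not occur.\<close>

lemma rho_txi_theta_power:
  "theta (rho (lmono 1 {i}) ((theta ^^ n) m)) =
    (theta ^^ n) (theta (rho (lmono 1 {i}) m) - mscale (2 * of_nat n) (eta i m))"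
proof (induction n)
  case (Suc n)
  let ?y = "(theta ^^ n) m"
  have eta_pow: "eta i ((theta ^^ k) m) = (theta ^^ k) (eta i m)" for k
    by (induction k) (simp_all add: eta_theta)
  have pow_scale: "mscale c ((theta ^^ k) y) = (theta ^^ k) (mscale c y)" for c k y
    by (induction k) (simp_all flip: theta_scale)
  have pow_diff: "(theta ^^ k) (y - z) = (theta ^^ k) y - (theta ^^ k) z" for k y z
    by (induction k) (simp_all add: theta_diff)
  have "rho (lmono 1 {i}) (theta ?y) = theta (rho (lmono 1 {i}) ?y) - mscale 2 (eta i ?y)"
    by (simp add: rho_theta lie_bracket_lone_lmono lie_scale_zero rho_scale_left
        xi_eq_lmono[symmetric] rho_xi)
  then have "theta (rho (lmono 1 {i}) ((theta ^^ Suc n) m))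
    = theta ((theta ^^ n) (theta (rho (lmono 1 {i}) m) - mscale (2 * of_nat n) (eta i m)))
        - mscale 2 (theta (eta i ?y))"
    using Suc by (simp add: theta_diff theta_scale)
  also have "\<dots> = (theta ^^ Suc n) (theta (rho (lmono 1 {i}) m) - mscale (2 * of_nat n) (eta i m)
      - mscale 2 (eta i m))"
    by (simp add: eta_pow pow_scale pow_diff theta_diff flip: theta_scale)
  also have "mscale (2 * of_nat n) (eta i m) + mscale 2 (eta i m)
      = mscale (2 * of_nat (Suc n)) (eta i m)"
    by (simp add: algebra_simps flip: M.scale_left_distrib)
  then have "theta (rho (lmono 1 {i}) m) - mscale (2 * of_nat n) (eta i m) - mscale 2 (eta i m)
     = theta (rho (lmono 1 {i}) m) - mscale (2 * of_nat (Suc n)) (eta i m)"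
    by (simp only: diff_diff_eq)
  finally show ?case .
qed simp

section \<open>Vanishing of the coefficients of a singular vector\<close>

lemma lmono_pos: "2 < 2 * m + card I \<Longrightarrow> lmono m I \<in> lie_pos"
  by (auto simp: lie_pos_iff lmono_def gcoeff_gmono)

lemma lookup_rho: "Poly_Mapping.lookup (rho x m) k =
  (\<Sum>p\<in>Poly_Mapping.keys m. Poly_Mapping.lookup (rho x (Poly_Mapping.single p (Poly_Mapping.lookup
      m p))) k)"
proof -
  have "m = (\<Sum>p\<in>Poly_Mapping.keys m. Poly_Mapping.single p (Poly_Mapping.lookup m p))"
    by (rule poly_mapping_eqI) (simp add: lookup_sum lookup_single when_def in_keys_iff)
  moreover have "rho x (\<Sum>p\<in>A. Poly_Mapping.single p (f p))
      = (\<Sum>p\<in>A. rho x (Poly_Mapping.single p (f p)))" for A f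
    by (rule additive.sum) (simp add: additive_def rho_add)
  ultimately show ?thesis by (metis (no_types, lifting) lookup_sum sum.cong)
qed

text \<open>The operator \<open>t \<xi>\<^sub>i\<close> lowers the exponent of \<open>\<Theta>\<close> by at most one, and by exactly one
  only through \<open>\<Theta>\<^sup>a \<mapsto> - 2 a \<Theta>\<^sup>a\<^sup>-\<^sup>1 \<eta>\<^sub>i\<close>.\<close>

lemma leading_coefficient_zero:
  assumes sing: "rho (lmono 1 {i}) m = 0" and i: "i \<notin> J"
    and low: "\<And>b I. b < Suc a \<Longrightarrow> Poly_Mapping.lookup m (b, I) = 0"
  shows "Poly_Mapping.lookup m (Suc a, J) = 0"
proof -
  \<comment> \<open>The image is tested at \<Theta>^a and the set J with i added; among exponents at
    least a + 1, only the monomial \<Theta>^(a+1) \<eta>_J reaches that place.\<close>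
  have single: "Poly_Mapping.lookup (rho (lmono 1 {i}) (Poly_Mapping.single (b, I) v)) (a, insert
      i J) =
     (if (b, I) = (Suc a, J) then - scale (2 * of_nat (Suc a) * gsign {i} J) v else 0)"
         if "b \<ge> Suc a" for b I v
  proof -
    have "Poly_Mapping.lookup (rho (lmono 1 {i}) (Poly_Mapping.single (b, I) v)) (a, insert i J)
      = Poly_Mapping.lookup (theta (rho (lmono 1 {i}) ((theta ^^ b) (Poly_Mapping.single (0, I)
          v)))) (Suc a, insert i J)"
      by (simp add: lookup_theta theta_power_single)
    \<comment> \<open>For b > a + 1 the power of \<Theta> in front is too high. For b = a + 1 the
      part free of \<Theta> is read, which leaves only the \<eta>_i term.\<close>
    also have "\<dots> = (if b = Suc a then - scale (2 * of_nat b) (Poly_Mapping.lookup (eta i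
        (Poly_Mapping.single (0, I) v)) (0, insert i J)) else 0)"
      unfolding rho_txi_theta_power lookup_theta_power using that
      by (auto simp: lookup_minus lookup_mscale lookup_theta)
    also have "Poly_Mapping.lookup (eta i (Poly_Mapping.single (0, I) v)) (0, insert i J)
      = (if I = J then scale (gsign {i} J) v else 0)"
      using i by (auto simp: eta_single lookup_single when_def dest: insert_ident)
    finally show ?thesis by simp
  qed
  have "0 = (\<Sum>p\<in>Poly_Mapping.keys m. Poly_Mapping.lookup (rho (lmono 1 {i}) (Poly_Mapping.single p
      (Poly_Mapping.lookup m p))) (a, insert i J))"
    using lookup_rho[of "lmono 1 {i}" m "(a, insert i J)"] sing by simp
  also have "\<dots> = (\<Sum>p\<in>Poly_Mapping.keys m. if p = (Suc a, J)
      then - scale (2 * of_nat (Suc a) * gsign {i} J) (Poly_Mapping.lookup m p) else 0)"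
  proof (rule sum.cong)
    fix p assume "p \<in> Poly_Mapping.keys m"
    moreover obtain b I where p: "p = (b, I)" by fastforce
    ultimately have "b \<ge> Suc a" using low[of b I] by (auto simp: in_keys_iff not_less[symmetric])
    then show "Poly_Mapping.lookup (rho (lmono 1 {i}) (Poly_Mapping.single p (Poly_Mapping.lookup
        m p))) (a, insert i J)
      = (if p = (Suc a, J) then - scale (2 * of_nat (Suc a) * gsign {i} J) (Poly_Mapping.lookup m
          p) else 0)"
      unfolding p by (rule single)
  qed simp
  also have "\<dots> = - scale (2 * of_nat (Suc a) * gsign {i} J) (Poly_Mapping.lookup m (Suc a, J))"
    by (simp add: in_keys_iff)
  finally have "2 * of_nat (Suc a) * gsign {i} J = 0 \<or> Poly_Mapping.lookup m (Suc a, J) = 0"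
    by (metis neg_equal_0_iff_equal scale_eq_0_iff)
  moreover have "gsign {i} J \<noteq> 0" by (simp add: gsign_def)
  ultimately show ?thesis using of_nat_neq_0[of a] by (simp del: of_nat_Suc)
qed

lemma top_coefficient_zero:
  assumes m: "m \<in> M_comp (2 * a + 4)" and sing: "\<And>x. x \<in> lie_pos \<Longrightarrow> rho x m = 0"
  shows "Poly_Mapping.lookup m (a, UNIV) = 0"
proof -
  define c where "c b J = Poly_Mapping.lookup m (b, J)" for b J
  \<comment> \<open>As \<eta>_I has degree at most 4, every exponent in m is at least a. Dividing
    out \<Theta>^a leaves degree 4, with eight possible monomials.\<close>
  define m0 where "m0 = Poly_Mapping.single (0, {X1, X2, X3, X4}) (c a {X1, X2, X3, X4})
    + Poly_Mapping.single (Suc 0, {X1, X2}) (c (Suc a) {X1, X2})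
    + Poly_Mapping.single (Suc 0, {X1, X3}) (c (Suc a) {X1, X3})
    + Poly_Mapping.single (Suc 0, {X1, X4}) (c (Suc a) {X1, X4})
    + Poly_Mapping.single (Suc 0, {X2, X3}) (c (Suc a) {X2, X3})
    + Poly_Mapping.single (Suc 0, {X2, X4}) (c (Suc a) {X2, X4})
    + Poly_Mapping.single (Suc 0, {X3, X4}) (c (Suc a) {X3, X4})
    + Poly_Mapping.single (Suc (Suc 0), {}) (c (Suc (Suc a)) {})"
  have "m = (theta ^^ a) m0"
  proof (rule poly_mapping_eqI)
    fix k :: "nat \<times> ix set"
    obtain b J where k: "k = (b, J)" by fastforce
    have z: "c b J = 0" if "2 * b + card J \<noteq> 2 * a + 4"
      using m that by (auto simp: M_comp_def c_def)
    have "Poly_Mapping.lookup ((theta ^^ a) m0) (b, J) = (if 2 * b + card J = 2 * a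
        + 4 then c b J else 0)"
    proof (cases "b < a")
      case True
      then show ?thesis by (cases J rule: ix_set_cases; simp only:; simp add: lookup_theta_power)
    next
      case False
      then obtain d where d: "b = a + d" by (metis le_iff_add not_less)
      \<comment> \<open>This excludes singletons, for which \<Theta> would need the exponent a + 3 /
        2.\<close>
      have "2 * d \<noteq> 3" by presburger
      then show ?thesis unfolding d lookup_theta_power m0_def
        by (cases J rule: ix_set_cases; simp only:; auto simp: lookup_add lookup_single when_def
            ix_set_eq_iff)
    qed
    then show "Poly_Mapping.lookup m k = Poly_Mapping.lookup ((theta ^^ a) m0) k"
      using z by (auto simp: k c_def)
  qed
  then have "(theta ^^ a) (rho (lmono 0 {X1, X2, X3}) m0) = 0"
    using sing[OF lmono_pos, of 0 "{X1, X2, X3}"] rho_xi3_theta_power[of "{X1, X2, X3}" a m0]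
    by (simp add: UNIV_ix ix_set_eq_iff)
  then have R: "rho (lmono 0 {X1, X2, X3}) m0 = 0" by (rule theta_power_eq_0)
  \<comment> \<open>The equations t \<xi>_i m = 0 descend to m0 at the cost of a term with factor 2
    a, which comes from moving t \<xi>_i past \<Theta>^a.\<close>
  have N: "theta (rho (lmono 1 {i}) m0) - mscale (2 * of_nat a) (eta i m0) = 0" for i
  proof (rule theta_power_eq_0[of a])
    show "(theta ^^ a) (theta (rho (lmono 1 {i}) m0) - mscale (2 * of_nat a) (eta i m0)) = 0"
      unfolding rho_txi_theta_power[symmetric]
      using sing[OF lmono_pos, of 1 "{i}"] \<open>m = (theta ^^ a) m0\<close> by simp
  qed
  let ?w = "c a {X1, X2, X3, X4}"
  \<comment> \<open>At \<eta>_I with I the complement of i \<le> 3, the equation R leaves only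
    \<plusminus> \<xi>_jk w, where {i, j, k} = {1, 2, 3}: the bracket of \<xi>_123 with the missing
    \<xi>_i.\<close>
  have F: "act (lmono 0 {X2, X3}) ?w = 0" "act (lmono 0 {X1, X3}) ?w = 0"
      "act (lmono 0 {X1, X2}) ?w = 0"
    using arg_cong[OF R, of "\<lambda>m. Poly_Mapping.lookup m (0, {X2, X3, X4})"]
      arg_cong[OF R, of "\<lambda>m. Poly_Mapping.lookup m (0, {X1, X3, X4})"]
      arg_cong[OF R, of "\<lambda>m. Poly_Mapping.lookup m (0, {X1, X2, X4})"]
    by (simp_all add: m0_def rho_add rho_compute grass_eval)
  have z: "v = 0" if "scale 2 v + scale (2 * of_nat a) v = 0" for v
  proof -
    have "2 + 2 * of_nat a = (of_nat (2 + 2 * a) :: complex)" by simp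
    then have "2 + 2 * of_nat a \<noteq> (0 :: complex)" by (simp only: of_nat_eq_0_iff)
    then show ?thesis using that by (simp flip: scale_left_distrib)
  qed
  have z': "v = 0" if "- scale 2 v = scale (2 * of_nat a) v" for v
    by (rule z) (simp flip: that)
  \<comment> \<open>In N at \<Theta> \<eta>_124 and \<Theta> \<eta>_134 the summands \<xi>_jk w
    vanish by F. What is left is 2 + 2 a times one coefficient up to sign: 2 from [1, t \<xi>_i] = 2
    \<xi>_i and 2 a from the extra term.\<close>
  have "scale 2 (c (Suc a) {X1, X4}) + scale (2 * of_nat a) (c (Suc a) {X1, X4}) = 0"
    "- scale 2 (c (Suc a) {X2, X4}) = scale (2 * of_nat a) (c (Suc a) {X2, X4})"
    "- scale 2 (c (Suc a) {X3, X4}) = scale (2 * of_nat a) (c (Suc a) {X3, X4})"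
    using arg_cong[OF N[of X2], of "\<lambda>m. Poly_Mapping.lookup m (1, {X1, X2, X4})"]
      arg_cong[OF N[of X1], of "\<lambda>m. Poly_Mapping.lookup m (1, {X1, X2, X4})"]
      arg_cong[OF N[of X1], of "\<lambda>m. Poly_Mapping.lookup m (1, {X1, X3, X4})"]
    by (simp_all add: m0_def rho_add rho_compute grass_eval lookup_theta F)
  then have V: "c (Suc a) {X1, X4} = 0" "c (Suc a) {X2, X4} = 0" "c (Suc a) {X3, X4} = 0"
    using z z' by blast+
  \<comment> \<open>In R at \<Theta> \<eta>_4, once F and V are used, only multiples of w produced
    by \<eta>_i \<eta>_i = - \<Theta> / 2 remain, and their sum is not the zero multiple.\<close>
  have "- scale (1 / 2) ?w = scale (1 / 2) ?w - (?w - scale (1 / 2) ?w)"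
    using arg_cong[OF R, of "\<lambda>m. Poly_Mapping.lookup m (1, {X4})"] V
    by (simp add: m0_def rho_add rho_compute grass_eval F)
  moreover have half: "scale (1 / 2) ?w + scale (1 / 2) ?w = ?w"
    by (simp only: scale_left_distrib[symmetric]) simp
  ultimately have "scale (1 / 2) ?w = 0"
    by (metis add.inverse_inverse add_diff_cancel_left' diff_self neg_equal_0_iff_equal)
  then have "?w = 0" by simp
  then show ?thesis by (simp add: c_def UNIV_ix)
qed

lemma singular_model_zero:
  assumes "3 < k" "m \<in> M_comp k" and sing: "\<And>x. x \<in> lie_pos \<Longrightarrow> rho x m = 0"
  shows "m = 0"
proof -
  \<comment> \<open>The full set is excluded by \<open>top_coefficient_zero\<close>; any other set
    contributes at most 3 < k to the degree, so the exponent of \<Theta> is positive.\<close>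
  have nz: "b \<noteq> 0 \<and> J \<noteq> UNIV" if "Poly_Mapping.lookup m (b, J) \<noteq> 0" for b J
  proof -
    have card: "card (UNIV :: ix set) = 4" by (simp add: UNIV_ix)
    have k: "2 * b + card J = k" using that assms(2) by (auto simp: M_comp_def)
    have "J \<noteq> UNIV"
    proof
      assume "J = UNIV"
      then have "m \<in> M_comp (2 * b + 4)" using k card assms(2) by simp
      then show False using top_coefficient_zero[of m b] sing that \<open>J = UNIV\<close> by simp
    qed
    moreover have "card J < 4" using \<open>J \<noteq> UNIV\<close> psubset_card_mono[of UNIV J] card by auto
    ultimately show ?thesis using k assms(1) by auto
  qed
  \<comment> \<open>Induction on the exponent supplies the vanishing of the lower coefficients that
    \<open>leading_coefficient_zero\<close> assumes.\<close>
  have "\<forall>J. Poly_Mapping.lookup m (b, J) = 0" for b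
  proof (induction b rule: less_induct)
    case (less b)
    show ?case
    proof (rule allI, rule ccontr)
      fix J assume J: "Poly_Mapping.lookup m (b, J) \<noteq> 0"
      then obtain a i where "b = Suc a" "i \<notin> J" using nz[OF J] by (cases b) auto
      then show False
        using leading_coefficient_zero[of i m J a] sing[OF lmono_pos, of 1 "{i}"] less J by simp
    qed
  qed
  then show ?thesis by (intro poly_mapping_eqI) auto
qed

end

theorem theorem6p9:
  fixes scale :: "complex \<Rightarrow> 'f \<Rightarrow> 'f::ab_group_add"
    and part :: "nat \<Rightarrow> 'f set"
    and act :: "lie \<Rightarrow> 'f \<Rightarrow> 'f"
  assumes "fd_irreducible_nonneg_module scale part act"
  shows "\<not> (\<exists>k X. k > 3 \<and> X \<in> ind_comp scale act k \<and> X \<noteq> ind_zero scale act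
              \<and> singular scale act X)"
proof -
  interpret fd_irreducible_nonneg_module scale part act by fact
  show ?thesis using singular_model_vector singular_model_zero by metis
qed

end
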